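(* Let $m,n$ be positive integers, let $k$ be an integer with $1\le k\le\min\{m,n-1\}$, and let $f\in\mathcal{S}(S^m)$ be a symmetric $m$-tensor field on $\mathbb{R}^n$ with Schwartz components. Then the following conditions are equivalent: (1) $\mathcal{I}^k f=0$. (2) $f=\mathrm{d}^{k+1}v$ for some (smooth, symmetric) $(m-k-1)$-tensor field $v$ on $\mathbb{R}^n$ satisfying $\mathrm{d}^\ell v(x)\to 0$ as $|x|\to\infty$ for $0\le\ell\le k$. (When $k=m$, there are no nonzero $(-1)$-tensor fields and this condition means $f=0$.) (3) $W^k f=0$.
   Context: Notation. $\mathcal{S}(S^m)$ is the space of covariant symmetric $m$-tensor fields $f=f_{i_1\dots i_m}(x)\,dx^{i_1}\cdots dx^{i_m}$ on $\mathbb{R}^n$ whose components $f_{i_1\dots i_m}$ (symmetric in all indices) belong to the Schwartz space $\mathcal{S}(\mathbb{R}^n)$. Indices run from $1$ to $n$. The Einstein summation convention is used for repeated indices, and upper and lower indices are not distinguished (Euclidean metric). $S^m$ denotes the space of symmetric $m$-tensors on $\mathbb{R}^n$, and $C^\infty(S^m)$ the smooth symmetric $m$-tensor fields. Integral moment transforms. Let $T\mathbb{S}^{n-1}=\{(x,\xi)\in\mathbb{R}^n\times\mathbb{R}^n : |\xi|=1,\ \langle x,\xi\rangle=0\}$. For an integer $q\ge 0$, the $q$-th integral moment transform of $f\in\mathcal{S}(S^m)$ is the function on $T\mathbb{S}^{n-1}$ $$(I^q f)(x,\xi)=\int_{-\infty}^{\infty} t^q f_{i_1\dots i_m}(x+t\xi)\,\xi^{i_1}\cdots\xi^{i_m}\,dt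 .$$ Set $\mathcal{I}^k f=(I^0 f, I^1 f,\dots, I^k f)$ on $T\mathbb{S}^{n-1}$. Symmetrization. $\sigma(a_1\dots a_r)$ denotes symmetrization over the listed indices: the average, over all $r!$ permutations of the indices $a_1,\dots,a_r$, of the expression that follows it. Inner differentiation. $\mathrm{d}:C^\infty(S^r)\to C^\infty(S^{r+1})$ is the symmetrized derivative $(\mathrm{d}u)_{i_1\dots i_{r+1}}=\sigma(i_1\dots i_{r+1})\,\dfrac{\partial u_{i_1\dots i_r}}{\partial x^{i_{r+1}}}$, and $\mathrm{d}^\ell$ is its $\ell$-fold iterate, with $\mathrm{d}^0$ the identity. Generalized Saint Venant operator. For fixed $i_1,\dots,i_k$, let $f^{i_1\cdots i_k}$ be the symmetric $(m-k)$-tensor field with components $f^{i_1\cdots i_k}_{j_1\dots j_{m-k}}=f_{i_1\dots i_k j_1\dots j_{m-k}}$. For $0\le k\le m$, the generalized Saint Venant operator $W^k:C^\infty(S^m)\to C^\infty(S^{m-k}\otimes S^{m})$ is $$(W^k f)_{p_1\dots p_{m-k}q_1\dots q_{m-k}i_1\dots i_k}=\sigma(p_1\dots p_{m-k})\,\sigma(q_1\dots q_{m-k}\,i_1\dots i_k)\sum_{\ell=0}^{m-k}(-1)^\ell\binom{m-k}{\ell}\frac{\partial^{m-k} f^{i_1\dots i_k}_{p_1\dots p_{m-k-\ell}\,q_1\dots q_\ell}}{\partial x^{p_{m-k-\ell+1}}\cdots\partial x^{p_{m-k}}\,\partial x^{q_{\ell+1}}\cdots\partial x^{q_{m-k}}}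 .$$ *)

theory Defs
  imports "HOL-Analysis.Analysis" "HOL-Combinatorics.Permutations"
begin

text \<open>
  An index list \<open>[i\<^sub>1, \<dots>, i\<^sub>m] :: 'n list\<close> stands for the multi-index \<open>i\<^sub>1\<dots>i\<^sub>m\<close>, each index ranging
  over the \<open>n = CARD('n)\<close> coordinates of \<open>real ^ 'n\<close>.  A tensor field is given by its components,
  \<open>u is x = u\<^bsub>i\<^sub>1\<dots>i\<^sub>m\<^esub>(x)\<close>.  Since the rank is not part of the type, a field of rank \<open>m\<close> is required to
  vanish on lists of length other than \<open>m\<close>, so that equality of fields of the same rank is
  equality of functions.
\<close>

type_synonym ('n, 'a) tensor_field = "'n list \<Rightarrow> real ^ 'n \<Rightarrow> 'a"

definition symmetric_tensor_field :: "nat \<Rightarrow> ('n::finite, 'a::zero) tensor_field \<Rightarrow> bool" where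
  "symmetric_tensor_field m u \<longleftrightarrow>
     (\<forall>is. length is \<noteq> m \<longrightarrow> u is = (\<lambda>x. 0)) \<and>
     (\<forall>is \<pi>. length is = m \<and> \<pi> permutes {..<m} \<longrightarrow> u (permute_list \<pi> is) = u is)"

definition partial_derivative ::
    "'n::finite \<Rightarrow> (real ^ 'n \<Rightarrow> 'a::real_normed_vector) \<Rightarrow> real ^ 'n \<Rightarrow> 'a" where
  "partial_derivative i g x = frechet_derivative g (at x) (axis i 1)"

definition partial_derivatives ::
    "'n::finite list \<Rightarrow> (real ^ 'n \<Rightarrow> 'a::real_normed_vector) \<Rightarrow> real ^ 'n \<Rightarrow> 'a" where
  "partial_derivatives is g = foldr partial_derivative is g"

definition smooth :: "(real ^ 'n::finite \<Rightarrow> 'a::real_normed_vector) \<Rightarrow> bool" where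
  "smooth g \<longleftrightarrow> (\<forall>is x. partial_derivatives is g differentiable at x)"

definition schwartz :: "(real ^ 'n::finite \<Rightarrow> 'a::real_normed_vector) \<Rightarrow> bool" where
  "schwartz g \<longleftrightarrow> smooth g \<and>
     (\<forall>N is. bounded (range (\<lambda>x. (1 + norm x) ^ N *\<^sub>R partial_derivatives is g x)))"

definition smooth_symmetric_tensor_field ::
    "nat \<Rightarrow> ('n::finite, 'a::real_normed_vector) tensor_field \<Rightarrow> bool" where
  "smooth_symmetric_tensor_field m u \<longleftrightarrow> symmetric_tensor_field m u \<and> (\<forall>is. smooth (u is))"

definition schwartz_symmetric_tensor_field ::
    "nat \<Rightarrow> ('n::finite, 'a::real_normed_vector) tensor_field \<Rightarrow> bool" where
  "schwartz_symmetric_tensor_field m u \<longleftrightarrow> symmetric_tensor_field m u \<and> (\<forall>is. schwartz (u is))"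

definition sphere_tangent_bundle :: "((real ^ 'n::finite) \<times> (real ^ 'n)) set" where
  "sphere_tangent_bundle = {(x, \<xi>). norm \<xi> = 1 \<and> x \<bullet> \<xi> = 0}"

definition moment_transform ::
    "nat \<Rightarrow> nat \<Rightarrow> ('n::finite, 'a::euclidean_space) tensor_field \<Rightarrow>
     real ^ 'n \<Rightarrow> real ^ 'n \<Rightarrow> 'a" where
  "moment_transform m q f x \<xi> =
     (LINT t|lborel. t ^ q *\<^sub>R
        (\<Sum>is | length is = m. prod_list (map (\<lambda>i. \<xi> $ i) is) *\<^sub>R f is (x + t *\<^sub>R \<xi>)))"

definition symmetrization :: "('n list \<Rightarrow> 'a::real_vector) \<Rightarrow> 'n list \<Rightarrow> 'a" where
  "symmetrization F is =
     (1 / fact (length is)) *\<^sub>R (\<Sum>\<pi> | \<pi> permutes {..<length is}. F (permute_list \<pi> is))"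

text \<open>
  The rank of \<open>u\<close> need not be given: for \<open>u\<close> of rank \<open>r\<close>, the right-hand side vanishes on lists of
  length other than \<open>r + 1\<close>.  The empty list is separate because \<open>last []\<close> is unspecified.
\<close>

definition inner_derivative ::
    "('n::finite, 'a::real_normed_vector) tensor_field \<Rightarrow> ('n, 'a) tensor_field" where
  "inner_derivative u is x =
     (if is = [] then 0
      else symmetrization (\<lambda>js. partial_derivative (last js) (u (butlast js)) x) is)"

definition fix_indices :: "'n list \<Rightarrow> ('n, 'a) tensor_field \<Rightarrow> ('n, 'a) tensor_field" where
  "fix_indices is f js = f (is @ js)"

text \<open>
  \<open>saint_venant m k f ps qs is x\<close> is the component at \<open>x\<close> of \<open>W\<^sup>k f\<close> with indices \<open>p\<^sub>1\<dots>p\<^bsub>m-k\<^esub>\<close>,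
  \<open>q\<^sub>1\<dots>q\<^bsub>m-k\<^esub>\<close>, \<open>i\<^sub>1\<dots>i\<^sub>k\<close>; it is meaningful only for lists of these lengths.  In the symmetrization over
  \<open>q\<^sub>1\<dots>q\<^bsub>m-k\<^esub>i\<^sub>1\<dots>i\<^sub>k\<close> the permuted list \<open>r\<close> of length \<open>m\<close> is split again into its first \<open>m - k\<close> and its
  last \<open>k\<close> entries.
\<close>

definition saint_venant_summand ::
    "nat \<Rightarrow> nat \<Rightarrow> ('n::finite, 'a::real_normed_vector) tensor_field \<Rightarrow>
     'n list \<Rightarrow> 'n list \<Rightarrow> 'n list \<Rightarrow> real ^ 'n \<Rightarrow> 'a" where
  "saint_venant_summand m k f p q i x =
     (\<Sum>l = 0..m - k. ((- 1) ^ l * real ((m - k) choose l)) *\<^sub>R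
        partial_derivatives (drop (m - k - l) p @ drop l q)
          (fix_indices i f (take (m - k - l) p @ take l q)) x)"

definition saint_venant ::
    "nat \<Rightarrow> nat \<Rightarrow> ('n::finite, 'a::real_normed_vector) tensor_field \<Rightarrow>
     'n list \<Rightarrow> 'n list \<Rightarrow> 'n list \<Rightarrow> real ^ 'n \<Rightarrow> 'a" where
  "saint_venant m k f ps qs is x =
     symmetrization (\<lambda>p.
       symmetrization (\<lambda>r. saint_venant_summand m k f p (take (m - k) r) (drop (m - k) r) x)
         (qs @ is)) ps"

end

theory Submission
  imports Defs "HOL-Probability.Probability"
begin

text \<open>
  Contract a tensor field of rank \<open>r\<close> with \<open>r\<close> copies of one vector \<open>\<xi>\<close>.  By polarization a symmetric
  field is determined by this contraction, and the notions of the theorem become simple: \<open>f\<close> turns into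
  a function \<open>P(x, \<xi>)\<close> that is a form of degree \<open>m\<close> in \<open>\<xi>\<close>, the transform \<open>I\<^sup>q f\<close> into the moment
  \<open>\<integral> t\<^sup>q P(x + t \<xi>, \<xi>) dt\<close>, the inner derivative into the derivative \<open>D\<^sub>\<xi>\<close> in \<open>x\<close> along \<open>\<xi>\<close>, and \<open>W\<^sup>k f\<close>,
  contracted with \<open>m - k\<close> copies of \<open>\<eta>\<close> and \<open>m\<close> copies of \<open>\<xi>\<close>, into
  \<open>w(x; \<eta>, \<xi>) = \<Sum>\<^sub>l (-1)\<^sup>l (m-k choose l) D\<^sub>\<eta>\<^sup>l D\<^sub>\<xi>\<^bsup>m-k-l\<^esup> \<langle>f, \<eta>\<^bsup>m-k-l\<^esup> \<xi>\<^bsup>k+l\<^esup>\<rangle>\<close> (\<open>saint_venant_form_eq\<close>).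

  Everything rests on one identity.  Let \<open>T\<close> be the line or the half-line \<open>t \<ge> 0\<close>, and let \<open>\<xi>\<^sub>s = \<xi> + s \<eta>\<close>.
  Then the derivative of order \<open>m - k\<close> in \<open>s\<close> of \<open>\<integral>\<^sub>T t\<^sup>k P(x + t \<xi>\<^sub>s, \<xi>\<^sub>s) dt\<close> is, up to sign,
  \<open>\<integral>\<^sub>T t\<^sup>m w(x + t \<xi>\<^sub>s; \<eta>, \<xi>\<^sub>s) dt\<close>: each differentiation acts either on the point, where it gives
  \<open>t D\<^sub>\<eta>\<close>, or on one of the arguments \<open>\<xi>\<^sub>s\<close> of \<open>f\<close>, and integration by parts trades the missing powers
  of \<open>t\<close> for derivatives \<open>D\<^sub>\<xi>\<close> (\<open>moment_derivative_has_vector_derivative\<close>, \<open>moment_saint_venant_form\<close>).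

  Vanishing moments imply \<open>W\<^sup>k f = 0\<close>.  With \<open>T\<close> the line, the identity shows that the moment of order \<open>m\<close>
  of \<open>w\<close> vanishes, hence so do those of lower order.  Now \<open>w\<close> is a form of degree \<open>m\<close> in \<open>\<xi>\<close> all of
  whose moments of order at most \<open>m\<close> vanish, and such a form is zero (\<open>vanishing_moments_imp_zero\<close>):
  differentiation in \<open>s\<close> lowers the order and the degree together, until each coefficient has
  vanishing X-ray transform, and the X-ray transform is injective (\<open>xray_transform_injective\<close>) by the
  Fourier slice argument and uniqueness for Fourier integrals on the line.

  \<open>W\<^sup>k f = 0\<close> implies the existence of a potential.  With \<open>T\<close> the half-line, the identity shows that
  \<open>V(x, \<xi>) = \<integral>\<^sub>0\<^sup>\<infinity> t\<^sup>k P(x + t \<xi>, \<xi>) dt\<close> is a polynomial of degree less than \<open>m - k\<close> in \<open>s\<close> along each line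
  \<open>\<xi> + s \<eta>\<close> that avoids the origin.  As \<open>V\<close> is homogeneous of degree \<open>m - k - 1\<close> under positive scaling,
  it is a form of degree \<open>m - k - 1\<close> in \<open>\<xi>\<close> (\<open>half_line_moment_homogeneous_polynomial\<close>), so it is the
  contraction of a symmetric field, and \<open>D\<^sub>\<xi>\<^bsup>k+1\<^esup> V = (-1)\<^bsup>k+1\<^esup> k! P\<close> makes a multiple of this field a
  potential of \<open>f\<close>.  The parity of \<open>V\<close> says that the half-line moments along \<open>\<xi>\<close> and \<open>-\<xi>\<close> cancel;
  therefore \<open>V(x, \<xi>)\<close> may be integrated over the half-line that leads away from the origin, which
  makes it and its derivatives decay (\<open>moment_half_line_tendsto_zero\<close>).  For \<open>k = m\<close> the form \<open>w\<close> is
  \<open>P\<close> itself, and \<open>W\<^sup>k f = 0\<close> means \<open>f = 0\<close>.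

  The existence of a potential implies vanishing moments.  Along a line, the contractions of
  \<open>v, d v, \<dots>, d\<^bsup>k+1\<^esup> v = f\<close> are successive derivatives of one function.  All tend to zero and the last one
  decreases rapidly, so all do, and integration by parts kills the moments of order at most \<open>k\<close>
  (\<open>potential_imp_moments_zero\<close>).
\<close>

section \<open>Contractions\<close>

definition monomial :: "real ^ 'n::finite \<Rightarrow> 'n list \<Rightarrow> real" where
  "monomial \<xi> is = prod_list (map (\<lambda>i. \<xi> $ i) is)"

text \<open>
  The value at \<open>(\<xi>, \<dots>, \<xi>)\<close> of the multilinear form with components \<open>T\<close>.
\<close>

definition contraction :: "nat \<Rightarrow> ('n::finite list \<Rightarrow> 'a::real_vector) \<Rightarrow> real ^ 'n \<Rightarrow> 'a" where
  "contraction r T \<xi> = (\<Sum>is | length is = r. monomial \<xi> is *\<^sub>R T is)"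

text \<open>
  Symmetry is phrased with multisets because they make reorderings of concatenated index lists
  trivial; no condition is put on lists of length other than \<open>r\<close>.
\<close>

definition symmetric_on :: "nat \<Rightarrow> ('n list \<Rightarrow> 'a) \<Rightarrow> bool" where
  "symmetric_on r T \<longleftrightarrow> (\<forall>is js. length is = r \<longrightarrow> mset is = mset js \<longrightarrow> T is = T js)"

lemma symmetric_onD:
  "symmetric_on r T \<Longrightarrow> length is = r \<Longrightarrow> mset is = mset js \<Longrightarrow> T is = T js"
  by (auto simp: symmetric_on_def)

lemma symmetric_on_Cons: "symmetric_on (Suc r) T \<Longrightarrow> symmetric_on r (\<lambda>is. T (i # is))"
  unfolding symmetric_on_def
proof (intro allI impI)
  fix "is" js :: "'a list"
  assume *: "\<forall>is js. length is = Suc r \<longrightarrow> mset is = mset js \<longrightarrow> T is = T js" "length is = r" "mset is = mset js"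
  show "T (i # is) = T (i # js)" using *(1)[rule_format, of "i # is" "i # js"] *(2,3) by simp
qed

lemma finite_lists_length [simp]: "finite {is :: 'n::finite list. length is = r}"
  using finite_lists_length_eq[of "UNIV :: 'n set" r] by simp

lemma monomial_simps [simp]:
  "monomial \<xi> [] = 1" "monomial \<xi> (i # is) = \<xi> $ i * monomial \<xi> is"
  "monomial \<xi> (is @ js) = monomial \<xi> is * monomial \<xi> js"
  by (simp_all add: monomial_def)

lemma monomial_mset_cong: "mset is = mset js \<Longrightarrow> monomial \<xi> is = monomial \<xi> js"
  unfolding monomial_def by (metis mset_map prod_mset_prod_list)

lemma monomial_scaleR: "monomial (c *\<^sub>R \<xi>) is = c ^ length is * monomial \<xi> is"
  by (induction "is") auto

lemma contraction_0 [simp]: "contraction 0 T \<xi> = T []"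
  by (simp add: contraction_def)

lemma sum_lists_length_add:
  fixes F :: "'n::finite list \<Rightarrow> 'a::comm_monoid_add"
  shows "(\<Sum>is | length is = a + b. F is) = (\<Sum>p | length p = a. \<Sum>q | length q = b. F (p @ q))"
proof -
  have "(\<Sum>p | length p = a. \<Sum>q | length q = b. F (p @ q)) =
        (\<Sum>(p, q)\<in>{p. length p = a} \<times> {q. length q = b}. F (p @ q))"
    by (simp add: sum.cartesian_product)
  also have "\<dots> = (\<Sum>is | length is = a + b. F is)"
    by (rule sum.reindex_bij_witness[of _ "\<lambda>is. (take a is, drop a is)" "\<lambda>(p, q). p @ q"]) auto
  finally show ?thesis by simp
qed

lemma contraction_add:
  "contraction (a + b) T \<xi> = contraction a (\<lambda>p. contraction b (\<lambda>q. T (p @ q)) \<xi>) \<xi>"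
  by (simp add: contraction_def sum_lists_length_add scaleR_sum_right)

lemma contraction_1: "contraction (Suc 0) T \<xi> = (\<Sum>i\<in>UNIV. \<xi> $ i *\<^sub>R T [i])"
  unfolding contraction_def
  by (rule sum.reindex_bij_witness[of _ "\<lambda>i. [i]" hd]) (auto simp: length_Suc_conv)

lemma contraction_Suc:
  "contraction (Suc r) T \<xi> = (\<Sum>i\<in>UNIV. \<xi> $ i *\<^sub>R contraction r (\<lambda>is. T (i # is)) \<xi>)"
  using contraction_add[of "Suc 0" r T \<xi>] by (simp add: contraction_1)

lemma contraction_Suc_last:
  "contraction (Suc r) T \<xi> = contraction r (\<lambda>is. \<Sum>i\<in>UNIV. \<xi> $ i *\<^sub>R T (is @ [i])) \<xi>"
  using contraction_add[of r "Suc 0" T \<xi>] by (simp add: contraction_1)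

lemma contraction_cong:
  "r = r' \<Longrightarrow> (\<And>is. length is = r' \<Longrightarrow> S is = T is) \<Longrightarrow> \<xi> = \<xi>' \<Longrightarrow>
    contraction r S \<xi> = contraction r' T \<xi>'"
  by (auto simp: contraction_def intro!: sum.cong)

lemma contraction_zero [simp]: "contraction r (\<lambda>is. 0) \<xi> = 0"
  by (simp add: contraction_def)

lemma contraction_sum:
  "contraction r (\<lambda>is. \<Sum>j\<in>J. T j is) \<xi> = (\<Sum>j\<in>J. contraction r (T j) \<xi>)"
  by (simp add: contraction_def scaleR_sum_right) (rule sum.swap)

lemma contraction_add_fun:
  "contraction r (\<lambda>is. S is + T is) \<xi> = contraction r S \<xi> + contraction r T \<xi>"
  by (simp add: contraction_def scaleR_add_right sum.distrib)

lemma contraction_scaleR_fun: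
  "contraction r (\<lambda>is. c *\<^sub>R T is) \<xi> = c *\<^sub>R contraction r T \<xi>"
  by (simp add: contraction_def scaleR_sum_right mult.commute)

lemma contraction_swap:
  "contraction a (\<lambda>p. contraction b (\<lambda>q. F p q) \<xi>) \<eta> = contraction b (\<lambda>q. contraction a (\<lambda>p. F p q) \<eta>) \<xi>"
  unfolding contraction_def scaleR_sum_right by (subst sum.swap) (simp add: mult.commute)

lemma contraction_scaleR: "contraction r T (c *\<^sub>R \<xi>) = c ^ r *\<^sub>R contraction r T \<xi>"
  by (simp add: contraction_def monomial_scaleR scaleR_sum_right)

lemma contraction_zero_vector: "0 < r \<Longrightarrow> contraction r T 0 = 0"
  using contraction_scaleR[of r T 0 0] by (cases r) auto

lemma continuous_on_contraction [continuous_intros]: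
  fixes T :: "'n::finite list \<Rightarrow> 'b::topological_space \<Rightarrow> 'a::real_normed_vector"
  assumes "\<And>is. continuous_on A (T is)" "continuous_on A g"
  shows "continuous_on A (\<lambda>x. contraction r (\<lambda>is. T is x) (g x))"
proof -
  have "continuous_on A (\<lambda>x. monomial (g x) is)" for "is" :: "'n list"
    by (induction "is") (auto intro!: continuous_intros assms)
  then show ?thesis unfolding contraction_def by (intro continuous_intros assms)
qed

section \<open>Polynomials along a line\<close>

lemma poly_eq_sum_up_to:
  fixes p :: "'a::comm_semiring_1 poly"
  assumes "degree p \<le> d"
  shows "poly p x = (\<Sum>j\<le>d. coeff p j * x ^ j)"
  unfolding poly_altdef by (rule sum.mono_neutral_left) (use assms in \<open>auto simp: coeff_eq_0\<close>)

lemma monomial_line: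
  "\<exists>c. \<forall>s. monomial (\<xi> + s *\<^sub>R \<eta>) is = (\<Sum>j\<le>length is. c j * s ^ j)"
proof -
  define p where "p = prod_list (map (\<lambda>i. [:\<xi> $ i, \<eta> $ i:]) is)"
  have "poly p s = monomial (\<xi> + s *\<^sub>R \<eta>) is" for s
    unfolding p_def by (induction "is") (auto simp: algebra_simps)
  moreover have "degree p \<le> length is"
    unfolding p_def
  proof (induction "is")
    case (Cons i "is")
    have "degree [:\<xi> $ i, \<eta> $ i:] \<le> 1" by simp
    then show ?case
      using Cons degree_mult_le[of "[:\<xi> $ i, \<eta> $ i:]" "prod_list (map (\<lambda>i. [:\<xi> $ i, \<eta> $ i:]) is)"]
      by (simp del: mult_pCons_left degree_pCons_eq_if)
  qed simp
  ultimately have "monomial (\<xi> + s *\<^sub>R \<eta>) is = (\<Sum>j\<le>length is. coeff p j * s ^ j)" for s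
    by (metis poly_eq_sum_up_to)
  then show ?thesis by blast
qed


text \<open>
  The coefficients \<open>c\<close> of the polynomial \<open>s \<mapsto> T(\<xi> + s \<eta>, \<dots>, \<xi> + s \<eta>)\<close> do not depend on \<open>T\<close>.  Hence
  for a field \<open>T\<close> the coefficients of the polynomial are linear combinations, with constant
  coefficients, of the components of \<open>T\<close>, and inherit their regularity and decay.
\<close>

lemma contraction_line_coeffs:
  fixes \<xi> \<eta> :: "real ^ 'n::finite"
  shows "\<exists>c. \<forall>(T :: 'n list \<Rightarrow> 'a::real_vector) s.
    contraction r T (\<xi> + s *\<^sub>R \<eta>) = (\<Sum>j\<le>r. s ^ j *\<^sub>R (\<Sum>is | length is = r. c is j *\<^sub>R T is))"
proof -
  obtain c where c: "\<And>is s. monomial (\<xi> + s *\<^sub>R \<eta>) is = (\<Sum>j\<le>length is. c is j * s ^ j)"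
    using monomial_line[of \<xi> \<eta>] by metis
  have "contraction r T (\<xi> + s *\<^sub>R \<eta>) = (\<Sum>j\<le>r. s ^ j *\<^sub>R (\<Sum>is | length is = r. c is j *\<^sub>R T is))"
    for T :: "'n list \<Rightarrow> 'a" and s
    unfolding contraction_def c scaleR_sum_left scaleR_sum_right
    by (subst sum.swap) (auto intro!: sum.cong simp: mult.commute)
  then show ?thesis by blast
qed

text \<open>
  By symmetry, each of the \<open>r\<close> arguments \<open>\<xi> + s \<eta>\<close> contributes the same term when it is
  differentiated.
\<close>

lemma contraction_has_vector_derivative:
  fixes T :: "'n::finite list \<Rightarrow> real \<Rightarrow> 'a::real_normed_vector"
  assumes "\<And>is. length is = r \<Longrightarrow> (T is has_vector_derivative T' is) (at s)"
    and "symmetric_on r (\<lambda>is. T is s)"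
  shows "((\<lambda>s. contraction r (\<lambda>is. T is s) (\<xi> + s *\<^sub>R \<eta>)) has_vector_derivative
    contraction r (\<lambda>is. T' is) (\<xi> + s *\<^sub>R \<eta>) +
    real r *\<^sub>R contraction (r - 1) (\<lambda>is. \<Sum>i\<in>UNIV. \<eta> $ i *\<^sub>R T (i # is) s) (\<xi> + s *\<^sub>R \<eta>)) (at s)"
  using assms
proof (induction r arbitrary: T T')
  case 0
  then show ?case by simp
next
  case (Suc r)
  let ?z = "\<xi> + s *\<^sub>R \<eta>"
  have IH: "((\<lambda>s. contraction r (\<lambda>is. T (i # is) s) (\<xi> + s *\<^sub>R \<eta>)) has_vector_derivative
      contraction r (\<lambda>is. T' (i # is)) ?z +
      real r *\<^sub>R contraction (r - 1) (\<lambda>is. \<Sum>j\<in>UNIV. \<eta> $ j *\<^sub>R T (i # j # is) s) ?z) (at s)" for i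
    by (rule Suc.IH) (auto intro: Suc.prems symmetric_on_Cons)
  have coord: "((\<lambda>s. (\<xi> + s *\<^sub>R \<eta>) $ i) has_real_derivative \<eta> $ i) (at s)" for i
    by (auto intro!: derivative_eq_intros)
  have deriv: "((\<lambda>s. \<Sum>i\<in>UNIV. (\<xi> + s *\<^sub>R \<eta>) $ i *\<^sub>R contraction r (\<lambda>is. T (i # is) s) (\<xi> + s *\<^sub>R \<eta>))
      has_vector_derivative (\<Sum>i\<in>UNIV. ?z $ i *\<^sub>R (contraction r (\<lambda>is. T' (i # is)) ?z +
      real r *\<^sub>R contraction (r - 1) (\<lambda>is. \<Sum>j\<in>UNIV. \<eta> $ j *\<^sub>R T (i # j # is) s) ?z) +
      (\<eta> $ i) *\<^sub>R contraction r (\<lambda>is. T (i # is) s) ?z)) (at s)"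
    by (intro has_vector_derivative_sum has_vector_derivative_scaleR coord IH)
  have "(\<Sum>i\<in>UNIV. ?z $ i *\<^sub>R contraction (r - 1) (\<lambda>is. \<Sum>j\<in>UNIV. \<eta> $ j *\<^sub>R T (i # j # is) s) ?z) =
      contraction r (\<lambda>is. \<Sum>j\<in>UNIV. \<eta> $ j *\<^sub>R T (j # is) s) ?z" if pos: "r > 0"
  proof -
    obtain r' where r: "r = Suc r'" using pos by (cases r) auto
    have "T (i # j # is) s = T (j # i # is) s" if "length is = r'" for i j "is"
      by (rule symmetric_onD[OF Suc.prems(2)]) (use that r in auto)
    then show ?thesis
      by (simp only: r contraction_Suc diff_Suc_1) (intro sum.cong contraction_cong refl arg_cong2[of _ _ _ _ scaleR], simp)
  qed
  then have "(\<Sum>i\<in>UNIV. ?z $ i *\<^sub>R (real r *\<^sub>R contraction (r - 1) (\<lambda>is. \<Sum>j\<in>UNIV. \<eta> $ j *\<^sub>R T (i # j # is) s) ?z)) =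
      real r *\<^sub>R contraction r (\<lambda>is. \<Sum>j\<in>UNIV. \<eta> $ j *\<^sub>R T (j # is) s) ?z"
    by (cases "r > 0") (simp_all only: scaleR_left_commute[of _ "real r"] scaleR_sum_right[symmetric], simp)
  then have "(\<Sum>i\<in>UNIV. ?z $ i *\<^sub>R (contraction r (\<lambda>is. T' (i # is)) ?z +
      real r *\<^sub>R contraction (r - 1) (\<lambda>is. \<Sum>j\<in>UNIV. \<eta> $ j *\<^sub>R T (i # j # is) s) ?z) +
      (\<eta> $ i) *\<^sub>R contraction r (\<lambda>is. T (i # is) s) ?z) =
    contraction (Suc r) T' ?z + (real r *\<^sub>R contraction r (\<lambda>is. \<Sum>j\<in>UNIV. \<eta> $ j *\<^sub>R T (j # is) s) ?z +
      contraction r (\<lambda>is. \<Sum>j\<in>UNIV. \<eta> $ j *\<^sub>R T (j # is) s) ?z)"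
    by (simp only: contraction_Suc[of r T'] scaleR_add_right sum.distrib contraction_sum contraction_scaleR_fun add.assoc)
  also have "\<dots> = contraction (Suc r) T' ?z + real (Suc r) *\<^sub>R
      contraction (Suc r - 1) (\<lambda>is. \<Sum>j\<in>UNIV. \<eta> $ j *\<^sub>R T (j # is) s) ?z"
    by (simp add: scaleR_add_left add.commute)
  finally show ?case using deriv by (simp only: contraction_Suc[of r "\<lambda>is. T is _"])
qed

text \<open>
  Lagrange interpolation: the coefficients of a polynomial of degree at most \<open>d\<close> are fixed linear
  combinations of its values at \<open>0, \<dots>, d\<close>.
\<close>

lemma vector_polynomial_coeffs:
  "\<exists>c. \<forall>(a :: nat \<Rightarrow> 'a::real_vector) j. j \<le> d \<longrightarrow>
     a j = (\<Sum>l\<le>d. c l j *\<^sub>R (\<Sum>i\<le>d. real l ^ i *\<^sub>R a i))"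
proof -
  \<comment> \<open>the Lagrange basis polynomials at the nodes \<open>0, \<dots>, d\<close>\<close>
  define p where "p l = smult (1 / (\<Prod>i\<in>{..d} - {l}. real l - real i)) (\<Prod>i\<in>{..d} - {l}. [:- real i, 1:])" for l
  have deg: "degree (p l) \<le> d" if "l \<le> d" for l
  proof -
    have "degree (\<Prod>i\<in>{..d} - {l}. [:- real i, 1:]) \<le> (\<Sum>i\<in>{..d} - {l}. 1)"
      by (rule order_trans[OF degree_prod_sum_le]) (auto intro!: sum_mono)
    then show ?thesis using that by (auto simp: p_def)
  qed
  have val: "poly (p l) (real x) = of_bool (x = l)" if "l \<le> d" "x \<le> d" for l x
    using that by (auto simp: p_def poly_prod)
  have interp: "monom 1 i = (\<Sum>l\<le>d. smult (real l ^ i) (p l))" if "i \<le> d" for i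
  proof (rule poly_eqI_degree)
    fix x assume "x \<in> real ` {..d}"
    then show "poly (monom 1 i) x = poly (\<Sum>l\<le>d. smult (real l ^ i) (p l)) x"
      by (auto simp: poly_monom poly_sum val)
  next
    have "degree (\<Sum>l\<le>d. smult (real l ^ i) (p l)) \<le> d"
      by (intro degree_sum_le) (use deg in auto)
    then show "degree (\<Sum>l\<le>d. smult (real l ^ i) (p l)) < card (real ` {..d})"
      by (simp add: card_image)
    show "degree (monom (1::real) i) < card (real ` {..d})"
      using that by (simp add: card_image degree_monom_eq)
  qed
  have "a j = (\<Sum>l\<le>d. coeff (p l) j *\<^sub>R (\<Sum>i\<le>d. real l ^ i *\<^sub>R a i))" if "j \<le> d" for a :: "nat \<Rightarrow> 'a" and j
  proof -
    have "(\<Sum>l\<le>d. coeff (p l) j *\<^sub>R (\<Sum>i\<le>d. real l ^ i *\<^sub>R a i)) =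
          (\<Sum>i\<le>d. coeff (\<Sum>l\<le>d. smult (real l ^ i) (p l)) j *\<^sub>R a i)"
      unfolding coeff_sum scaleR_sum_left scaleR_sum_right by (subst sum.swap) (simp add: mult.commute)
    also have "\<dots> = (\<Sum>i\<le>d. coeff (monom 1 i) j *\<^sub>R a i)"
      by (intro sum.cong) (simp_all add: interp del: coeff_monom)
    also have "\<dots> = a j" using that by (simp add: if_distrib[of "\<lambda>x. x *\<^sub>R _"] sum.delta cong: if_cong)
    finally show ?thesis by simp
  qed
  then show ?thesis by (intro exI[of _ "\<lambda>l j. coeff (p l) j"]) blast
qed

lemma vector_polynomial_eqD:
  fixes a b :: "nat \<Rightarrow> 'a::real_vector"
  assumes "\<And>l. l \<le> d \<Longrightarrow> (\<Sum>i\<le>d. real l ^ i *\<^sub>R a i) = (\<Sum>i\<le>d. real l ^ i *\<^sub>R b i)" "j \<le> d"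
  shows "a j = b j"
proof -
  obtain c where c: "\<And>(a :: nat \<Rightarrow> 'a) j. j \<le> d \<Longrightarrow>
     a j = (\<Sum>l\<le>d. c l j *\<^sub>R (\<Sum>i\<le>d. real l ^ i *\<^sub>R a i))"
    using vector_polynomial_coeffs[of d, where 'a = 'a] by blast
  show ?thesis
    by (subst c[OF assms(2), of a], subst c[OF assms(2), of b]) (auto intro!: sum.cong simp: assms(1))
qed

section \<open>Polarization and symmetrization\<close>

text \<open>
  Every component of a symmetric tensor is a linear combination of its contractions with single
  vectors, so it belongs to every linear class \<open>S\<close> of functions that contains those contractions.
  The induction peels off one index \<open>i\<close>: the contraction with \<open>\<xi> + s e\<^sub>i\<close> is a polynomial in \<open>s\<close> whose
  linear coefficient is a multiple of the contraction of \<open>T(i, \<dots>)\<close> with \<open>\<xi>\<close>, and this coefficient is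
  a linear combination of values of the polynomial.
\<close>

lemma polarization:
  fixes T :: "'n::finite list \<Rightarrow> 'x \<Rightarrow> 'a::real_normed_vector"
  assumes add: "\<And>g h. S g \<Longrightarrow> S h \<Longrightarrow> S (\<lambda>x. g x + h x)"
    and scale: "\<And>c g. S g \<Longrightarrow> S (\<lambda>x. c *\<^sub>R g x)"
    and zero: "S (\<lambda>x. 0)"
    and sym: "symmetric_on r T"
    and diag: "\<And>\<xi>. S (\<lambda>x. contraction r (\<lambda>is. T is x) \<xi>)"
    and len: "length is = r"
  shows "S (T is)"
  using sym diag len
proof (induction r arbitrary: T "is")
  case 0
  then show ?case by simp
next
  case (Suc r)
  obtain i is' where is_eq: "is = i # is'" "length is' = r" using Suc.prems(3) by (cases "is") auto
  have S_sum: "S (\<lambda>x. \<Sum>j\<in>J. g j x)" if "finite J" "\<And>j. j \<in> J \<Longrightarrow> S (g j)" for J and g :: "nat \<Rightarrow> 'x \<Rightarrow> 'a"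
    using that by (induction J) (auto intro: zero add)
  have "S (\<lambda>x. contraction r (\<lambda>is. T (i # is) x) \<xi>)" for \<xi>
  proof -
    define e where "e = (axis i 1 :: real ^ 'n)"
    obtain c where c: "\<And>(T :: 'n list \<Rightarrow> 'a) s.
      contraction (Suc r) T (\<xi> + s *\<^sub>R e) = (\<Sum>j\<le>Suc r. s ^ j *\<^sub>R (\<Sum>is | length is = Suc r. c is j *\<^sub>R T is))"
      using contraction_line_coeffs[of "Suc r" \<xi> e, where 'a = 'a] by blast
    define a where "a x j = (\<Sum>is | length is = Suc r. c is j *\<^sub>R T is x)" for x j
    obtain v where v: "\<And>(a :: nat \<Rightarrow> 'a) j. j \<le> Suc r \<Longrightarrow>
       a j = (\<Sum>l\<le>Suc r. v l j *\<^sub>R (\<Sum>i\<le>Suc r. real l ^ i *\<^sub>R a i))"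
      using vector_polynomial_coeffs[of "Suc r", where 'a = 'a] by blast
    have S_a: "S (\<lambda>x. a x 1)"
    proof -
      have "(\<lambda>x. \<Sum>l\<le>Suc r. v l 1 *\<^sub>R contraction (Suc r) (\<lambda>is. T is x) (\<xi> + real l *\<^sub>R e)) = (\<lambda>x. a x 1)"
        unfolding c a_def[symmetric] by (rule ext, rule v[of 1, symmetric]) simp
      moreover have "S (\<lambda>x. \<Sum>l\<le>Suc r. v l 1 *\<^sub>R contraction (Suc r) (\<lambda>is. T is x) (\<xi> + real l *\<^sub>R e))"
        by (intro S_sum scale Suc.prems(2)) simp
      ultimately show ?thesis by (simp only:)
    qed
    \<comment> \<open>two expressions for the derivative at \<open>s = 0\<close>\<close>
    have a1: "a x 1 = real (Suc r) *\<^sub>R contraction r (\<lambda>is. T (i # is) x) \<xi>" for x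
    proof -
      have "((\<lambda>s. contraction (Suc r) (\<lambda>is. T is x) (\<xi> + s *\<^sub>R e)) has_vector_derivative
        contraction (Suc r) (\<lambda>is. 0) (\<xi> + 0 *\<^sub>R e) +
        real (Suc r) *\<^sub>R contraction (Suc r - 1) (\<lambda>is. \<Sum>i\<in>UNIV. e $ i *\<^sub>R T (i # is) x) (\<xi> + 0 *\<^sub>R e)) (at 0)"
        by (rule contraction_has_vector_derivative)
          (use Suc.prems(1) in \<open>simp, unfold symmetric_on_def, metis\<close>)
      then have "((\<lambda>s. contraction (Suc r) (\<lambda>is. T is x) (\<xi> + s *\<^sub>R e)) has_vector_derivative
        real (Suc r) *\<^sub>R contraction r (\<lambda>is. T (i # is) x) \<xi>) (at 0)"
        by (simp add: e_def axis_def if_distrib[of "\<lambda>x. x *\<^sub>R _"] sum.delta cong: if_cong del: of_nat_Suc)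
      moreover have "((\<lambda>s. \<Sum>j\<le>Suc r. s ^ j *\<^sub>R a x j) has_vector_derivative (\<Sum>j\<le>Suc r. (real j * 0 ^ (j - 1)) *\<^sub>R a x j)) (at 0)"
      proof (rule has_vector_derivative_sum)
        fix j
        have "((\<lambda>s. s ^ j) has_real_derivative real j * 0 ^ (j - 1)) (at 0)"
          using DERIV_pow[of j 0] by simp
        then show "((\<lambda>s. s ^ j *\<^sub>R a x j) has_vector_derivative (real j * 0 ^ (j - 1)) *\<^sub>R a x j) (at 0)"
          using has_vector_derivative_scaleR[OF _ has_vector_derivative_const] by fastforce
      qed
      moreover have "(\<Sum>j\<le>Suc r. (real j * 0 ^ (j - 1)) *\<^sub>R a x j) = a x 1"
      proof -
        have "(\<Sum>j\<le>Suc r. (real j * 0 ^ (j - 1)) *\<^sub>R a x j) = (\<Sum>j\<le>Suc r. if j = 1 then a x 1 else 0)"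
          by (intro sum.cong) (auto simp: power_0_left)
        then show ?thesis by simp
      qed
      moreover have "(\<lambda>s. contraction (Suc r) (\<lambda>is. T is x) (\<xi> + s *\<^sub>R e)) = (\<lambda>s. \<Sum>j\<le>Suc r. s ^ j *\<^sub>R a x j)"
        by (simp only: c a_def)
      ultimately show ?thesis
        by (metis (no_types, lifting) vector_derivative_unique_at)
    qed
    have "(\<lambda>x. (1 / real (Suc r)) *\<^sub>R a x 1) = (\<lambda>x. contraction r (\<lambda>is. T (i # is) x) \<xi>)"
      unfolding a1 by (simp del: of_nat_Suc)
    with scale[OF S_a, of "1 / real (Suc r)"] show ?thesis by (simp only:)
  qed
  from Suc.IH[OF symmetric_on_Cons[OF Suc.prems(1)] this is_eq(2)] show ?case by (simp add: is_eq)
qed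

corollary contraction_eq_zero:
  fixes T :: "'n::finite list \<Rightarrow> 'a::real_normed_vector"
  assumes "symmetric_on r T" "\<And>\<xi>. contraction r T \<xi> = 0" "length is = r"
  shows "T is = 0"
proof -
  have "(\<lambda>x::unit. T is) = (\<lambda>x. 0)"
    by (rule polarization[where S = "\<lambda>g. g = (\<lambda>x. 0)" and T = "\<lambda>is x. T is" and r = r])
      (use assms in \<open>simp_all add: fun_eq_iff, unfold symmetric_on_def, metis\<close>)
  then show ?thesis by (simp add: fun_eq_iff)
qed

lemma symmetric_on_symmetrization:
  "symmetric_on r (symmetrization F)"
  unfolding symmetric_on_def
proof (intro allI impI)
  fix "is" js :: "'a list"
  assume "mset is = mset js"
  then obtain \<rho> where \<rho>: "\<rho> permutes {..<length js}" "permute_list \<rho> js = is"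
    by (rule mset_eq_permutation)
  have len: "length is = length js" using \<rho> by auto
  have "(\<Sum>\<pi> | \<pi> permutes {..<length js}. F (permute_list \<pi> is)) = (\<Sum>\<pi> | \<pi> permutes {..<length js}. F (permute_list \<pi> js))"
  proof (rule sum.reindex_bij_witness[of _ "\<lambda>\<pi>. inv \<rho> \<circ> \<pi>" "\<lambda>\<pi>. \<rho> \<circ> \<pi>"])
    fix \<pi> assume "\<pi> \<in> {\<pi>. \<pi> permutes {..<length js}}"
    then show "F (permute_list (\<rho> \<circ> \<pi>) js) = F (permute_list \<pi> is)"
      by (simp add: permute_list_compose \<rho>(2))
  qed (use \<rho>(1) in \<open>auto simp: o_assoc permutes_inv_o permutes_inv permutes_compose\<close>)
  then show "symmetrization F is = symmetrization F js"
    by (simp add: symmetrization_def len)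
qed

text \<open>
  A monomial does not see the order of its indices.
\<close>

lemma contraction_symmetrization:
  fixes F :: "'n::finite list \<Rightarrow> 'a::real_vector"
  shows "contraction r (symmetrization F) \<xi> = contraction r F \<xi>"
proof -
  have *: "(\<Sum>is | length is = r. monomial \<xi> is *\<^sub>R F (permute_list \<pi> is)) = contraction r F \<xi>"
    if \<pi>: "\<pi> permutes {..<r}" for \<pi>
    unfolding contraction_def
  proof (rule sum.reindex_bij_witness[of _ "permute_list (inv \<pi>)" "permute_list \<pi>"])
    fix js :: "'n list" assume js: "js \<in> {is. length is = r}"
    show "permute_list (inv \<pi>) (permute_list \<pi> js) = js"
      using \<pi> js by (auto simp flip: permute_list_compose simp: permutes_inv permutes_inv_o)
    show "monomial \<xi> (permute_list \<pi> js) *\<^sub>R F (permute_list \<pi> js) = monomial \<xi> js *\<^sub>R F (permute_list \<pi> js)"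
      using \<pi> js by (simp add: monomial_mset_cong[OF mset_permute_list])
  qed (use \<pi> in \<open>auto simp flip: permute_list_compose simp: permutes_inv permutes_inv_o\<close>)
  have "contraction r (symmetrization F) \<xi> =
      (\<Sum>is | length is = r. (1 / fact r) *\<^sub>R (\<Sum>\<pi> | \<pi> permutes {..<r}. monomial \<xi> is *\<^sub>R F (permute_list \<pi> is)))"
    unfolding contraction_def by (intro sum.cong) (auto simp: symmetrization_def scaleR_sum_right mult.commute)
  also have "\<dots> = (1 / fact r) *\<^sub>R (\<Sum>is | length is = r. \<Sum>\<pi> | \<pi> permutes {..<r}. monomial \<xi> is *\<^sub>R F (permute_list \<pi> is))"
    by (rule scaleR_sum_right[symmetric])
  also have "(\<Sum>is | length is = r. \<Sum>\<pi> | \<pi> permutes {..<r}. monomial \<xi> is *\<^sub>R F (permute_list \<pi> is)) =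
      (\<Sum>\<pi> | \<pi> permutes {..<r}. contraction r F \<xi>)"
    by (subst sum.swap) (simp add: *)
  also have "(1 / fact r) *\<^sub>R (\<Sum>\<pi> | \<pi> permutes {..<r}. contraction r F \<xi>) = contraction r F \<xi>"
    by (simp add: sum_constant_scaleR card_permutations del: sum_constant)
  finally show ?thesis .
qed

section \<open>Smooth and rapidly decreasing functions\<close>

definition directional_derivative ::
    "real ^ 'n::finite \<Rightarrow> (real ^ 'n \<Rightarrow> 'a::real_normed_vector) \<Rightarrow> real ^ 'n \<Rightarrow> 'a" where
  "directional_derivative \<eta> g x = (\<Sum>i\<in>UNIV. \<eta> $ i *\<^sub>R partial_derivative i g x)"

lemma partial_derivatives_simps [simp]:
  "partial_derivatives [] g = g"
  "partial_derivatives (i # is) g = partial_derivative i (partial_derivatives is g)"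
  "partial_derivatives (is @ js) g = partial_derivatives is (partial_derivatives js g)"
  by (simp_all add: partial_derivatives_def)

lemma has_derivative_partial_derivative:
  "(g has_derivative g') (at x) \<Longrightarrow> partial_derivative i g x = g' (axis i 1)"
  unfolding partial_derivative_def by (metis frechet_derivative_at)

lemma has_derivative_directional_derivative:
  fixes g :: "real ^ 'n::finite \<Rightarrow> 'a::real_normed_vector"
  assumes "(g has_derivative g') (at x)"
  shows "directional_derivative \<eta> g x = g' \<eta>"
proof -
  interpret g': bounded_linear g' using assms by (rule has_derivative_bounded_linear)
  have "g' \<eta> = g' (\<Sum>i\<in>UNIV. \<eta> $ i *\<^sub>R axis i 1)"
    by (simp add: basis_expansion scalar_mult_eq_scaleR[symmetric])
  also have "\<dots> = (\<Sum>i\<in>UNIV. \<eta> $ i *\<^sub>R g' (axis i 1))"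
    by (simp add: g'.sum g'.scaleR)
  finally show ?thesis
    by (simp add: directional_derivative_def has_derivative_partial_derivative[OF assms])
qed

lemma smooth_has_derivative:
  assumes "smooth g"
  shows "(g has_derivative (\<lambda>h. directional_derivative h g x)) (at x)"
proof -
  have "g differentiable at x"
    using assms unfolding smooth_def by (metis partial_derivatives_simps(1))
  then obtain g' where g': "(g has_derivative g') (at x)" by (auto simp: differentiable_def)
  moreover have "g' = (\<lambda>h. directional_derivative h g x)"
    using has_derivative_directional_derivative[OF g'] by auto
  ultimately show ?thesis by simp
qed

lemma smooth_continuous: "smooth g \<Longrightarrow> continuous_on A g"
  by (meson continuous_at_imp_continuous_on has_derivative_continuous smooth_has_derivative)

lemma smooth_partial_derivatives: "smooth g \<Longrightarrow> smooth (partial_derivatives is g)"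
  unfolding smooth_def by (metis partial_derivatives_simps(3))

lemma smooth_partial_derivative: "smooth g \<Longrightarrow> smooth (partial_derivative i g)"
  using smooth_partial_derivatives[of g "[i]"] by simp

lemma partial_derivatives_linear_combination:
  fixes g :: "'b \<Rightarrow> real ^ 'n::finite \<Rightarrow> 'a::real_normed_vector"
  assumes "finite J" "\<And>j. j \<in> J \<Longrightarrow> smooth (g j)"
  shows "partial_derivatives is (\<lambda>x. \<Sum>j\<in>J. c j *\<^sub>R g j x) =
    (\<lambda>x. \<Sum>j\<in>J. c j *\<^sub>R partial_derivatives is (g j) x)"
proof (induction "is")
  case (Cons i "is")
  show ?case
  proof
    fix x
    have "((\<lambda>x. \<Sum>j\<in>J. c j *\<^sub>R partial_derivatives is (g j) x) has_derivative
      (\<lambda>h. \<Sum>j\<in>J. c j *\<^sub>R directional_derivative h (partial_derivatives is (g j)) x)) (at x)"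
      by (intro has_derivative_sum has_derivative_scaleR_right smooth_has_derivative
          smooth_partial_derivatives assms)
    from has_derivative_partial_derivative[OF this, of i]
    show "partial_derivatives (i # is) (\<lambda>x. \<Sum>j\<in>J. c j *\<^sub>R g j x) x =
        (\<Sum>j\<in>J. c j *\<^sub>R partial_derivatives (i # is) (g j) x)"
      using assms
      by (simp add: Cons has_derivative_partial_derivative[OF smooth_has_derivative] smooth_partial_derivatives)
  qed
qed simp

lemma smooth_linear_combination:
  fixes g :: "'b \<Rightarrow> real ^ 'n::finite \<Rightarrow> 'a::real_normed_vector"
  assumes "finite J" "\<And>j. j \<in> J \<Longrightarrow> smooth (g j)"
  shows "smooth (\<lambda>x. \<Sum>j\<in>J. c j *\<^sub>R g j x)"
  unfolding smooth_def
proof (intro allI)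
  fix "is" :: "'n list" and x
  have "((\<lambda>x. \<Sum>j\<in>J. c j *\<^sub>R partial_derivatives is (g j) x) has_derivative
    (\<lambda>h. \<Sum>j\<in>J. c j *\<^sub>R directional_derivative h (partial_derivatives is (g j)) x)) (at x)"
    by (intro has_derivative_sum has_derivative_scaleR_right smooth_has_derivative
        smooth_partial_derivatives assms)
  then show "partial_derivatives is (\<lambda>x. \<Sum>j\<in>J. c j *\<^sub>R g j x) differentiable at x"
    by (auto simp: partial_derivatives_linear_combination[OF assms] differentiable_def)
qed

lemma schwartz_smooth: "schwartz g \<Longrightarrow> smooth g"
  by (simp add: schwartz_def)

lemma schwartz_linear_combination:
  fixes g :: "'b \<Rightarrow> real ^ 'n::finite \<Rightarrow> 'a::real_normed_vector"
  assumes "finite J" "\<And>j. j \<in> J \<Longrightarrow> schwartz (g j)"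
  shows "schwartz (\<lambda>x. \<Sum>j\<in>J. c j *\<^sub>R g j x)"
  unfolding schwartz_def
proof (intro conjI allI)
  have sm: "j \<in> J \<Longrightarrow> smooth (g j)" for j using assms(2) by (rule schwartz_smooth)
  show "smooth (\<lambda>x. \<Sum>j\<in>J. c j *\<^sub>R g j x)"
    by (intro smooth_linear_combination assms sm)
  fix N and "is" :: "'n list"
  have "\<exists>B. \<forall>x. norm ((1 + norm x) ^ N *\<^sub>R partial_derivatives is (g j) x) \<le> B" if "j \<in> J" for j
    using assms(2)[OF that] by (auto simp: schwartz_def bounded_iff)
  then obtain B where B: "\<And>j x. j \<in> J \<Longrightarrow> norm ((1 + norm x) ^ N *\<^sub>R partial_derivatives is (g j) x) \<le> B j"
    by metis
  have "norm ((1 + norm x) ^ N *\<^sub>R (\<Sum>j\<in>J. c j *\<^sub>R partial_derivatives is (g j) x)) \<le> (\<Sum>j\<in>J. \<bar>c j\<bar> * B j)" for x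
    unfolding scaleR_sum_right
  proof (rule order_trans[OF norm_sum sum_mono])
    fix j assume "j \<in> J"
    then have "\<bar>c j\<bar> * norm ((1 + norm x) ^ N *\<^sub>R partial_derivatives is (g j) x) \<le> \<bar>c j\<bar> * B j"
      by (intro mult_left_mono B) auto
    then show "norm ((1 + norm x) ^ N *\<^sub>R c j *\<^sub>R partial_derivatives is (g j) x) \<le> \<bar>c j\<bar> * B j"
      by (simp add: ac_simps abs_mult power_abs)
  qed
  then show "bounded (range (\<lambda>x. (1 + norm x) ^ N *\<^sub>R partial_derivatives is (\<lambda>x. \<Sum>j\<in>J. c j *\<^sub>R g j x) x))"
    unfolding bounded_iff by (auto simp: partial_derivatives_linear_combination[OF assms(1) sm])
qed

lemma schwartz_partial_derivatives: "schwartz g \<Longrightarrow> schwartz (partial_derivatives is g)"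
  unfolding schwartz_def by (metis smooth_partial_derivatives partial_derivatives_simps(3))

lemma schwartz_directional_derivative:
  fixes g :: "real ^ 'n::finite \<Rightarrow> 'a::real_normed_vector"
  shows "schwartz g \<Longrightarrow> schwartz (directional_derivative \<eta> g)"
  using schwartz_partial_derivatives[of g "[i]" for i]
  unfolding directional_derivative_def[abs_def] by (intro schwartz_linear_combination) auto

lemma smooth_directional_derivative:
  fixes g :: "real ^ 'n::finite \<Rightarrow> 'a::real_normed_vector"
  shows "smooth g \<Longrightarrow> smooth (directional_derivative \<eta> g)"
  unfolding directional_derivative_def[abs_def]
  by (intro smooth_linear_combination smooth_partial_derivative) auto

lemma schwartz_directional_derivatives:
  "schwartz g \<Longrightarrow> schwartz ((directional_derivative \<eta> ^^ l) g)"
  by (induction l) (auto intro: schwartz_directional_derivative)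

lemma smooth_directional_derivatives:
  "smooth g \<Longrightarrow> smooth ((directional_derivative \<eta> ^^ l) g)"
  by (induction l) (auto intro: smooth_directional_derivative)

lemma schwartz_contraction:
  assumes "\<And>is. length is = r \<Longrightarrow> schwartz (T is)"
  shows "schwartz (\<lambda>x. contraction r (\<lambda>is. T is x) \<xi>)"
  unfolding contraction_def using assms by (intro schwartz_linear_combination) auto

lemma smooth_contraction:
  assumes "\<And>is. length is = r \<Longrightarrow> smooth (T is)"
  shows "smooth (\<lambda>x. contraction r (\<lambda>is. T is x) \<xi>)"
  unfolding contraction_def using assms by (intro smooth_linear_combination) auto

lemma directional_derivative_linear_combination:
  fixes g :: "'b \<Rightarrow> real ^ 'n::finite \<Rightarrow> 'a::real_normed_vector"
  assumes "finite J" "\<And>j. j \<in> J \<Longrightarrow> smooth (g j)"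
  shows "directional_derivative \<eta> (\<lambda>x. \<Sum>j\<in>J. c j *\<^sub>R g j x) =
    (\<lambda>x. \<Sum>j\<in>J. c j *\<^sub>R directional_derivative \<eta> (g j) x)"
proof
  fix x
  have "((\<lambda>x. \<Sum>j\<in>J. c j *\<^sub>R g j x) has_derivative
    (\<lambda>h. \<Sum>j\<in>J. c j *\<^sub>R directional_derivative h (g j) x)) (at x)"
    by (intro has_derivative_sum has_derivative_scaleR_right smooth_has_derivative assms)
  from has_derivative_directional_derivative[OF this]
  show "directional_derivative \<eta> (\<lambda>x. \<Sum>j\<in>J. c j *\<^sub>R g j x) x =
    (\<Sum>j\<in>J. c j *\<^sub>R directional_derivative \<eta> (g j) x)" .
qed

lemma directional_derivatives_linear_combination:
  fixes g :: "'b \<Rightarrow> real ^ 'n::finite \<Rightarrow> 'a::real_normed_vector"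
  assumes "finite J" "\<And>j. j \<in> J \<Longrightarrow> smooth (g j)"
  shows "(directional_derivative \<eta> ^^ l) (\<lambda>x. \<Sum>j\<in>J. c j *\<^sub>R g j x) =
    (\<lambda>x. \<Sum>j\<in>J. c j *\<^sub>R (directional_derivative \<eta> ^^ l) (g j) x)"
proof (induction l)
  case (Suc l)
  then show ?case
    using assms by (simp add: directional_derivative_linear_combination smooth_directional_derivatives)
qed simp

lemma directional_derivatives_contraction:
  assumes "\<And>is. length is = r \<Longrightarrow> smooth (T is)"
  shows "(directional_derivative \<eta> ^^ l) (\<lambda>x. contraction r (\<lambda>is. T is x) \<xi>) =
    (\<lambda>x. contraction r (\<lambda>is. (directional_derivative \<eta> ^^ l) (T is) x) \<xi>)"
  unfolding contraction_def using assms by (intro directional_derivatives_linear_combination) auto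

lemma partial_derivatives_contraction:
  assumes "\<And>is. length is = r \<Longrightarrow> smooth (T is)"
  shows "partial_derivatives js (\<lambda>x. contraction r (\<lambda>is. T is x) \<xi>) =
    (\<lambda>x. contraction r (\<lambda>is. partial_derivatives js (T is) x) \<xi>)"
  unfolding contraction_def using assms by (intro partial_derivatives_linear_combination) auto

text \<open>
  The iterated derivative along one vector needs no commutation of partial derivatives, because all
  orders of differentiation are summed.
\<close>

lemma directional_derivatives_eq_contraction:
  assumes "smooth g"
  shows "(directional_derivative \<eta> ^^ l) g = (\<lambda>x. contraction l (\<lambda>p. partial_derivatives p g x) \<eta>)"
proof (induction l)
  case (Suc l)
  show ?case
    unfolding funpow.simps o_apply Suc
    using assms
    by (simp add: directional_derivative_def[abs_def] contraction_Suc fun_eq_iff smooth_partial_derivatives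
        partial_derivatives_contraction[where js = "[i]" for i, simplified])
qed simp

lemma smooth_has_vector_derivative_line:
  assumes "smooth g"
  shows "((\<lambda>t. g (x + t *\<^sub>R \<xi>)) has_vector_derivative directional_derivative \<xi> g (x + t *\<^sub>R \<xi>)) (at t)"
proof -
  have "((\<lambda>t. x + t *\<^sub>R \<xi>) has_derivative (\<lambda>h. h *\<^sub>R \<xi>)) (at t)"
    by (auto intro!: derivative_eq_intros)
  from has_derivative_compose[OF this smooth_has_derivative[OF assms]]
  have "((\<lambda>t. g (x + t *\<^sub>R \<xi>)) has_derivative (\<lambda>h. directional_derivative (h *\<^sub>R \<xi>) g (x + t *\<^sub>R \<xi>))) (at t)" .
  then show ?thesis
    by (simp add: has_vector_derivative_def directional_derivative_def scaleR_sum_right)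
qed

lemma schwartz_bound:
  assumes "schwartz g"
  obtains C where "0 < C" "\<And>x. norm (g x) \<le> C / (1 + norm x) ^ N"
proof -
  have "bounded (range (\<lambda>x. (1 + norm x) ^ N *\<^sub>R g x))"
    using assms unfolding schwartz_def by (metis partial_derivatives_simps(1))
  then obtain B where B: "0 < B" "\<And>x. norm ((1 + norm x) ^ N *\<^sub>R g x) \<le> B"
    by (auto simp: bounded_pos)
  have "norm (g x) \<le> B / (1 + norm x) ^ N" for x
    using B(2)[of x] by (simp add: pos_le_divide_eq add_pos_nonneg mult.commute)
  then show ?thesis using B(1) that by blast
qed

section \<open>Moments along rays\<close>

text \<open>
  Differentiation under the integral sign, by dominated convergence: the mean value inequality bounds
  all difference quotients by \<open>2 B\<close>.
\<close>

lemma has_derivative_integral: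
  fixes F :: "'b::real_normed_vector \<Rightarrow> real \<Rightarrow> 'a::{banach, second_countable_topology}"
  assumes r: "0 < r"
    and deriv: "\<And>y t. y \<in> ball x r \<Longrightarrow> ((\<lambda>y. F y t) has_derivative F' y t) (at y)"
    and bound: "\<And>y t h. y \<in> ball x r \<Longrightarrow> norm (F' y t h) \<le> B t * norm h"
    and B: "integrable M B" "\<And>t. 0 \<le> B t"
    and F: "\<And>y. y \<in> ball x r \<Longrightarrow> integrable M (F y)"
    and F': "\<And>h. integrable M (\<lambda>t. F' x t h)"
  shows "((\<lambda>y. LINT t|M. F y t) has_derivative (\<lambda>h. LINT t|M. F' x t h)) (at x)"
  unfolding has_derivative_at_within
proof (intro conjI)
  have x: "x \<in> ball x r" using r by simp
  have lin: "bounded_linear (F' x t)" for t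
    using deriv[OF x] by (rule has_derivative_bounded_linear)
  show "bounded_linear (\<lambda>h. LINT t|M. F' x t h)"
  proof (rule bounded_linear_intro[where K = "LINT t|M. B t"])
    fix h k :: 'b and c :: real
    have "F' x t (h + k) = F' x t h + F' x t k" "F' x t (c *\<^sub>R h) = c *\<^sub>R F' x t h" for t
      using lin[of t] by (simp_all add: bounded_linear.linear linear_add linear_cmul)
    then show "(LINT t|M. F' x t (h + k)) = (LINT t|M. F' x t h) + (LINT t|M. F' x t k)"
      "(LINT t|M. F' x t (c *\<^sub>R h)) = c *\<^sub>R (LINT t|M. F' x t h)"
      using F' by simp_all
    have "norm (LINT t|M. F' x t h) \<le> (LINT t|M. B t * norm h)"
      by (intro Bochner_Integration.integral_norm_bound_integral F' integrable_mult_left B(1) bound[OF x])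
    then show "norm (LINT t|M. F' x t h) \<le> norm h * (LINT t|M. B t)"
      by (simp add: mult.commute)
  qed
  have diff: "norm (F y t - F x t - F' x t (y - x)) \<le> 2 * B t * norm (y - x)" if y: "y \<in> ball x r" for y t
  proof -
    have "norm (F y t - F x t) \<le> B t * norm (y - x)"
    proof (rule differentiable_bound[OF convex_ball _ _ y x])
      fix z assume z: "z \<in> ball x r"
      show "((\<lambda>y. F y t) has_derivative F' z t) (at z within ball x r)"
        by (rule has_derivative_at_withinI[OF deriv[OF z]])
      show "onorm (F' z t) \<le> B t"
        by (intro onorm_bound B bound z)
    qed
    moreover have "norm (F' x t (y - x)) \<le> B t * norm (y - x)" by (rule bound[OF x])
    ultimately show ?thesis
      using norm_triangle_ineq4[of "F y t - F x t" "F' x t (y - x)"] by simp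
  qed
  show "((\<lambda>y. ((LINT t|M. F y t) - (LINT t|M. F x t) - (LINT t|M. F' x t (y - x))) /\<^sub>R norm (y - x)) \<longlongrightarrow> 0) (at x)"
    unfolding tendsto_at_iff_sequentially
  proof (intro allI impI)
    fix X :: "nat \<Rightarrow> 'b" assume X: "\<forall>i. X i \<in> UNIV - {x}" "X \<longlonglongrightarrow> x"
    obtain N where N: "\<And>n. n \<ge> N \<Longrightarrow> X n \<in> ball x r"
      using topological_tendstoD[OF X(2) open_ball x] by (auto simp: eventually_sequentially)
    define Y where "Y n = X (n + N)" for n
    have Y: "Y n \<in> ball x r" "Y n \<noteq> x" for n using N X(1) by (auto simp: Y_def)
    have Ylim: "Y \<longlonglongrightarrow> x" unfolding Y_def by (rule LIMSEQ_ignore_initial_segment[OF X(2)])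
    let ?q = "\<lambda>y t. (F y t - F x t - F' x t (y - x)) /\<^sub>R norm (y - x)"
    have "(\<lambda>n. LINT t|M. ?q (Y n) t) \<longlonglongrightarrow> (LINT t|M. 0)"
    proof (rule integral_dominated_convergence[where w = "\<lambda>t. 2 * B t"])
      show "AE t in M. (\<lambda>n. ?q (Y n) t) \<longlonglongrightarrow> 0"
      proof (rule AE_I2)
        fix t
        have "((\<lambda>y. ?q y t) \<longlongrightarrow> 0) (at x)"
          using deriv[OF x, of t] by (simp add: has_derivative_at_within)
        then show "(\<lambda>n. ?q (Y n) t) \<longlonglongrightarrow> 0"
          unfolding tendsto_at_iff_sequentially using Y(2) Ylim by (auto simp: o_def)
      qed
      show "AE t in M. norm (?q (Y n) t) \<le> 2 * B t" for n
        using diff[OF Y(1)[of n]] Y(2)[of n]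
        by (intro AE_I2) (simp add: divide_simps mult.commute)
      show "(\<lambda>t. ?q (Y n) t) \<in> borel_measurable M" for n
        using F[OF Y(1)[of n]] F[OF x] F'[of "Y n - x"] by measurable
    qed (use B in auto)
    moreover have "(LINT t|M. ?q (Y n) t) =
      ((LINT t|M. F (Y n) t) - (LINT t|M. F x t) - (LINT t|M. F' x t (Y n - x))) /\<^sub>R norm (Y n - x)" for n
      using F[OF Y(1)[of n]] F[OF x] F'[of "Y n - x"] by simp
    ultimately have "(\<lambda>n. ((LINT t|M. F (Y n) t) - (LINT t|M. F x t) - (LINT t|M. F' x t (Y n - x))) /\<^sub>R norm (Y n - x)) \<longlonglongrightarrow> 0"
      by (simp only: Bochner_Integration.integral_zero)
    then show "((\<lambda>y. ((LINT t|M. F y t) - (LINT t|M. F x t) - (LINT t|M. F' x t (y - x))) /\<^sub>R norm (y - x)) \<circ> X) \<longlonglongrightarrow> 0"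
      unfolding Y_def o_def by (rule LIMSEQ_offset)
  qed
qed

lemma integrable_inverse_square: "integrable lborel (\<lambda>t::real. 1 / (1 + \<bar>t\<bar>)\<^sup>2)"
proof (rule Bochner_Integration.integrable_bound)
  show "integrable lborel (\<lambda>t::real. inverse (1 + t\<^sup>2))"
    using integrable_inverse_1_plus_square by (simp add: set_integrable_def einterval_eq_UNIV)
  show "AE t in lborel. norm (1 / (1 + \<bar>t :: real\<bar>)\<^sup>2) \<le> norm (inverse (1 + t\<^sup>2))"
  proof (intro AE_I2)
    fix t :: real
    have "1 + t\<^sup>2 \<le> (1 + \<bar>t\<bar>)\<^sup>2" by (simp add: power2_sum)
    then show "norm (1 / (1 + \<bar>t\<bar>)\<^sup>2) \<le> norm (inverse (1 + t\<^sup>2))"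
      by (simp add: inverse_eq_divide frac_le add_pos_nonneg)
  qed
qed simp

lemma integrable_continuous_bounded:
  fixes g :: "real \<Rightarrow> 'a::euclidean_space"
  assumes "continuous_on UNIV g" "\<And>t. norm (g t) \<le> C / (1 + \<bar>t\<bar>)\<^sup>2"
  shows "integrable lborel g"
proof (rule Bochner_Integration.integrable_bound)
  show "integrable lborel (\<lambda>t. C * (1 / (1 + \<bar>t\<bar>)\<^sup>2))"
    by (intro integrable_mult_right integrable_inverse_square)
  show "g \<in> borel_measurable lborel"
    using borel_measurable_continuous_onI[OF assms(1)] by simp
  show "AE t in lborel. norm (g t) \<le> norm (C * (1 / (1 + \<bar>t\<bar>)\<^sup>2))"
    using order_trans[OF assms(2) divide_right_mono[OF abs_ge_self]] by (intro AE_I2) (simp add: abs_mult)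
qed

text \<open>
  The bound is uniform in a neighbourhood of \<open>(x\<^sub>0, \<xi>\<^sub>0)\<close>, as needed for differentiation under the
  integral sign with respect to both the point and the direction of a ray.
\<close>

lemma schwartz_ray_bound:
  fixes \<phi> :: "real ^ 'n::finite \<Rightarrow> 'a::real_normed_vector"
  assumes "schwartz \<phi>" "\<xi>\<^sub>0 \<noteq> 0"
  obtains C where "0 < C"
    "\<And>x \<xi> t. norm (x - x\<^sub>0) \<le> 1 \<Longrightarrow> norm (\<xi> - \<xi>\<^sub>0) \<le> norm \<xi>\<^sub>0 / 2 \<Longrightarrow>
       norm (\<phi> (x + t *\<^sub>R \<xi>)) \<le> C / (1 + \<bar>t\<bar>) ^ N"
proof -
  obtain A where A: "0 < A" "\<And>x. norm (\<phi> x) \<le> A / (1 + norm x) ^ N"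
    using schwartz_bound[OF assms(1)] by blast
  define K where "K = 1 + (2 / norm \<xi>\<^sub>0) * (norm x\<^sub>0 + 2)"
  have K: "K > 0" using assms(2) by (auto simp: K_def intro!: add_pos_nonneg)
  have "norm (\<phi> (x + t *\<^sub>R \<xi>)) \<le> A * K ^ N / (1 + \<bar>t\<bar>) ^ N"
    if x: "norm (x - x\<^sub>0) \<le> 1" and \<xi>: "norm (\<xi> - \<xi>\<^sub>0) \<le> norm \<xi>\<^sub>0 / 2" for x \<xi> t
  proof -
    have "norm \<xi>\<^sub>0 / 2 \<le> norm \<xi>"
      using \<xi> norm_triangle_ineq2[of \<xi>\<^sub>0 \<xi>] by (simp add: norm_minus_commute)
    then have "\<bar>t\<bar> * (norm \<xi>\<^sub>0 / 2) \<le> norm (t *\<^sub>R \<xi>)"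
      using mult_left_mono[of "norm \<xi>\<^sub>0 / 2" "norm \<xi>" "\<bar>t\<bar>"] by simp
    also have "\<dots> \<le> norm (x + t *\<^sub>R \<xi>) + norm x"
      using norm_triangle_ineq4[of "x + t *\<^sub>R \<xi>" x] by simp
    also have "norm x \<le> norm x\<^sub>0 + 1"
      using x norm_triangle_ineq2[of x x\<^sub>0] by simp
    finally have "\<bar>t\<bar> \<le> (2 / norm \<xi>\<^sub>0) * (norm (x + t *\<^sub>R \<xi>) + norm x\<^sub>0 + 1)"
      using assms(2) by (simp add: field_simps)
    also have "\<dots> \<le> (2 / norm \<xi>\<^sub>0) * ((norm x\<^sub>0 + 2) * (1 + norm (x + t *\<^sub>R \<xi>)))"
      by (intro mult_left_mono) (auto simp: distrib_left distrib_right)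
    finally have "1 + \<bar>t\<bar> \<le> 1 + norm (x + t *\<^sub>R \<xi>) + (2 / norm \<xi>\<^sub>0) * ((norm x\<^sub>0 + 2) * (1 + norm (x + t *\<^sub>R \<xi>)))"
      using norm_ge_zero[of "x + t *\<^sub>R \<xi>"] by linarith
    also have "\<dots> = K * (1 + norm (x + t *\<^sub>R \<xi>))"
      by (simp only: K_def distrib_right mult_1 mult.assoc)
    finally have "1 + \<bar>t\<bar> \<le> K * (1 + norm (x + t *\<^sub>R \<xi>))" .
    then have "(1 + \<bar>t\<bar>) ^ N \<le> K ^ N * (1 + norm (x + t *\<^sub>R \<xi>)) ^ N"
      using power_mono[of "1 + \<bar>t\<bar>" "K * (1 + norm (x + t *\<^sub>R \<xi>))" N] by (simp add: power_mult_distrib)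
    then have "A * (1 + \<bar>t\<bar>) ^ N \<le> A * (K ^ N * (1 + norm (x + t *\<^sub>R \<xi>)) ^ N)"
      using A(1) by (intro mult_left_mono) auto
    then have "A / (1 + norm (x + t *\<^sub>R \<xi>)) ^ N \<le> A * K ^ N / (1 + \<bar>t\<bar>) ^ N"
      by (simp add: field_simps add_pos_nonneg)
    with A(2) show ?thesis by (rule order_trans)
  qed
  then show ?thesis using A(1) K that[of "A * K ^ N"] by auto
qed

text \<open>
  The set \<open>T\<close> is the whole line or the half-line \<open>{0..}\<close>; most facts hold for both and are stated
  for both at once.
\<close>

definition moment ::
    "real set \<Rightarrow> nat \<Rightarrow> (real ^ 'n::finite \<Rightarrow> 'a::euclidean_space) \<Rightarrow> real ^ 'n \<Rightarrow> real ^ 'n \<Rightarrow> 'a" where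
  "moment T q \<phi> \<xi> x = (LINT t:T|lborel. t ^ q *\<^sub>R \<phi> (x + t *\<^sub>R \<xi>))"

lemma power_div_power_bound:
  fixes t :: real
  assumes "0 \<le> C"
  shows "\<bar>t\<bar> ^ q * (C / (1 + \<bar>t\<bar>) ^ (q + N)) \<le> C / (1 + \<bar>t\<bar>) ^ N"
proof -
  have "\<bar>t\<bar> ^ q \<le> (1 + \<bar>t\<bar>) ^ q" by (intro power_mono) auto
  then have "\<bar>t\<bar> ^ q * (C / (1 + \<bar>t\<bar>) ^ (q + N)) \<le> (1 + \<bar>t\<bar>) ^ q * (C / (1 + \<bar>t\<bar>) ^ (q + N))"
    using assms by (intro mult_right_mono) auto
  also have "\<dots> = C / (1 + \<bar>t\<bar>) ^ N" by (simp add: power_add field_simps)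
  finally show ?thesis .
qed

lemma schwartz_line_bound:
  fixes \<phi> :: "real ^ 'n::finite \<Rightarrow> 'a::euclidean_space"
  assumes "schwartz \<phi>" "\<xi> \<noteq> 0"
  obtains C where "0 < C" "\<And>t. norm (t ^ q *\<^sub>R \<phi> (x + t *\<^sub>R \<xi>)) \<le> C / (1 + \<bar>t\<bar>) ^ N"
proof -
  obtain C where C: "0 < C"
    "\<And>y \<zeta> t. norm (y - x) \<le> 1 \<Longrightarrow> norm (\<zeta> - \<xi>) \<le> norm \<xi> / 2 \<Longrightarrow>
       norm (\<phi> (y + t *\<^sub>R \<zeta>)) \<le> C / (1 + \<bar>t\<bar>) ^ (q + N)"
    using schwartz_ray_bound[OF assms] by blast
  have "norm (t ^ q *\<^sub>R \<phi> (x + t *\<^sub>R \<xi>)) \<le> C / (1 + \<bar>t\<bar>) ^ N" for t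
  proof -
    have "norm (t ^ q *\<^sub>R \<phi> (x + t *\<^sub>R \<xi>)) \<le> \<bar>t\<bar> ^ q * (C / (1 + \<bar>t\<bar>) ^ (q + N))"
      unfolding norm_scaleR power_abs by (intro mult_left_mono C(2)) auto
    also have "\<dots> \<le> C / (1 + \<bar>t\<bar>) ^ N"
      using C(1) by (intro power_div_power_bound) auto
    finally show ?thesis .
  qed
  then show ?thesis using C(1) that by blast
qed

lemma continuous_on_line:
  assumes "smooth \<phi>"
  shows "continuous_on A (\<lambda>t. \<phi> (x + t *\<^sub>R \<xi>))"
  by (intro continuous_intros continuous_on_compose2[OF smooth_continuous[OF assms, of UNIV]]) auto

lemma schwartz_line_integrable:
  fixes \<phi> :: "real ^ 'n::finite \<Rightarrow> 'a::euclidean_space"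
  assumes "schwartz \<phi>" "\<xi> \<noteq> 0"
  shows "integrable lborel (\<lambda>t. t ^ q *\<^sub>R \<phi> (x + t *\<^sub>R \<xi>))"
proof -
  obtain C where "\<And>t. norm (t ^ q *\<^sub>R \<phi> (x + t *\<^sub>R \<xi>)) \<le> C / (1 + \<bar>t\<bar>)\<^sup>2"
    using schwartz_line_bound[OF assms] by blast
  then show ?thesis
    by (intro integrable_continuous_bounded continuous_intros continuous_on_line schwartz_smooth assms)
qed

lemma schwartz_line_set_integrable:
  fixes \<phi> :: "real ^ 'n::finite \<Rightarrow> 'a::euclidean_space"
  assumes "schwartz \<phi>" "\<xi> \<noteq> 0" "T \<in> sets borel"
  shows "set_integrable lborel T (\<lambda>t. t ^ q *\<^sub>R \<phi> (x + t *\<^sub>R \<xi>))"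
  unfolding set_integrable_def
  using integrable_mult_indicator[OF _ schwartz_line_integrable[OF assms(1,2), of q x], of T] assms(3) by simp

lemma norm_directional_derivative_le:
  "norm (directional_derivative h \<phi> x) \<le> (\<Sum>i\<in>UNIV. norm (partial_derivative i \<phi> x)) * norm h"
  unfolding directional_derivative_def sum_distrib_right
proof (rule order_trans[OF norm_sum sum_mono])
  fix i
  have "\<bar>h $ i\<bar> * norm (partial_derivative i \<phi> x) \<le> norm h * norm (partial_derivative i \<phi> x)"
    by (intro mult_right_mono component_le_norm_cart) auto
  then show "norm (h $ i *\<^sub>R partial_derivative i \<phi> x) \<le> norm (partial_derivative i \<phi> x) * norm h"
    by (simp add: mult.commute)
qed

lemma directional_derivative_lincomb:
  "directional_derivative (h + t *\<^sub>R k) \<phi> x = directional_derivative h \<phi> x + t *\<^sub>R directional_derivative k \<phi> x"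
  by (simp add: directional_derivative_def scaleR_add_left sum.distrib scaleR_sum_right)

lemma directional_derivative_axis: "directional_derivative (axis i 1) \<phi> = partial_derivative i \<phi>"
  by (simp add: directional_derivative_def[abs_def] axis_def if_distrib[of "\<lambda>x. x *\<^sub>R _"] sum.delta cong: if_cong)

lemma directional_derivative_zero [simp]: "directional_derivative 0 \<phi> = (\<lambda>x. 0)"
  by (simp add: directional_derivative_def[abs_def])

lemma moment_zero [simp]: "moment T q (\<lambda>x. 0) \<xi> x = 0"
  by (simp add: moment_def set_lebesgue_integral_def)

text \<open>
  Moving the point by \<open>h\<close> and the direction by \<open>k\<close> moves \<open>x + t \<xi>\<close> by \<open>h + t k\<close>; the factor \<open>t\<close> raises the
  order of the moment by one.
\<close>

lemma moment_has_derivative: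
  fixes \<phi> :: "real ^ 'n::finite \<Rightarrow> 'a::euclidean_space"
  assumes \<phi>: "schwartz \<phi>" and \<xi>: "\<xi> \<noteq> 0" and T: "T \<in> sets borel"
  shows "((\<lambda>p. moment T q \<phi> (snd p) (fst p)) has_derivative
    (\<lambda>p. moment T q (directional_derivative (fst p) \<phi>) \<xi> x + moment T (Suc q) (directional_derivative (snd p) \<phi>) \<xi> x))
    (at (x, \<xi>))"
proof -
  have "\<exists>C>0. \<forall>y \<zeta> t. norm (y - x) \<le> 1 \<longrightarrow> norm (\<zeta> - \<xi>) \<le> norm \<xi> / 2 \<longrightarrow>
       norm (partial_derivative i \<phi> (y + t *\<^sub>R \<zeta>)) \<le> C / (1 + \<bar>t\<bar>) ^ (q + 3)" for i
    using schwartz_ray_bound[OF schwartz_partial_derivatives[OF \<phi>, of "[i]"] \<xi>, of x "q + 3"]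
    by (metis partial_derivatives_simps(1,2))
  then obtain C where C: "\<And>i. C i > 0" "\<And>i y \<zeta> t. norm (y - x) \<le> 1 \<Longrightarrow> norm (\<zeta> - \<xi>) \<le> norm \<xi> / 2 \<Longrightarrow>
       norm (partial_derivative i \<phi> (y + t *\<^sub>R \<zeta>)) \<le> C i / (1 + \<bar>t\<bar>) ^ (q + 3)"
    by metis
  define r where "r = min 1 (norm \<xi> / 2)"
  have near: "norm (y - x) \<le> 1" "norm (\<zeta> - \<xi>) \<le> norm \<xi> / 2" "\<zeta> \<noteq> 0" if "(y, \<zeta>) \<in> ball (x, \<xi>) r" for y \<zeta>
  proof -
    have "dist (x, \<xi>) (y, \<zeta>) < r" using that by simp
    then have "dist x y < r" "dist \<xi> \<zeta> < r"
      using dist_fst_le[of "(x, \<xi>)" "(y, \<zeta>)"] dist_snd_le[of "(x, \<xi>)" "(y, \<zeta>)"] by auto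
    then show "norm (y - x) \<le> 1" "norm (\<zeta> - \<xi>) \<le> norm \<xi> / 2" "\<zeta> \<noteq> 0"
      using \<xi> by (auto simp: r_def dist_norm norm_minus_commute)
  qed
  define F' where "F' p t h = (indicator T t * t ^ q) *\<^sub>R
      directional_derivative (fst h + t *\<^sub>R snd h) \<phi> (fst p + t *\<^sub>R snd p)" for p h :: "(real ^ 'n) \<times> (real ^ 'n)" and t :: real
  have "((\<lambda>p. LINT t|lborel. (indicator T t * t ^ q) *\<^sub>R \<phi> (fst p + t *\<^sub>R snd p)) has_derivative
      (\<lambda>h. LINT t|lborel. F' (x, \<xi>) t h)) (at (x, \<xi>))"
  proof (rule has_derivative_integral[where r = r and B = "\<lambda>t. (\<Sum>i\<in>UNIV. C i) / (1 + \<bar>t\<bar>)\<^sup>2"])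
    show "0 < r" using \<xi> by (simp add: r_def)
    show "integrable lborel (\<lambda>t. (\<Sum>i\<in>UNIV. C i) / (1 + \<bar>t\<bar>)\<^sup>2)"
      using integrable_mult_right[OF integrable_inverse_square, of "\<Sum>i\<in>UNIV. C i"] by simp
    show "0 \<le> (\<Sum>i\<in>UNIV. C i) / (1 + \<bar>t\<bar>)\<^sup>2" for t :: real
      using C(1) by (intro divide_nonneg_nonneg sum_nonneg) (auto intro: less_imp_le)
    fix p :: "(real ^ 'n) \<times> (real ^ 'n)" assume p: "p \<in> ball (x, \<xi>) r"
    obtain y \<zeta> where [simp]: "p = (y, \<zeta>)" by (cases p)
    note near = near[OF p[unfolded \<open>p = _\<close>]]
    show "integrable lborel (\<lambda>t. (indicator T t * t ^ q) *\<^sub>R \<phi> (fst p + t *\<^sub>R snd p))"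
      using schwartz_line_set_integrable[OF \<phi> near(3) T, of q y] by (simp add: set_integrable_def)
    fix t :: real
    have "((\<lambda>p. fst p + t *\<^sub>R snd p) has_derivative (\<lambda>h. fst h + t *\<^sub>R snd h)) (at p)"
      by (auto intro!: derivative_eq_intros)
    from has_derivative_scaleR_right[OF has_derivative_compose[OF this smooth_has_derivative[OF schwartz_smooth[OF \<phi>]]]]
    show "((\<lambda>p. (indicator T t * t ^ q) *\<^sub>R \<phi> (fst p + t *\<^sub>R snd p)) has_derivative F' p t) (at p)"
      unfolding F'_def .
    fix h :: "(real ^ 'n) \<times> (real ^ 'n)"
    have "norm (fst h + t *\<^sub>R snd h) \<le> norm (fst h) + \<bar>t\<bar> * norm (snd h)"
      using norm_triangle_ineq[of "fst h" "t *\<^sub>R snd h"] by simp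
    also have "\<dots> \<le> (1 + \<bar>t\<bar>) * norm h"
      using norm_fst_le[of "fst h" "snd h"]
        mult_left_mono[OF norm_snd_le[of "snd h" "fst h"], of "\<bar>t\<bar>"]
      by (simp add: distrib_right)
    finally have h: "norm (fst h + t *\<^sub>R snd h) \<le> (1 + \<bar>t\<bar>) * norm h" .
    have "norm (F' p t h) \<le> \<bar>t\<bar> ^ q * norm (directional_derivative (fst h + t *\<^sub>R snd h) \<phi> (y + t *\<^sub>R \<zeta>))"
      by (simp add: F'_def abs_mult power_abs indicator_def)
    also have "\<dots> \<le> \<bar>t\<bar> ^ q * ((\<Sum>i\<in>UNIV. norm (partial_derivative i \<phi> (y + t *\<^sub>R \<zeta>))) * norm (fst h + t *\<^sub>R snd h))"
      by (intro mult_left_mono norm_directional_derivative_le) auto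
    also have "\<dots> \<le> \<bar>t\<bar> ^ q * ((\<Sum>i\<in>UNIV. C i / (1 + \<bar>t\<bar>) ^ (q + 3)) * ((1 + \<bar>t\<bar>) * norm h))"
      by (intro mult_left_mono mult_mono sum_mono h C(2) near sum_nonneg) (auto simp: less_imp_le[OF C(1)])
    also have "\<dots> = \<bar>t\<bar> ^ q * ((\<Sum>i\<in>UNIV. C i) / (1 + \<bar>t\<bar>) ^ (q + 2)) * norm h"
    proof -
      have "a * (S / u ^ (q + 3) * (u * H)) = a * (S / u ^ (q + 2)) * H" if "u \<noteq> 0" for a S u H :: real
        using that by (simp add: power_add eval_nat_numeral)
      then show ?thesis by (simp add: sum_divide_distrib[symmetric] add_nonneg_eq_0_iff)
    qed
    also have "\<dots> \<le> (\<Sum>i\<in>UNIV. C i) / (1 + \<bar>t\<bar>)\<^sup>2 * norm h"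
      by (intro mult_right_mono power_div_power_bound sum_nonneg) (auto intro: less_imp_le C(1))
    finally show "norm (F' p t h) \<le> (\<Sum>i\<in>UNIV. C i) / (1 + \<bar>t\<bar>)\<^sup>2 * norm h" .
  next
    fix h :: "(real ^ 'n) \<times> (real ^ 'n)"
    show "integrable lborel (\<lambda>t. F' (x, \<xi>) t h)"
      using Bochner_Integration.integrable_add[OF
          schwartz_line_set_integrable[OF schwartz_directional_derivative[OF \<phi>] \<xi> T, of q "fst h" x, unfolded set_integrable_def]
          schwartz_line_set_integrable[OF schwartz_directional_derivative[OF \<phi>] \<xi> T, of "Suc q" "snd h" x, unfolded set_integrable_def]]
      by (simp add: F'_def directional_derivative_lincomb scaleR_add_right mult_ac)
  qed
  moreover have "(LINT t|lborel. F' (x, \<xi>) t h) =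
      moment T q (directional_derivative (fst h) \<phi>) \<xi> x + moment T (Suc q) (directional_derivative (snd h) \<phi>) \<xi> x" for h
    unfolding moment_def set_lebesgue_integral_def
    by (subst Bochner_Integration.integral_add[symmetric])
      (use schwartz_line_set_integrable[OF schwartz_directional_derivative[OF \<phi>] \<xi> T, of q "fst h" x]
        schwartz_line_set_integrable[OF schwartz_directional_derivative[OF \<phi>] \<xi> T, of "Suc q" "snd h" x] in
       \<open>auto simp: set_integrable_def F'_def directional_derivative_lincomb scaleR_add_right mult_ac\<close>)
  ultimately show ?thesis
    by (simp add: moment_def set_lebesgue_integral_def)
qed

lemma moment_has_derivative_point:
  fixes \<phi> :: "real ^ 'n::finite \<Rightarrow> 'a::euclidean_space"
  assumes "schwartz \<phi>" "\<xi> \<noteq> 0" "T \<in> sets borel"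
  shows "(moment T q \<phi> \<xi> has_derivative (\<lambda>h. moment T q (directional_derivative h \<phi>) \<xi> x)) (at x)"
proof -
  have "((\<lambda>y. (y, \<xi>)) has_derivative (\<lambda>h. (h, 0))) (at x)"
    by (auto intro!: derivative_eq_intros)
  from has_derivative_compose[OF this moment_has_derivative[OF assms]]
  show ?thesis by simp
qed

lemma moment_has_vector_derivative_direction:
  fixes \<phi> :: "real ^ 'n::finite \<Rightarrow> 'a::euclidean_space"
  assumes "schwartz \<phi>" "\<xi> + s *\<^sub>R \<eta> \<noteq> 0" "T \<in> sets borel"
  shows "((\<lambda>s. moment T q \<phi> (\<xi> + s *\<^sub>R \<eta>) x) has_vector_derivative
    moment T (Suc q) (directional_derivative \<eta> \<phi>) (\<xi> + s *\<^sub>R \<eta>) x) (at s)"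
proof -
  have "((\<lambda>s. (x, \<xi> + s *\<^sub>R \<eta>)) has_derivative (\<lambda>h. (0, h *\<^sub>R \<eta>))) (at s)"
    by (auto intro!: derivative_eq_intros)
  from has_derivative_compose[OF this moment_has_derivative[OF assms]]
  show ?thesis
    by (simp add: has_vector_derivative_def directional_derivative_def moment_def scaleR_left_commute
        set_lebesgue_integral_def scaleR_sum_right[symmetric] flip: scaleR_scaleR)
qed

lemma partial_derivatives_moment:
  fixes \<phi> :: "real ^ 'n::finite \<Rightarrow> 'a::euclidean_space"
  assumes "schwartz \<phi>" "\<xi> \<noteq> 0" "T \<in> sets borel"
  shows "partial_derivatives is (moment T q \<phi> \<xi>) = moment T q (partial_derivatives is \<phi>) \<xi>"
proof (induction "is")
  case (Cons i "is")
  show ?case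
    unfolding partial_derivatives_simps Cons
    by (rule ext)
      (simp add: directional_derivative_axis
        has_derivative_partial_derivative[OF moment_has_derivative_point[OF schwartz_partial_derivatives[OF assms(1)] assms(2,3)]])
qed simp

lemma smooth_moment:
  fixes \<phi> :: "real ^ 'n::finite \<Rightarrow> 'a::euclidean_space"
  assumes "schwartz \<phi>" "\<xi> \<noteq> 0" "T \<in> sets borel"
  shows "smooth (moment T q \<phi> \<xi>)"
  unfolding smooth_def partial_derivatives_moment[OF assms]
  using moment_has_derivative_point[OF schwartz_partial_derivatives[OF assms(1)] assms(2,3)]
  by (auto simp: differentiable_def)

lemma directional_derivative_moment:
  fixes \<phi> :: "real ^ 'n::finite \<Rightarrow> 'a::euclidean_space"
  assumes "schwartz \<phi>" "\<xi> \<noteq> 0" "T \<in> sets borel"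
  shows "directional_derivative \<eta> (moment T q \<phi> \<xi>) = moment T q (directional_derivative \<eta> \<phi>) \<xi>"
  by (rule ext) (rule has_derivative_directional_derivative[OF moment_has_derivative_point[OF assms]])

lemma directional_derivatives_moment:
  fixes \<phi> :: "real ^ 'n::finite \<Rightarrow> 'a::euclidean_space"
  assumes "schwartz \<phi>" "\<xi> \<noteq> 0" "T \<in> sets borel"
  shows "(directional_derivative \<eta> ^^ l) (moment T q \<phi> \<xi>) = moment T q ((directional_derivative \<eta> ^^ l) \<phi>) \<xi>"
  by (induction l) (simp_all add: directional_derivative_moment schwartz_directional_derivatives assms)

lemma moment_linear_combination:
  fixes \<phi> :: "'b \<Rightarrow> real ^ 'n::finite \<Rightarrow> 'a::euclidean_space"
  assumes "finite J" "\<And>j. j \<in> J \<Longrightarrow> schwartz (\<phi> j)" "\<xi> \<noteq> 0" "T \<in> sets borel"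
  shows "moment T q (\<lambda>x. \<Sum>j\<in>J. c j *\<^sub>R \<phi> j x) \<xi> x = (\<Sum>j\<in>J. c j *\<^sub>R moment T q (\<phi> j) \<xi> x)"
proof -
  have "integrable lborel (\<lambda>t. indicator T t *\<^sub>R t ^ q *\<^sub>R \<phi> j (x + t *\<^sub>R \<xi>))" if "j \<in> J" for j
    using schwartz_line_set_integrable[OF assms(2)[OF that] assms(3,4), of q x] by (simp add: set_integrable_def)
  then show ?thesis
    unfolding moment_def set_lebesgue_integral_def
    by (simp add: scaleR_sum_right scaleR_left_commute[of _ "c _"] flip: scaleR_scaleR)
qed

lemma moment_contraction:
  fixes \<phi> :: "'n::finite list \<Rightarrow> real ^ 'n::finite \<Rightarrow> 'a::euclidean_space"
  assumes "\<And>is. length is = r \<Longrightarrow> schwartz (\<phi> is)" "\<xi> \<noteq> 0" "T \<in> sets borel"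
  shows "moment T q (\<lambda>x. contraction r (\<lambda>is. \<phi> is x) \<zeta>) \<xi> x = contraction r (\<lambda>is. moment T q (\<phi> is) \<xi> x) \<zeta>"
  unfolding contraction_def using assms by (intro moment_linear_combination) auto

lemma FTC_half_line:
  fixes G g :: "real \<Rightarrow> 'a::euclidean_space"
  assumes G: "\<And>t. (G has_vector_derivative g t) (at t)"
    and g: "continuous_on UNIV g" "integrable lborel g"
    and L: "(G \<longlongrightarrow> L) at_top"
  shows "(LINT t:{0..}|lborel. g t) = L - G 0"
proof -
  have "(LBINT t=0..\<infinity>. g t) = L - G 0"
  proof (rule interval_integral_FTC_integrable)
    show "isCont g t" for t using g(1) by (simp add: continuous_on_eq_continuous_at)
    show "set_integrable lborel (einterval 0 \<infinity>) g"
      using g(2) by (auto simp: set_integrable_def intro!: integrable_mult_indicator)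
    have "isCont G 0" using G by (rule has_vector_derivative_continuous)
    then show "((G \<circ> real_of_ereal) \<longlongrightarrow> G 0) (at_right 0)"
      by (simp add: zero_ereal_def ereal_tendsto_simps1 isCont_def filterlim_at_split)
    show "((G \<circ> real_of_ereal) \<longlongrightarrow> L) (at_left \<infinity>)"
      using L by (simp add: ereal_tendsto_simps1)
  qed (use G in auto)
  moreover have "(LBINT t=0..\<infinity>. g t) = (LINT t:{0..}|lborel. g t)"
    unfolding interval_lebesgue_integral_def set_lebesgue_integral_def
    by (simp, rule integral_cong_AE)
      (use g AE_lborel_singleton[of 0] in \<open>auto simp: einterval_def zero_ereal_def indicator_def elim!: eventually_mono\<close>)
  ultimately show ?thesis by simp
qed

lemma FTC_whole_line:
  fixes G g :: "real \<Rightarrow> 'a::euclidean_space"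
  assumes G: "\<And>t. (G has_vector_derivative g t) (at t)"
    and g: "continuous_on UNIV g" "integrable lborel g"
    and L: "(G \<longlongrightarrow> L) at_top" "(G \<longlongrightarrow> L') at_bot"
  shows "(LINT t|lborel. g t) = L - L'"
proof -
  have "(LBINT t=-\<infinity>..\<infinity>. g t) = L - L'"
  proof (rule interval_integral_FTC_integrable)
    show "isCont g t" for t using g(1) by (simp add: continuous_on_eq_continuous_at)
    show "set_integrable lborel (einterval (-\<infinity>) \<infinity>) g"
      using g(2) by (simp add: set_integrable_def)
    show "((G \<circ> real_of_ereal) \<longlongrightarrow> L') (at_right (-\<infinity>))" "((G \<circ> real_of_ereal) \<longlongrightarrow> L) (at_left \<infinity>)"
      using L by (simp_all add: ereal_tendsto_simps1)
  qed (use G in auto)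
  then show ?thesis by (simp add: interval_lebesgue_integral_def set_lebesgue_integral_def)
qed

lemma tendsto_zero_of_bound:
  fixes g :: "real \<Rightarrow> 'a::real_normed_vector"
  assumes "\<And>t. norm (g t) \<le> C / (1 + \<bar>t\<bar>)"
  shows "(g \<longlongrightarrow> 0) at_top" "(g \<longlongrightarrow> 0) at_bot"
proof -
  have lim: "((\<lambda>t. C / (1 + \<bar>t\<bar>)) \<longlongrightarrow> 0) at_top" "((\<lambda>t. C / (1 + \<bar>t\<bar>)) \<longlongrightarrow> 0) at_bot"
    by real_asymp+
  show "(g \<longlongrightarrow> 0) at_top" by (rule Lim_null_comparison[OF _ lim(1)]) (simp add: assms)
  show "(g \<longlongrightarrow> 0) at_bot" by (rule Lim_null_comparison[OF _ lim(2)]) (simp add: assms)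
qed

lemma moment_directional_derivative_antiderivative:
  fixes \<phi> :: "real ^ 'n::finite \<Rightarrow> 'a::euclidean_space" and q :: nat
  assumes \<phi>: "schwartz \<phi>" and \<xi>: "\<xi> \<noteq> 0"
  defines "G \<equiv> \<lambda>t x. t ^ q *\<^sub>R \<phi> (x + t *\<^sub>R \<xi>)"
    and "g \<equiv> \<lambda>t x. real q *\<^sub>R (t ^ (q - 1) *\<^sub>R \<phi> (x + t *\<^sub>R \<xi>)) + t ^ q *\<^sub>R directional_derivative \<xi> \<phi> (x + t *\<^sub>R \<xi>)"
  shows "((\<lambda>t. G t x) has_vector_derivative g t x) (at t)" "continuous_on UNIV (\<lambda>t. g t x)" "integrable lborel (\<lambda>t. g t x)"
    "((\<lambda>t. G t x) \<longlongrightarrow> 0) at_top" "((\<lambda>t. G t x) \<longlongrightarrow> 0) at_bot"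
proof -
  have "((\<lambda>t. t ^ q) has_real_derivative real q * t ^ (q - 1)) (at t)"
    using DERIV_pow[of q t] by simp
  from has_vector_derivative_scaleR[OF this smooth_has_vector_derivative_line[OF schwartz_smooth[OF \<phi>], of x \<xi> t]]
  show "((\<lambda>t. G t x) has_vector_derivative g t x) (at t)"
    by (simp add: G_def g_def add.commute)
  show "continuous_on UNIV (\<lambda>t. g t x)"
    unfolding g_def
    by (intro continuous_intros continuous_on_line schwartz_smooth schwartz_directional_derivative \<phi>)
  show "integrable lborel (\<lambda>t. g t x)"
    unfolding g_def
    by (intro Bochner_Integration.integrable_add integrable_scaleR_right schwartz_line_integrable \<phi> \<xi> schwartz_directional_derivative)
  obtain C where C: "\<And>t. norm (G t x) \<le> C / (1 + \<bar>t\<bar>) ^ 1"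
    using schwartz_line_bound[OF \<phi> \<xi>, of q x 1] by (auto simp: G_def)
  then show "((\<lambda>t. G t x) \<longlongrightarrow> 0) at_top" "((\<lambda>t. G t x) \<longlongrightarrow> 0) at_bot"
    by (auto intro: tendsto_zero_of_bound)
qed

lemma moment_UNIV: "moment UNIV q \<phi> \<xi> x = (LINT t|lborel. t ^ q *\<^sub>R \<phi> (x + t *\<^sub>R \<xi>))"
  by (simp add: moment_def set_lebesgue_integral_def)

lemma moment_UNIV_directional_derivative:
  fixes \<phi> :: "real ^ 'n::finite \<Rightarrow> 'a::euclidean_space"
  assumes \<phi>: "schwartz \<phi>" and \<xi>: "\<xi> \<noteq> 0"
  shows "moment UNIV q (directional_derivative \<xi> \<phi>) \<xi> x = - (real q *\<^sub>R moment UNIV (q - 1) \<phi> \<xi> x)"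
proof -
  have "(LINT t|lborel. real q *\<^sub>R (t ^ (q - 1) *\<^sub>R \<phi> (x + t *\<^sub>R \<xi>)) + t ^ q *\<^sub>R directional_derivative \<xi> \<phi> (x + t *\<^sub>R \<xi>)) = 0 - 0"
    by (rule FTC_whole_line) (rule moment_directional_derivative_antiderivative[OF assms])+
  then have "real q *\<^sub>R moment UNIV (q - 1) \<phi> \<xi> x + moment UNIV q (directional_derivative \<xi> \<phi>) \<xi> x = 0"
    by (subst (asm) Bochner_Integration.integral_add)
      (simp_all only: moment_UNIV integral_scaleR_right diff_0_right diff_self
        integrable_scaleR_right schwartz_line_integrable assms schwartz_directional_derivative simp_thms not_False_eq_True)
  then show ?thesis by (simp add: add_eq_0_iff add.commute)
qed

lemma moment_half_line_directional_derivative: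
  fixes \<phi> :: "real ^ 'n::finite \<Rightarrow> 'a::euclidean_space"
  assumes \<phi>: "schwartz \<phi>" and \<xi>: "\<xi> \<noteq> 0"
  shows "moment {0..} q (directional_derivative \<xi> \<phi>) \<xi> x =
    - (real q *\<^sub>R moment {0..} (q - 1) \<phi> \<xi> x) - (if q = 0 then \<phi> x else 0)"
proof -
  have f1: "(LINT t:{0..}|lborel. real q *\<^sub>R (t ^ (q - 1) *\<^sub>R \<phi> (x + t *\<^sub>R \<xi>)) + t ^ q *\<^sub>R directional_derivative \<xi> \<phi> (x + t *\<^sub>R \<xi>)) =
      0 - 0 ^ q *\<^sub>R \<phi> (x + 0 *\<^sub>R \<xi>)"
    by (rule FTC_half_line) (rule moment_directional_derivative_antiderivative[OF assms])+
  have f2: "(LINT t:{0..}|lborel. real q *\<^sub>R (t ^ (q - 1) *\<^sub>R \<phi> (x + t *\<^sub>R \<xi>)) + t ^ q *\<^sub>R directional_derivative \<xi> \<phi> (x + t *\<^sub>R \<xi>)) =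
      real q *\<^sub>R moment {0..} (q - 1) \<phi> \<xi> x + moment {0..} q (directional_derivative \<xi> \<phi>) \<xi> x"
    unfolding moment_def
    by (subst set_integral_add)
      (auto simp del: scaleR_scaleR simp: set_integrable_scaleR_right set_integral_scaleR_right
        intro!: schwartz_line_set_integrable assms schwartz_directional_derivative)
  have eq: "real q *\<^sub>R moment {0..} (q - 1) \<phi> \<xi> x + moment {0..} q (directional_derivative \<xi> \<phi>) \<xi> x =
      0 - 0 ^ q *\<^sub>R \<phi> (x + 0 *\<^sub>R \<xi>)"
    by (rule trans[OF sym[OF f2] f1])
  have solve: "v = - u - w" if "u + v = 0 - w" for u v w :: 'a
    using that by (metis add_diff_cancel_left' diff_0 uminus_add_conv_diff add_uminus_conv_diff add.commute)
  have "0 ^ q *\<^sub>R \<phi> (x + 0 *\<^sub>R \<xi>) = (if q = 0 then \<phi> x else 0)" by simp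
  with solve[OF eq] show ?thesis by (simp only:)
qed

lemma moment_half_line_reflect:
  fixes \<phi> :: "real ^ 'n::finite \<Rightarrow> 'a::euclidean_space"
  assumes \<phi>: "schwartz \<phi>" and \<xi>: "\<xi> \<noteq> 0"
  shows "moment UNIV q \<phi> \<xi> x = moment {0..} q \<phi> \<xi> x + (- 1) ^ q *\<^sub>R moment {0..} q \<phi> (- \<xi>) x"
proof -
  let ?g = "\<lambda>t. t ^ q *\<^sub>R \<phi> (x + t *\<^sub>R \<xi>)"
  have int: "integrable lborel (\<lambda>t. indicator A t *\<^sub>R ?g t)" if "A \<in> sets borel" for A
    using schwartz_line_set_integrable[OF assms that] by (simp add: set_integrable_def)
  have "moment UNIV q \<phi> \<xi> x = (LINT t|lborel. indicator {0..} t *\<^sub>R ?g t + indicator {..0} t *\<^sub>R ?g t)"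
    unfolding moment_UNIV
    by (rule integral_cong_AE)
      (use int[of "{0..}"] int[of "{..0}"] int[of UNIV] AE_lborel_singleton[of 0] in
        \<open>auto simp: indicator_def elim!: eventually_mono\<close>)
  also have "\<dots> = moment {0..} q \<phi> \<xi> x + (LINT t|lborel. indicator {..0} t *\<^sub>R ?g t)"
    unfolding moment_def set_lebesgue_integral_def
    by (rule Bochner_Integration.integral_add) (rule int, simp)+
  also have "(LINT t|lborel. indicator {..0} t *\<^sub>R ?g t) = (LINT t|lborel. indicator {..0} (- t) *\<^sub>R ?g (- t))"
    by (subst lborel_integral_real_affine[where c = "-1" and t = 0]) auto
  also have "\<dots> = (- 1) ^ q *\<^sub>R moment {0..} q \<phi> (- \<xi>) x"
    unfolding moment_def set_lebesgue_integral_def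
    by (subst integral_scaleR_right[symmetric], rule Bochner_Integration.integral_cong)
      (auto simp: indicator_def power_minus')
  finally show ?thesis .
qed

lemma moment_scale:
  fixes \<phi> :: "real ^ 'n::finite \<Rightarrow> 'a::euclidean_space"
  assumes c: "0 < c" and T: "\<And>t. c * t \<in> T \<longleftrightarrow> t \<in> T"
  shows "moment T q \<phi> \<xi> x = c ^ Suc q *\<^sub>R moment T q \<phi> (c *\<^sub>R \<xi>) x"
proof -
  have "moment T q \<phi> \<xi> x = \<bar>c\<bar> *\<^sub>R (LINT t|lborel. indicator T (0 + c * t) *\<^sub>R (0 + c * t) ^ q *\<^sub>R \<phi> (x + (0 + c * t) *\<^sub>R \<xi>))"
    unfolding moment_def set_lebesgue_integral_def using c by (intro lborel_integral_real_affine) simp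
  also have "(\<lambda>t. indicator T (0 + c * t) *\<^sub>R (0 + c * t) ^ q *\<^sub>R \<phi> (x + (0 + c * t) *\<^sub>R \<xi>)) =
      (\<lambda>t. c ^ q *\<^sub>R indicator T t *\<^sub>R t ^ q *\<^sub>R \<phi> (x + t *\<^sub>R c *\<^sub>R \<xi>))"
    using T by (auto simp: fun_eq_iff indicator_def power_mult_distrib mult_ac)
  also have "\<bar>c\<bar> *\<^sub>R (LINT t|lborel. c ^ q *\<^sub>R indicator T t *\<^sub>R t ^ q *\<^sub>R \<phi> (x + t *\<^sub>R c *\<^sub>R \<xi>)) =
      c *\<^sub>R c ^ q *\<^sub>R moment T q \<phi> (c *\<^sub>R \<xi>) x"
    using c by (simp only: moment_def set_lebesgue_integral_def integral_scaleR_right) simp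
  also have "\<dots> = c ^ Suc q *\<^sub>R moment T q \<phi> (c *\<^sub>R \<xi>) x"
    by simp
  finally show ?thesis .
qed

lemma moment_UNIV_translate:
  fixes \<phi> :: "real ^ 'n::finite \<Rightarrow> 'a::euclidean_space"
  assumes \<phi>: "schwartz \<phi>" and \<xi>: "\<xi> \<noteq> 0"
  shows "moment UNIV q \<phi> \<xi> (x + a *\<^sub>R \<xi>) =
    (\<Sum>i\<le>q. (real (q choose i) * (- a) ^ (q - i)) *\<^sub>R moment UNIV i \<phi> \<xi> x)"
proof -
  have "moment UNIV q \<phi> \<xi> (x + a *\<^sub>R \<xi>) =
      \<bar>1 :: real\<bar> *\<^sub>R (LINT t|lborel. (- a + 1 * t) ^ q *\<^sub>R \<phi> (x + a *\<^sub>R \<xi> + (- a + 1 * t) *\<^sub>R \<xi>))"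
    unfolding moment_UNIV by (intro lborel_integral_real_affine) simp
  also have "\<dots> = (LINT t|lborel. (t + - a) ^ q *\<^sub>R \<phi> (x + t *\<^sub>R \<xi>))"
    by (simp add: algebra_simps)
  also have "\<dots> = (LINT t|lborel. (\<Sum>i\<le>q. (real (q choose i) * (- a) ^ (q - i)) *\<^sub>R (t ^ i *\<^sub>R \<phi> (x + t *\<^sub>R \<xi>))))"
    unfolding binomial_ring scaleR_sum_left by (simp add: mult_ac)
  also have "\<dots> = (\<Sum>i\<le>q. (real (q choose i) * (- a) ^ (q - i)) *\<^sub>R moment UNIV i \<phi> \<xi> x)"
    unfolding moment_UNIV
    by (subst Bochner_Integration.integral_sum)
      (simp_all only: integral_scaleR_right integrable_scaleR_right schwartz_line_integrable assms simp_thms not_False_eq_True)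
  finally show ?thesis .
qed

text \<open>
  If \<open>x\<close> and \<open>\<xi>\<close> form an acute angle, the half-line from \<open>x\<close> in direction \<open>\<xi>\<close> leads away from the
  origin, and \<open>x + t \<xi>\<close> is at least as long as both \<open>x\<close> and \<open>t \<xi>\<close>.
\<close>

lemma moment_half_line_bound:
  fixes \<phi> :: "real ^ 'n::finite \<Rightarrow> 'a::euclidean_space"
  assumes \<phi>: "schwartz \<phi>" and \<xi>: "\<xi> \<noteq> 0"
  obtains K where "0 \<le> K" "\<And>x. 0 \<le> x \<bullet> \<xi> \<Longrightarrow> norm (moment {0..} q \<phi> \<xi> x) \<le> K / (1 + norm x)"
proof -
  obtain A where A: "0 < A" "\<And>x. norm (\<phi> x) \<le> A / (1 + norm x) ^ (q + 3)"
    using schwartz_bound[OF \<phi>] by blast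
  \<comment> \<open>with this choice \<open>\<kappa> (1 + t) \<le> 1 + t |\<xi>|\<close> for \<open>t \<ge> 0\<close>\<close>
  define \<kappa> where "\<kappa> = min 1 (norm \<xi>)"
  have \<kappa>: "0 < \<kappa>" using \<xi> by (simp add: \<kappa>_def)
  have le: "norm (indicator {0..} t *\<^sub>R t ^ q *\<^sub>R \<phi> (x + t *\<^sub>R \<xi>)) \<le> A / (\<kappa> ^ (q + 2) * (1 + norm x)) * (1 / (1 + \<bar>t\<bar>)\<^sup>2)"
    if x: "0 \<le> x \<bullet> \<xi>" for x t
  proof (cases "0 \<le> t")
    case t: True
    define z where "z = x + t *\<^sub>R \<xi>"
    have z: "(norm z)\<^sup>2 = (norm x)\<^sup>2 + 2 * t * (x \<bullet> \<xi>) + (t * norm \<xi>)\<^sup>2"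
      unfolding z_def by (simp add: power2_norm_eq_inner power_mult_distrib inner_add_left inner_add_right inner_commute[of \<xi> x]
          algebra_simps power2_eq_square[of t])
    have zx: "norm x \<le> norm z" "t * norm \<xi> \<le> norm z"
    proof -
      have "(norm x)\<^sup>2 \<le> (norm z)\<^sup>2" "(t * norm \<xi>)\<^sup>2 \<le> (norm z)\<^sup>2" unfolding z using x t by simp_all
      then show "norm x \<le> norm z" "t * norm \<xi> \<le> norm z" by (auto dest: power2_le_imp_le)
    qed
    have "\<kappa> * (1 + t) \<le> 1 + t * norm \<xi>"
    proof -
      have "\<kappa> * 1 \<le> 1" "t * \<kappa> \<le> t * norm \<xi>" using t by (auto simp: \<kappa>_def intro: mult_left_mono)
      then show ?thesis by (simp add: algebra_simps)
    qed
    then have "\<kappa> * (1 + t) \<le> 1 + norm z" using zx(2) by linarith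
    then have "(\<kappa> * (1 + t)) ^ (q + 2) * (1 + norm x) \<le> (1 + norm z) ^ (q + 2) * (1 + norm z)"
      using \<kappa> t zx(1) by (intro mult_mono power_mono) auto
    then have *: "\<kappa> ^ (q + 2) * (1 + t) ^ (q + 2) * (1 + norm x) \<le> (1 + norm z) ^ (q + 3)"
      by (simp add: power_mult_distrib numeral_3_eq_3 mult_ac)
    have "norm (\<phi> z) \<le> A / (1 + norm z) ^ (q + 3)" by (rule A(2))
    also have "\<dots> \<le> A / (\<kappa> ^ (q + 2) * (1 + t) ^ (q + 2) * (1 + norm x))"
      using A(1) \<kappa> t by (intro divide_left_mono *) (auto intro!: mult_pos_pos zero_less_power add_pos_nonneg)
    finally have "norm (\<phi> z) \<le> A / (\<kappa> ^ (q + 2) * (1 + norm x)) / (1 + \<bar>t\<bar>) ^ (q + 2)"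
      using t by (simp add: mult_ac)
    then have "\<bar>t\<bar> ^ q * norm (\<phi> z) \<le> \<bar>t\<bar> ^ q * (A / (\<kappa> ^ (q + 2) * (1 + norm x)) / (1 + \<bar>t\<bar>) ^ (q + 2))"
      by (intro mult_left_mono) auto
    also have "\<dots> \<le> A / (\<kappa> ^ (q + 2) * (1 + norm x)) / (1 + \<bar>t\<bar>)\<^sup>2"
      using A(1) \<kappa> by (intro power_div_power_bound) (auto intro!: divide_nonneg_nonneg mult_nonneg_nonneg)
    finally show ?thesis using t by (simp add: z_def power_abs)
  next
    case False
    then show ?thesis using A(1) \<kappa> by (auto intro!: divide_nonneg_nonneg mult_nonneg_nonneg)
  qed
  define I where "I = (LINT t|lborel. 1 / (1 + \<bar>t :: real\<bar>)\<^sup>2)"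
  have I: "0 \<le> I" unfolding I_def by (intro integral_nonneg_AE) auto
  have "norm (moment {0..} q \<phi> \<xi> x) \<le> (A * I / \<kappa> ^ (q + 2)) / (1 + norm x)" if x: "0 \<le> x \<bullet> \<xi>" for x
  proof -
    have "norm (moment {0..} q \<phi> \<xi> x) \<le> (LINT t|lborel. A / (\<kappa> ^ (q + 2) * (1 + norm x)) * (1 / (1 + \<bar>t\<bar>)\<^sup>2))"
      unfolding moment_def set_lebesgue_integral_def
      by (intro Bochner_Integration.integral_norm_bound_integral integrable_mult_right integrable_inverse_square le[OF x]
          schwartz_line_set_integrable[OF \<phi> \<xi>, unfolded set_integrable_def]) auto
    also have "\<dots> = (A * I / \<kappa> ^ (q + 2)) / (1 + norm x)"
      unfolding I_def integral_mult_right_zero by (simp add: mult_ac)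
    finally show ?thesis .
  qed
  then show ?thesis using that[of "A * I / \<kappa> ^ (q + 2)"] A(1) I \<kappa> by simp
qed

text \<open>
  If the moment over the whole line vanishes, the half-line moment may be computed along whichever
  of the two half-lines leads away from the origin; hence it decays.
\<close>

lemma moment_half_line_tendsto_zero:
  fixes \<phi> :: "real ^ 'n::finite \<Rightarrow> 'a::euclidean_space"
  assumes \<phi>: "schwartz \<phi>" and \<xi>: "\<xi> \<noteq> 0" and zero: "\<And>x. moment UNIV q \<phi> \<xi> x = 0"
  shows "(moment {0..} q \<phi> \<xi> \<longlongrightarrow> 0) at_infinity"
proof -
  obtain K where K: "0 \<le> K" "\<And>x. 0 \<le> x \<bullet> \<xi> \<Longrightarrow> norm (moment {0..} q \<phi> \<xi> x) \<le> K / (1 + norm x)"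
    using moment_half_line_bound[OF \<phi> \<xi>] by blast
  obtain K' where K': "0 \<le> K'" "\<And>x. 0 \<le> x \<bullet> (- \<xi>) \<Longrightarrow> norm (moment {0..} q \<phi> (- \<xi>) x) \<le> K' / (1 + norm x)"
    using moment_half_line_bound[OF \<phi>, of "- \<xi>"] \<xi> by (metis neg_equal_0_iff_equal)
  have "norm (moment {0..} q \<phi> \<xi> x) \<le> (K + K') / (1 + norm x)" for x
  proof (cases "0 \<le> x \<bullet> \<xi>")
    case True
    have "K / (1 + norm x) \<le> (K + K') / (1 + norm x)" using K'(1) by (intro divide_right_mono) auto
    then show ?thesis using K(2)[OF True] by linarith
  next
    case False
    have "moment {0..} q \<phi> \<xi> x = - ((- 1) ^ q *\<^sub>R moment {0..} q \<phi> (- \<xi>) x)"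
      using moment_half_line_reflect[OF \<phi> \<xi>, of q x] zero[of x] by (simp add: eq_neg_iff_add_eq_0)
    then have "norm (moment {0..} q \<phi> \<xi> x) = norm (moment {0..} q \<phi> (- \<xi>) x)" by (simp add: power_abs)
    also have "\<dots> \<le> K' / (1 + norm x)" using False by (intro K'(2)) simp
    also have "\<dots> \<le> (K + K') / (1 + norm x)" using K(1) by (intro divide_right_mono) auto
    finally show ?thesis .
  qed
  then have le: "norm (moment {0..} q \<phi> \<xi> x) \<le> (K + K') / (1 + norm x)" for x .
  have "filterlim (\<lambda>x :: real ^ 'n. 1 + norm x) at_top at_infinity"
    by (rule filterlim_tendsto_add_at_top[OF tendsto_const filterlim_norm_at_top])
  then have "((\<lambda>x :: real ^ 'n. (K + K') / (1 + norm x)) \<longlongrightarrow> 0) at_infinity"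
    by (intro tendsto_divide_0[OF tendsto_const] filterlim_at_top_imp_at_infinity)
  then show ?thesis
    by (rule Lim_null_comparison[rotated]) (simp add: le)
qed

section \<open>Injectivity of the X-ray transform\<close>

lemma integrable_pair_bound:
  fixes f :: "real \<Rightarrow> real \<Rightarrow> 'a::euclidean_space" and a b :: "real \<Rightarrow> real"
  assumes f [measurable]: "(\<lambda>(s, t). f s t) \<in> borel_measurable (lborel \<Otimes>\<^sub>M lborel)"
    and a: "integrable lborel a" and b: "integrable lborel b"
    and le: "\<And>s t. norm (f s t) \<le> a s * b t"
  shows "integrable (lborel \<Otimes>\<^sub>M lborel) (\<lambda>(s, t). f s t)"
proof (rule Bochner_Integration.integrable_bound)
  note [measurable] = borel_measurable_integrable[OF a] borel_measurable_integrable[OF b]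
  show "integrable (lborel \<Otimes>\<^sub>M lborel) (\<lambda>(s, t). a s * b t)"
  proof (rule lborel_pair.Fubini_integrable)
    show "integrable lborel (\<lambda>s. LINT t|lborel. norm (case (s, t) of (s, t) \<Rightarrow> a s * b t))"
      using a b by (simp add: abs_mult)
  qed (use a b in auto)
  have "norm (f s t) \<le> norm (a s * b t)" for s t
    using le[of s t] by simp
  then show "AE p in lborel \<Otimes>\<^sub>M lborel. norm (case p of (s, t) \<Rightarrow> f s t) \<le> norm (case p of (s, t) \<Rightarrow> a s * b t)"
    by (intro AE_I2) (auto split: prod.split)
qed fact

text \<open>
  The real part of the characteristic function of the normal distribution.
\<close>

lemma cos_integral_std_normal_density:
  "(LINT \<alpha>|lborel. std_normal_density \<alpha> * cos (\<alpha> * u)) = exp (- u\<^sup>2 / 2)"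
proof -
  interpret real_distribution std_normal_distribution by (rule real_dist_normal_dist)
  have int: "integrable std_normal_distribution (\<lambda>\<alpha>. iexp (u * \<alpha>))"
    by (intro integrable_iexp) auto
  have "exp (- u\<^sup>2 / 2) = Re (char std_normal_distribution u)"
    by (simp add: char_std_normal_distribution del: of_real_exp)
  also have "\<dots> = (LINT \<alpha>|std_normal_distribution. cos (u * \<alpha>))"
    unfolding char_def integral_Re[OF int, symmetric] by (simp add: Re_exp)
  also have "\<dots> = (LINT \<alpha>|lborel. std_normal_density \<alpha> *\<^sub>R cos (u * \<alpha>))"
    by (rule integral_density) (auto simp: normal_density_nonneg)
  finally show ?thesis by (simp add: mult.commute)
qed

text \<open>
  The Gaussian is a superposition of cosines with Gaussian weights, so an integral against it is a
  superposition of integrals against cosines.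
\<close>

lemma gaussian_integral_eq_zero:
  fixes g :: "real \<Rightarrow> 'a::euclidean_space"
  assumes g: "integrable lborel g"
    and cos: "\<And>\<omega>. \<omega> \<noteq> 0 \<Longrightarrow> (LINT t|lborel. cos (\<omega> * t) *\<^sub>R g t) = 0"
  shows "(LINT t|lborel. std_normal_density t *\<^sub>R g t) = 0"
proof -
  note [measurable] = borel_measurable_integrable[OF g]
  have "integrable (lborel \<Otimes>\<^sub>M lborel) (\<lambda>(\<alpha>, u). (std_normal_density \<alpha> * cos (\<alpha> * u)) *\<^sub>R g u)"
  proof (rule integrable_pair_bound)
    show "integrable lborel std_normal_density" by simp
    show "integrable lborel (\<lambda>u. norm (g u))" using g by simp
    show "norm ((std_normal_density \<alpha> * cos (\<alpha> * u)) *\<^sub>R g u) \<le> std_normal_density \<alpha> * norm (g u)" for \<alpha> u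
    proof -
      have "std_normal_density \<alpha> * \<bar>cos (\<alpha> * u)\<bar> \<le> std_normal_density \<alpha> * 1"
        by (intro mult_left_mono) auto
      then show ?thesis by (simp add: abs_mult mult_right_mono)
    qed
  qed measurable
  from lborel_pair.Fubini_integral[OF this]
  have "(LINT u|lborel. LINT \<alpha>|lborel. (std_normal_density \<alpha> * cos (\<alpha> * u)) *\<^sub>R g u) =
      (LINT \<alpha>|lborel. LINT u|lborel. (std_normal_density \<alpha> * cos (\<alpha> * u)) *\<^sub>R g u)" .
  also have "\<dots> = (LINT \<alpha>|lborel. std_normal_density \<alpha> *\<^sub>R (LINT u|lborel. cos (\<alpha> * u) *\<^sub>R g u))"
    by (simp flip: scaleR_scaleR)
  also have "\<dots> = 0"
    by (rule integral_eq_zero_AE) (use AE_lborel_singleton[of 0] in \<open>auto simp: cos elim!: eventually_mono\<close>)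
  finally have "(LINT u|lborel. LINT \<alpha>|lborel. (std_normal_density \<alpha> * cos (\<alpha> * u)) *\<^sub>R g u) = 0" .
  moreover have "(LINT \<alpha>|lborel. (std_normal_density \<alpha> * cos (\<alpha> * u)) *\<^sub>R g u) = exp (- u\<^sup>2 / 2) *\<^sub>R g u" for u
  proof -
    have "integrable lborel (\<lambda>\<alpha>. std_normal_density \<alpha> * cos (\<alpha> * u))"
    proof (rule Bochner_Integration.integrable_bound)
      show "integrable lborel std_normal_density" by simp
      show "AE \<alpha> in lborel. norm (std_normal_density \<alpha> * cos (\<alpha> * u)) \<le> norm (std_normal_density \<alpha>)"
        by (intro AE_I2) (simp add: abs_mult mult_left_le)
    qed measurable
    then show ?thesis by (simp add: cos_integral_std_normal_density)
  qed
  ultimately have "(LINT u|lborel. exp (- u\<^sup>2 / 2) *\<^sub>R g u) = 0"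
    by (simp only:)
  then have "(1 / sqrt (2 * pi)) *\<^sub>R (LINT u|lborel. exp (- u\<^sup>2 / 2) *\<^sub>R g u) = 0" by simp
  then show ?thesis
    by (simp only: std_normal_density_def flip: integral_scaleR_right scaleR_scaleR)
qed

text \<open>
  Integrals against Gaussians of width \<open>\<sigma>\<close> centred at \<open>a\<close> vanish; as \<open>\<sigma>\<close> tends to \<open>0\<close> they converge
  to \<open>g a\<close>.  The frequency \<open>0\<close> is left out because the Fourier slice argument does not reach it.
\<close>

lemma fourier_uniqueness:
  fixes g :: "real \<Rightarrow> 'a::euclidean_space"
  assumes cont: "continuous_on UNIV g" and bound: "\<And>t. norm (g t) \<le> C / (1 + \<bar>t\<bar>)\<^sup>2"
    and cos: "\<And>\<omega>. \<omega> \<noteq> 0 \<Longrightarrow> (LINT t|lborel. cos (\<omega> * t) *\<^sub>R g t) = 0"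
    and sin: "\<And>\<omega>. \<omega> \<noteq> 0 \<Longrightarrow> (LINT t|lborel. sin (\<omega> * t) *\<^sub>R g t) = 0"
  shows "g a = 0"
proof -
  have g: "integrable lborel g" by (rule integrable_continuous_bounded[OF cont bound])
  note [measurable] = borel_measurable_integrable[OF g]
  have trig: "integrable lborel (\<lambda>t. p t *\<^sub>R g t)"
    if "p \<in> borel_measurable borel" "\<And>t. \<bar>p t\<bar> \<le> 1" for p :: "real \<Rightarrow> real"
  proof (rule Bochner_Integration.integrable_bound[OF g])
    show "AE t in lborel. norm (p t *\<^sub>R g t) \<le> norm (g t)"
      using that(2) by (intro AE_I2) (simp add: mult_left_le_one_le)
  qed (use that(1) in measurable)
  have zero: "(LINT u|lborel. std_normal_density u *\<^sub>R g (a + \<sigma> * u)) = 0" if \<sigma>: "0 < \<sigma>" for \<sigma>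
  proof (rule gaussian_integral_eq_zero)
    show "integrable lborel (\<lambda>u. g (a + \<sigma> * u))"
      using lborel_integrable_real_affine[OF g, of \<sigma> a] \<sigma> by simp
    fix \<omega> :: real assume \<omega>: "\<omega> \<noteq> 0"
    \<comment> \<open>the frequency after the substitution \<open>t = a + \<sigma> u\<close>\<close>
    define p where "p = \<omega> / \<sigma>"
    have p: "p \<noteq> 0" using \<omega> \<sigma> by (simp add: p_def)
    have "(LINT t|lborel. cos (p * t - p * a) *\<^sub>R g t) =
        \<bar>\<sigma>\<bar> *\<^sub>R (LINT u|lborel. cos (p * (a + \<sigma> * u) - p * a) *\<^sub>R g (a + \<sigma> * u))"
      using \<sigma> by (intro lborel_integral_real_affine) simp
    also have "(\<lambda>u. cos (p * (a + \<sigma> * u) - p * a) *\<^sub>R g (a + \<sigma> * u)) = (\<lambda>u. cos (\<omega> * u) *\<^sub>R g (a + \<sigma> * u))"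
      using \<sigma> by (simp add: p_def algebra_simps)
    also have "(LINT t|lborel. cos (p * t - p * a) *\<^sub>R g t) =
        (LINT t|lborel. cos (p * a) *\<^sub>R (cos (p * t) *\<^sub>R g t) + sin (p * a) *\<^sub>R (sin (p * t) *\<^sub>R g t))"
      by (simp add: cos_diff scaleR_add_left mult.commute)
    also have "\<dots> = cos (p * a) *\<^sub>R (LINT t|lborel. cos (p * t) *\<^sub>R g t) + sin (p * a) *\<^sub>R (LINT t|lborel. sin (p * t) *\<^sub>R g t)"
      by (subst Bochner_Integration.integral_add) (auto simp del: scaleR_scaleR intro!: integrable_scaleR_right trig)
    also have "\<dots> = 0" by (simp add: cos[OF p] sin[OF p])
    finally show "(LINT u|lborel. cos (\<omega> * u) *\<^sub>R g (a + \<sigma> * u)) = 0"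
      using \<sigma> by simp
  qed
  have C: "0 \<le> C" using order_trans[OF norm_ge_zero bound[of 0]] by simp
  have gC: "norm (g t) \<le> C" for t
  proof -
    have "C / (1 + \<bar>t\<bar>)\<^sup>2 \<le> C / 1" using C by (intro divide_left_mono) (auto intro!: one_le_power)
    then show ?thesis using bound[of t] by simp
  qed
  have "(\<lambda>n. LINT u|lborel. std_normal_density u *\<^sub>R g (a + (1 / real (Suc n)) * u)) \<longlonglongrightarrow>
      (LINT u|lborel. std_normal_density u *\<^sub>R g (a + 0 * u))"
  proof (rule integral_dominated_convergence[where w = "\<lambda>u. std_normal_density u * C"])
    show "integrable lborel (\<lambda>u. std_normal_density u * C)" by simp
    show "AE u in lborel. (\<lambda>n. std_normal_density u *\<^sub>R g (a + (1 / real (Suc n)) * u)) \<longlonglongrightarrow> std_normal_density u *\<^sub>R g (a + 0 * u)"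
    proof (rule AE_I2)
      fix u :: real
      have "(\<lambda>n. a + (1 / real (Suc n)) * u) \<longlonglongrightarrow> a + 0 * u"
        by (intro tendsto_intros) (use LIMSEQ_inverse_real_of_nat in \<open>simp add: inverse_eq_divide\<close>)
      moreover have "isCont g (a + 0 * u)" using cont by (simp add: continuous_on_eq_continuous_at)
      ultimately have "(\<lambda>n. g (a + (1 / real (Suc n)) * u)) \<longlonglongrightarrow> g (a + 0 * u)"
        by (metis isCont_tendsto_compose)
      then show "(\<lambda>n. std_normal_density u *\<^sub>R g (a + (1 / real (Suc n)) * u)) \<longlonglongrightarrow> std_normal_density u *\<^sub>R g (a + 0 * u)"
        by (rule tendsto_scaleR[OF tendsto_const])
    qed
    show "AE u in lborel. norm (std_normal_density u *\<^sub>R g (a + (1 / real (Suc n)) * u)) \<le> std_normal_density u * C" for n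
      using gC by (intro AE_I2) (simp add: mult_left_mono)
  qed measurable
  moreover have "(LINT u|lborel. std_normal_density u *\<^sub>R g (a + (1 / real (Suc n)) * u)) = 0" for n
    by (rule zero) simp
  ultimately have "(LINT u|lborel. std_normal_density u *\<^sub>R g (a + 0 * u)) = 0"
    using LIMSEQ_unique[OF _ tendsto_const] by auto
  then show ?thesis by simp
qed

definition independent_pair :: "'v::real_vector \<Rightarrow> 'v \<Rightarrow> bool" where
  "independent_pair \<xi> \<eta> \<longleftrightarrow> (\<forall>a b. a *\<^sub>R \<xi> + b *\<^sub>R \<eta> = 0 \<longrightarrow> a = 0 \<and> b = 0)"

lemma independent_pair_shear: "independent_pair \<xi> \<eta> \<Longrightarrow> independent_pair (\<xi> + s *\<^sub>R \<eta>) \<eta>"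
  unfolding independent_pair_def
proof (intro allI impI)
  fix a b assume *: "\<forall>a b. a *\<^sub>R \<xi> + b *\<^sub>R \<eta> = 0 \<longrightarrow> a = 0 \<and> b = 0" "a *\<^sub>R (\<xi> + s *\<^sub>R \<eta>) + b *\<^sub>R \<eta> = 0"
  have "a *\<^sub>R \<xi> + (a * s + b) *\<^sub>R \<eta> = 0" using *(2) by (simp add: algebra_simps)
  with *(1) have "a = 0 \<and> a * s + b = 0" by blast
  then show "a = 0 \<and> b = 0" by auto
qed

lemma independent_pair_nonzero: "independent_pair \<xi> \<eta> \<Longrightarrow> \<xi> + s *\<^sub>R \<eta> \<noteq> 0"
  unfolding independent_pair_def by (metis scaleR_one zero_neq_one)

lemma schwartz_plane_bound:
  fixes \<phi> :: "real ^ 'n::finite \<Rightarrow> 'a::euclidean_space"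
  assumes \<phi>: "schwartz \<phi>" and ind: "independent_pair \<xi> \<eta>"
  obtains C where "0 < C" "\<And>t y. norm (\<phi> (x + t *\<^sub>R \<xi> + y *\<^sub>R \<eta>)) \<le> C / (1 + \<bar>t\<bar>)\<^sup>2 * (1 / (1 + \<bar>y\<bar>)\<^sup>2)"
proof -
  define f where "f p = fst p *\<^sub>R \<xi> + snd p *\<^sub>R \<eta>" for p :: "real \<times> real"
  have "linear f" by (rule linearI) (auto simp: f_def algebra_simps)
  moreover have "inj f"
    using ind \<open>linear f\<close> by (auto simp: linear_injective_0 f_def independent_pair_def prod_eq_iff)
  ultimately obtain B where B: "0 < B" "\<And>p. B * norm p \<le> norm (f p)"
    using linear_inj_bounded_below_pos by blast
  obtain A where A: "0 < A" "\<And>x. norm (\<phi> x) \<le> A / (1 + norm x) ^ 4"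
    using schwartz_bound[OF \<phi>] by blast
  define K where "K = 1 + (norm x + 1) / B"
  have K: "0 < K" using B by (auto simp: K_def intro!: add_pos_nonneg)
  have "norm (\<phi> (x + t *\<^sub>R \<xi> + y *\<^sub>R \<eta>)) \<le> (A * K ^ 4) / (1 + \<bar>t\<bar>)\<^sup>2 * (1 / (1 + \<bar>y\<bar>)\<^sup>2)" for t y
  proof -
    define z where "z = x + t *\<^sub>R \<xi> + y *\<^sub>R \<eta>"
    have "B * norm (t, y) \<le> norm (z - x)" using B(2)[of "(t, y)"] by (simp add: f_def z_def)
    also have "\<dots> \<le> norm z + norm x" by (rule norm_triangle_ineq4)
    also have "\<dots> \<le> (norm x + 1) * (1 + norm z)" by (simp add: algebra_simps)
    finally have "norm (t, y) \<le> (norm x + 1) / B * (1 + norm z)"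
      using B(1) by (simp add: field_simps)
    then have "1 + norm (t, y) \<le> K * (1 + norm z)"
      by (simp only: K_def distrib_right mult_1) (use norm_ge_zero[of z] in linarith)
    then have ty: "1 + \<bar>t\<bar> \<le> K * (1 + norm z)" "1 + \<bar>y\<bar> \<le> K * (1 + norm z)"
      using norm_fst_le[of t y] norm_snd_le[of y t] by auto
    have "(1 + \<bar>t\<bar>)\<^sup>2 * (1 + \<bar>y\<bar>)\<^sup>2 \<le> (K * (1 + norm z))\<^sup>2 * (K * (1 + norm z))\<^sup>2"
      by (intro mult_mono power_mono ty) auto
    also have "\<dots> = K ^ 4 * (1 + norm z) ^ 4" by (simp add: power_mult_distrib power4_eq_xxxx power2_eq_square mult_ac)
    finally have "A * ((1 + \<bar>t\<bar>)\<^sup>2 * (1 + \<bar>y\<bar>)\<^sup>2) \<le> A * (K ^ 4 * (1 + norm z) ^ 4)"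
      using A(1) by (intro mult_left_mono) auto
    then have "A / (1 + norm z) ^ 4 \<le> (A * K ^ 4) / ((1 + \<bar>t\<bar>)\<^sup>2 * (1 + \<bar>y\<bar>)\<^sup>2)"
      by (subst frac_le_eq) (auto simp: add_nonneg_eq_0_iff divide_simps mult_ac)
    then show ?thesis using A(2)[of z] by (simp add: z_def)
  qed
  then show ?thesis using A(1) K that[of "A * K ^ 4"] by auto
qed

text \<open>
  The integral of \<open>\<phi>\<close> against a plane wave over the plane through \<open>x\<close> spanned by \<open>\<xi>\<close> and \<open>\<eta>\<close> is a
  superposition of integrals over the parallel lines of direction \<open>\<xi> + s \<eta>\<close>.
\<close>

lemma plane_wave_integral:
  fixes \<phi> :: "real ^ 'n::finite \<Rightarrow> 'a::euclidean_space" and p :: "real \<Rightarrow> real"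
  assumes \<phi>: "schwartz \<phi>" and ind: "independent_pair \<xi> \<eta>"
    and zero: "\<And>x. moment UNIV 0 \<phi> (\<xi> + s *\<^sub>R \<eta>) x = 0"
    and p: "continuous_on UNIV p" "\<And>y. \<bar>p y\<bar> \<le> 1"
  shows "(LINT t|lborel. LINT y|lborel. p (y - s * t) *\<^sub>R \<phi> (x + t *\<^sub>R \<xi> + y *\<^sub>R \<eta>)) = 0"
proof -
  obtain C where C: "0 < C" "\<And>t y. norm (\<phi> (x + t *\<^sub>R (\<xi> + s *\<^sub>R \<eta>) + y *\<^sub>R \<eta>)) \<le> C / (1 + \<bar>t\<bar>)\<^sup>2 * (1 / (1 + \<bar>y\<bar>)\<^sup>2)"
    using schwartz_plane_bound[OF \<phi> independent_pair_shear[OF ind]] by blast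
  let ?f = "\<lambda>t b. p b *\<^sub>R \<phi> (x + t *\<^sub>R (\<xi> + s *\<^sub>R \<eta>) + b *\<^sub>R \<eta>)"
  have "integrable (lborel \<Otimes>\<^sub>M lborel) (\<lambda>(t, b). ?f t b)"
  proof (rule integrable_pair_bound)
    have "continuous_on UNIV (\<lambda>q. ?f (fst q) (snd q))"
      by (intro continuous_intros continuous_on_compose2[OF smooth_continuous[OF schwartz_smooth[OF \<phi>], of UNIV]]
          continuous_on_compose2[OF p(1)]) auto
    then show "(\<lambda>(t, b). ?f t b) \<in> borel_measurable (lborel \<Otimes>\<^sub>M lborel)"
      by (simp add: lborel_prod case_prod_beta' borel_measurable_continuous_onI)
    show "integrable lborel (\<lambda>t. C / (1 + \<bar>t\<bar>)\<^sup>2)"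
      using integrable_mult_right[OF integrable_inverse_square, of C] by simp
    show "norm (?f t b) \<le> C / (1 + \<bar>t\<bar>)\<^sup>2 * (1 / (1 + \<bar>b\<bar>)\<^sup>2)" for t b
      using mult_mono[OF p(2)[of b] C(2)[of t b]] by simp
  qed (rule integrable_inverse_square)
  from lborel_pair.Fubini_integral[OF this]
  have "(LINT t|lborel. LINT b|lborel. ?f t b) = (LINT b|lborel. LINT t|lborel. ?f t b)" by simp
  also have "\<dots> = (LINT b|lborel. p b *\<^sub>R moment UNIV 0 \<phi> (\<xi> + s *\<^sub>R \<eta>) (x + b *\<^sub>R \<eta>))"
    by (simp add: moment_UNIV add_ac)
  also have "\<dots> = 0" by (simp add: zero)
  finally have "(LINT t|lborel. LINT b|lborel. ?f t b) = 0" .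
  moreover have "(LINT b|lborel. ?f t b) = (LINT y|lborel. p (y - s * t) *\<^sub>R \<phi> (x + t *\<^sub>R \<xi> + y *\<^sub>R \<eta>))" for t
  proof -
    have "(LINT b|lborel. ?f t b) = \<bar>1 :: real\<bar> *\<^sub>R (LINT y|lborel. ?f t (- (s * t) + 1 * y))"
      by (rule lborel_integral_real_affine) simp
    then show ?thesis by (simp add: algebra_simps)
  qed
  ultimately show ?thesis by (simp only:)
qed

text \<open>
  In coordinates \<open>(t, y)\<close> of the plane through \<open>x\<close> spanned by \<open>\<xi>\<close> and \<open>\<eta>\<close>, plane waves constant along
  the direction \<open>(1, s)\<close> have the form \<open>e\<^bsup>i \<omega> (y - s t)\<^esup>\<close>; with \<open>s\<close> free they have all frequencies
  \<open>(- \<omega> s, \<omega>)\<close> with \<open>\<omega> \<noteq> 0\<close>.  Uniqueness on the line is applied first in \<open>t\<close> and then in \<open>y\<close>, so that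
  no change of variables by a rotation is needed.
\<close>

theorem xray_transform_injective:
  fixes \<phi> :: "real ^ 'n::finite \<Rightarrow> 'a::euclidean_space"
  assumes \<phi>: "schwartz \<phi>" and ind: "independent_pair \<xi> \<eta>"
    and zero: "\<And>s x. moment UNIV 0 \<phi> (\<xi> + s *\<^sub>R \<eta>) x = 0"
  shows "\<phi> x = 0"
proof -
  define h where "h t y = \<phi> (x + t *\<^sub>R \<xi> + y *\<^sub>R \<eta>)" for t y
  obtain C where C: "0 < C" "\<And>t y. norm (h t y) \<le> C / (1 + \<bar>t\<bar>)\<^sup>2 * (1 / (1 + \<bar>y\<bar>)\<^sup>2)"
    using schwartz_plane_bound[OF \<phi> ind, of x] unfolding h_def by blast
  have h_cont: "continuous_on UNIV (\<lambda>p. h (f p) (g p))"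
    if "continuous_on UNIV f" "continuous_on UNIV g" for f g :: "real \<Rightarrow> real"
    unfolding h_def
    by (intro continuous_intros that continuous_on_compose2[OF smooth_continuous[OF schwartz_smooth[OF \<phi>], of UNIV]]) auto
  define I where "I = (LINT y|lborel. 1 / (1 + \<bar>y :: real\<bar>)\<^sup>2)"
  have int_h: "integrable lborel (\<lambda>y. p y *\<^sub>R h t y)"
    and norm_ph: "norm (p y *\<^sub>R h t y) \<le> C / (1 + \<bar>t\<bar>)\<^sup>2 * (1 / (1 + \<bar>y\<bar>)\<^sup>2)"
    if p: "continuous_on UNIV p" "\<And>y. \<bar>p y\<bar> \<le> 1" for p :: "real \<Rightarrow> real" and t y
  proof -
    show le: "norm (p y *\<^sub>R h t y) \<le> C / (1 + \<bar>t\<bar>)\<^sup>2 * (1 / (1 + \<bar>y\<bar>)\<^sup>2)" for y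
      using mult_mono[OF p(2)[of y] C(2)[of t y]] by simp
    show "integrable lborel (\<lambda>y. p y *\<^sub>R h t y)"
      by (rule integrable_continuous_bounded[where C = "C / (1 + \<bar>t\<bar>)\<^sup>2"])
        (use le in \<open>auto intro!: continuous_intros p(1) h_cont\<close>)
  qed
  have H_cont: "continuous_on UNIV (\<lambda>t. LINT y|lborel. p y *\<^sub>R h t y)"
    and H_bound: "norm (LINT y|lborel. p y *\<^sub>R h t y) \<le> (C * I) / (1 + \<bar>t\<bar>)\<^sup>2"
    if p: "continuous_on UNIV p" "\<And>y. \<bar>p y\<bar> \<le> 1" for p :: "real \<Rightarrow> real" and t
  proof -
    have "norm (LINT y|lborel. p y *\<^sub>R h t y) \<le> (LINT y|lborel. C / (1 + \<bar>t\<bar>)\<^sup>2 * (1 / (1 + \<bar>y\<bar>)\<^sup>2))"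
      by (intro Bochner_Integration.integral_norm_bound_integral int_h p norm_ph integrable_mult_right integrable_inverse_square)
    also have "\<dots> = (C * I) / (1 + \<bar>t\<bar>)\<^sup>2"
      unfolding I_def integral_mult_right_zero by simp
    finally show "norm (LINT y|lborel. p y *\<^sub>R h t y) \<le> (C * I) / (1 + \<bar>t\<bar>)\<^sup>2" .
    show "continuous_on UNIV (\<lambda>t. LINT y|lborel. p y *\<^sub>R h t y)"
      unfolding continuous_on_sequentially
    proof (intro ballI allI impI)
      fix X :: "nat \<Rightarrow> real" and a assume "(\<forall>n. X n \<in> UNIV) \<and> X \<longlonglongrightarrow> a"
      then have X: "X \<longlonglongrightarrow> a" by simp
      have "(\<lambda>n. LINT y|lborel. p y *\<^sub>R h (X n) y) \<longlonglongrightarrow> (LINT y|lborel. p y *\<^sub>R h a y)"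
      proof (rule integral_dominated_convergence[where w = "\<lambda>y. C * (1 / (1 + \<bar>y\<bar>)\<^sup>2)"])
        show "AE y in lborel. (\<lambda>n. p y *\<^sub>R h (X n) y) \<longlonglongrightarrow> p y *\<^sub>R h a y"
        proof (rule AE_I2)
          fix y
          have "isCont (\<lambda>t. h t y) a"
            using h_cont[of "\<lambda>t. t" "\<lambda>t. y"] by (simp add: continuous_on_eq_continuous_at continuous_on_id)
          then show "(\<lambda>n. p y *\<^sub>R h (X n) y) \<longlonglongrightarrow> p y *\<^sub>R h a y"
            by (intro tendsto_scaleR tendsto_const isCont_tendsto_compose[OF _ X])
        qed
        show "AE y in lborel. norm (p y *\<^sub>R h (X n) y) \<le> C * (1 / (1 + \<bar>y\<bar>)\<^sup>2)" for n
        proof (rule AE_I2)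
          fix y
          have "C / (1 + \<bar>X n\<bar>)\<^sup>2 \<le> C / 1" using C(1) by (intro divide_left_mono) (auto intro!: one_le_power)
          then have "C / (1 + \<bar>X n\<bar>)\<^sup>2 * (1 / (1 + \<bar>y\<bar>)\<^sup>2) \<le> C * (1 / (1 + \<bar>y\<bar>)\<^sup>2)"
            by (intro mult_right_mono) auto
          then show "norm (p y *\<^sub>R h (X n) y) \<le> C * (1 / (1 + \<bar>y\<bar>)\<^sup>2)"
            using norm_ph[OF p, of y "X n"] by linarith
        qed
        show "integrable lborel (\<lambda>y. C * (1 / (1 + \<bar>y\<bar>)\<^sup>2))"
          by (intro integrable_mult_right integrable_inverse_square)
      qed (use int_h[OF p] in auto)
      then show "((\<lambda>t. LINT y|lborel. p y *\<^sub>R h t y) \<circ> X) \<longlonglongrightarrow> (LINT y|lborel. p y *\<^sub>R h a y)"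
        by (simp add: o_def)
    qed
  qed
  have H_int: "integrable lborel (\<lambda>t. q t *\<^sub>R (LINT y|lborel. p y *\<^sub>R h t y))"
    if p: "continuous_on UNIV p" "\<And>y. \<bar>p y\<bar> \<le> 1" and q: "continuous_on UNIV q" "\<And>y. \<bar>q y\<bar> \<le> 1" for p q :: "real \<Rightarrow> real"
  proof (rule integrable_continuous_bounded[where C = "C * I"])
    show "continuous_on UNIV (\<lambda>t. q t *\<^sub>R (LINT y|lborel. p y *\<^sub>R h t y))"
      by (intro continuous_intros q(1) H_cont p)
    show "norm (q t *\<^sub>R (LINT y|lborel. p y *\<^sub>R h t y)) \<le> C * I / (1 + \<bar>t\<bar>)\<^sup>2" for t
      using mult_mono[OF q(2)[of t] H_bound[OF p, of t]] by simp
  qed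
  have H_zero: "(LINT y|lborel. cos (\<omega> * y) *\<^sub>R h t y) = 0 \<and> (LINT y|lborel. sin (\<omega> * y) *\<^sub>R h t y) = 0"
    if \<omega>: "\<omega> \<noteq> 0" for \<omega> t
  proof -
    have cs: "continuous_on UNIV (\<lambda>y. cos (\<tau> * y))" "continuous_on UNIV (\<lambda>y. sin (\<tau> * y))" for \<tau> :: real
      by (intro continuous_intros)+
    define Hc where "Hc t = (LINT y|lborel. cos (\<omega> * y) *\<^sub>R h t y)" for t
    define Hs where "Hs t = (LINT y|lborel. sin (\<omega> * y) *\<^sub>R h t y)" for t
    have int: "integrable lborel (\<lambda>t. cos (\<tau> * t) *\<^sub>R Hc t)" "integrable lborel (\<lambda>t. sin (\<tau> * t) *\<^sub>R Hc t)"
      "integrable lborel (\<lambda>t. cos (\<tau> * t) *\<^sub>R Hs t)" "integrable lborel (\<lambda>t. sin (\<tau> * t) *\<^sub>R Hs t)" for \<tau>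
      unfolding Hc_def Hs_def by (intro H_int cs; simp)+
    have c: "(LINT t|lborel. cos (\<tau> * t) *\<^sub>R Hc t) + (LINT t|lborel. sin (\<tau> * t) *\<^sub>R Hs t) = 0" for \<tau>
    proof -
      have "(LINT t|lborel. LINT y|lborel. cos (\<omega> * (y - \<tau> / \<omega> * t)) *\<^sub>R h t y) = 0"
        unfolding h_def by (rule plane_wave_integral[OF \<phi> ind zero]) (auto intro!: continuous_intros)
      moreover have "(LINT y|lborel. cos (\<omega> * (y - \<tau> / \<omega> * t)) *\<^sub>R h t y) = cos (\<tau> * t) *\<^sub>R Hc t + sin (\<tau> * t) *\<^sub>R Hs t" for t
      proof -
        have "cos (\<omega> * (y - \<tau> / \<omega> * t)) *\<^sub>R h t y = cos (\<tau> * t) *\<^sub>R (cos (\<omega> * y) *\<^sub>R h t y) + sin (\<tau> * t) *\<^sub>R (sin (\<omega> * y) *\<^sub>R h t y)" for y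
          using \<omega> by (simp add: right_diff_distrib cos_diff scaleR_add_left mult.commute)
        then show ?thesis
          unfolding Hc_def Hs_def
          by (simp only:) (subst Bochner_Integration.integral_add,
            auto simp del: scaleR_scaleR intro!: integrable_scaleR_right int_h cs)
      qed
      ultimately have "(LINT t|lborel. cos (\<tau> * t) *\<^sub>R Hc t + sin (\<tau> * t) *\<^sub>R Hs t) = 0"
        by (simp only:)
      then show ?thesis
        by (subst (asm) Bochner_Integration.integral_add) (auto intro: int)
    qed
    have s: "(LINT t|lborel. cos (\<tau> * t) *\<^sub>R Hs t) - (LINT t|lborel. sin (\<tau> * t) *\<^sub>R Hc t) = 0" for \<tau>
    proof -
      have "(LINT t|lborel. LINT y|lborel. sin (\<omega> * (y - \<tau> / \<omega> * t)) *\<^sub>R h t y) = 0"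
        unfolding h_def by (rule plane_wave_integral[OF \<phi> ind zero]) (auto intro!: continuous_intros)
      moreover have "(LINT y|lborel. sin (\<omega> * (y - \<tau> / \<omega> * t)) *\<^sub>R h t y) = cos (\<tau> * t) *\<^sub>R Hs t - sin (\<tau> * t) *\<^sub>R Hc t" for t
      proof -
        have "sin (\<omega> * (y - \<tau> / \<omega> * t)) *\<^sub>R h t y = cos (\<tau> * t) *\<^sub>R (sin (\<omega> * y) *\<^sub>R h t y) - sin (\<tau> * t) *\<^sub>R (cos (\<omega> * y) *\<^sub>R h t y)" for y
          using \<omega> by (simp add: right_diff_distrib sin_diff scaleR_diff_left mult.commute)
        then show ?thesis
          unfolding Hc_def Hs_def
          by (simp only:) (subst Bochner_Integration.integral_diff,
            auto simp del: scaleR_scaleR intro!: integrable_scaleR_right int_h cs)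
      qed
      ultimately have "(LINT t|lborel. cos (\<tau> * t) *\<^sub>R Hs t - sin (\<tau> * t) *\<^sub>R Hc t) = 0"
        by (simp only:)
      then show ?thesis
        by (subst (asm) Bochner_Integration.integral_diff) (auto intro: int)
    qed
    \<comment> \<open>replacing \<open>\<tau>\<close> by \<open>- \<tau>\<close> in the equations \<open>c\<close> and \<open>s\<close> separates the two integrals\<close>
    have both: "u = 0 \<and> v = 0" if "u + v = 0" "u - v = 0" for u v :: 'a
    proof -
      have "(u + v) + (u - v) = 0" using that by simp
      then have "2 *\<^sub>R u = 0" by (simp add: scaleR_2)
      then show ?thesis using that by simp
    qed
    have Hc0: "(LINT t|lborel. cos (\<tau> * t) *\<^sub>R Hc t) = 0 \<and> (LINT t|lborel. sin (\<tau> * t) *\<^sub>R Hs t) = 0" for \<tau>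
      using both[OF c[of \<tau>]] c[of "- \<tau>"] by simp
    have Hs0: "(LINT t|lborel. cos (\<tau> * t) *\<^sub>R Hs t) = 0 \<and> (LINT t|lborel. sin (\<tau> * t) *\<^sub>R Hc t) = 0" for \<tau>
      using both[of "LINT t|lborel. cos (\<tau> * t) *\<^sub>R Hs t" "LINT t|lborel. sin (\<tau> * t) *\<^sub>R Hc t"] s[of \<tau>] s[of "- \<tau>"] by simp
    have "Hc t = 0"
      by (rule fourier_uniqueness[where C = "C * I"])
        (use Hc0 Hs0 in \<open>auto simp: Hc_def intro!: H_cont H_bound cs\<close>)
    moreover have "Hs t = 0"
      by (rule fourier_uniqueness[where C = "C * I"])
        (use Hc0 Hs0 in \<open>auto simp: Hs_def intro!: H_cont H_bound cs\<close>)
    ultimately show ?thesis by (simp add: Hc_def Hs_def)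
  qed
  have "h 0 0 = 0"
  proof (rule fourier_uniqueness[where g = "h 0" and a = 0 and C = C])
    show "continuous_on UNIV (h 0)" using h_cont[of "\<lambda>t. 0" "\<lambda>t. t"] by (simp add: continuous_on_id)
  qed (use H_zero C(2)[of 0] in auto)
  then show ?thesis by (simp add: h_def)
qed

section \<open>Fields with vanishing moments\<close>

text \<open>
  The falling factorial \<open>q (q - 1) \<dots> (q - j + 1)\<close>.
\<close>

definition falling :: "nat \<Rightarrow> nat \<Rightarrow> real" where
  "falling q j = (\<Prod>i<j. real q - real i)"

lemma falling_simps [simp]: "falling q 0 = 1" "falling q (Suc j) = falling q j * (real q - real j)"
  by (simp_all add: falling_def)

lemma falling_eq_0: "q < j \<Longrightarrow> falling q j = 0"
  by (auto simp: falling_def)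

lemma falling_nonzero: "j \<le> q \<Longrightarrow> falling q j \<noteq> 0"
  by (auto simp: falling_def)

lemma directional_derivative_const [simp]: "directional_derivative \<eta> (\<lambda>x. c) = (\<lambda>x. 0)"
  by (rule ext) (rule has_derivative_directional_derivative[OF has_derivative_const])

lemma has_vector_derivative_eq_0:
  assumes "\<And>s. g s = 0" "(g has_vector_derivative v) (at s)"
  shows "v = 0"
proof -
  have "g = (\<lambda>s. 0)" using assms(1) by auto
  then show ?thesis using assms(2) vector_derivative_unique_at[OF _ has_vector_derivative_const] by metis
qed

text \<open>
  Let \<open>\<phi>\<^sub>j\<close> be the coefficients of the form with respect to \<open>s\<close> and let \<open>M\<^sub>q\<^sub>,\<^sub>j(s, x)\<close> be the moment of
  order \<open>q\<close> of \<open>\<phi>\<^sub>j\<close> along \<open>\<xi> + s \<eta>\<close>, so that \<open>\<Sum>\<^sub>j s\<^sup>j M\<^sub>q\<^sub>,\<^sub>j(s, x) = 0\<close> for \<open>q \<le> m\<close>.  In the derivative of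
  this equation in \<open>s\<close>, the terms in which the moments are differentiated add up to the derivative
  along \<open>\<eta>\<close> of the equation for \<open>q + 1\<close>, hence to zero.  So the powers of \<open>s\<close> may be differentiated as
  if the moments were constant, at the price of one order each time.  Order \<open>0\<close> survives \<open>m\<close>
  differentiations, which is enough to isolate every \<open>M\<^sub>0\<^sub>,\<^sub>j\<close>.
\<close>

theorem vanishing_moments_imp_zero:
  fixes G :: "'n::finite list \<Rightarrow> real ^ 'n \<Rightarrow> 'a::euclidean_space"
  assumes G: "\<And>is. schwartz (G is)" and ind: "independent_pair \<xi> \<eta>"
    and zero: "\<And>q s x. q \<le> m \<Longrightarrow>
      moment UNIV q (\<lambda>y. contraction m (\<lambda>is. G is y) (\<xi> + s *\<^sub>R \<eta>)) (\<xi> + s *\<^sub>R \<eta>) x = 0"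
  shows "contraction m (\<lambda>is. G is x) \<xi> = 0"
proof -
  obtain c where c: "\<And>(T :: 'n list \<Rightarrow> 'a) s. contraction m T (\<xi> + s *\<^sub>R \<eta>) =
      (\<Sum>j\<le>m. s ^ j *\<^sub>R (\<Sum>is | length is = m. c is j *\<^sub>R T is))"
    using contraction_line_coeffs[of m \<xi> \<eta>, where 'a = 'a] by blast
  define \<phi> where "\<phi> j x = (\<Sum>is | length is = m. c is j *\<^sub>R G is x)" for j x
  have \<phi>: "schwartz (\<phi> j)" for j
    unfolding \<phi>_def[abs_def] by (intro schwartz_linear_combination G) simp
  have nz: "\<xi> + s *\<^sub>R \<eta> \<noteq> 0" for s by (rule independent_pair_nonzero[OF ind])
  define M where "M q j s x = moment UNIV q (\<phi> j) (\<xi> + s *\<^sub>R \<eta>) x" for q j s x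
  have step: "(\<Sum>j\<le>m. (falling j r * s ^ (j - r)) *\<^sub>R M q j s x) = 0" if "q + r \<le> m" for q r s x
    using that
  proof (induction r arbitrary: q s x)
    case 0
    have "moment UNIV q (\<lambda>y. contraction m (\<lambda>is. G is y) (\<xi> + s *\<^sub>R \<eta>)) (\<xi> + s *\<^sub>R \<eta>) x =
        (\<Sum>j\<le>m. s ^ j *\<^sub>R M q j s x)"
      unfolding c \<phi>_def[symmetric] M_def by (intro moment_linear_combination \<phi> nz) auto
    then show ?case using zero[of q s x] 0 by simp
  next
    case (Suc r)
    have deriv: "((\<lambda>s. \<Sum>j\<le>m. (falling j r * s ^ (j - r)) *\<^sub>R M q j s x) has_vector_derivative
        (\<Sum>j\<le>m. (falling j r * s ^ (j - r)) *\<^sub>R moment UNIV (Suc q) (directional_derivative \<eta> (\<phi> j)) (\<xi> + s *\<^sub>R \<eta>) x +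
           (falling j (Suc r) * s ^ (j - Suc r)) *\<^sub>R M q j s x)) (at s)"
    proof (intro has_vector_derivative_sum has_vector_derivative_scaleR)
      fix j
      have "((\<lambda>s. falling j r * s ^ (j - r)) has_real_derivative falling j r * (real (j - r) * s ^ (j - r - 1))) (at s)"
        using DERIV_cmult[OF DERIV_pow[of "j - r" s]] by simp
      also have "falling j r * (real (j - r) * s ^ (j - r - 1)) = falling j (Suc r) * s ^ (j - Suc r)"
        by (cases "r \<le> j") (auto simp: of_nat_diff falling_eq_0)
      finally show "((\<lambda>s. falling j r * s ^ (j - r)) has_real_derivative falling j (Suc r) * s ^ (j - Suc r)) (at s)" .
      show "((\<lambda>s. M q j s x) has_vector_derivative moment UNIV (Suc q) (directional_derivative \<eta> (\<phi> j)) (\<xi> + s *\<^sub>R \<eta>) x) (at s)"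
        unfolding M_def by (intro moment_has_vector_derivative_direction \<phi> nz) simp
    qed
    \<comment> \<open>the induction hypothesis for \<open>q + 1\<close> holds at all points, so it may be differentiated along \<open>\<eta>\<close>\<close>
    have "(\<lambda>y. \<Sum>j\<le>m. (falling j r * s ^ (j - r)) *\<^sub>R moment UNIV (Suc q) (\<phi> j) (\<xi> + s *\<^sub>R \<eta>) y) = (\<lambda>y. 0)"
      using Suc.IH[of "Suc q" s] Suc.prems by (auto simp: M_def)
    then have "directional_derivative \<eta> (\<lambda>y. \<Sum>j\<le>m. (falling j r * s ^ (j - r)) *\<^sub>R moment UNIV (Suc q) (\<phi> j) (\<xi> + s *\<^sub>R \<eta>) y) x = 0"
      by simp
    then have "(\<Sum>j\<le>m. (falling j r * s ^ (j - r)) *\<^sub>R moment UNIV (Suc q) (directional_derivative \<eta> (\<phi> j)) (\<xi> + s *\<^sub>R \<eta>) x) = 0"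
      by (subst (asm) directional_derivative_linear_combination)
        (auto intro!: smooth_moment \<phi> nz simp: directional_derivative_moment[OF \<phi> nz])
    moreover have "(\<Sum>j\<le>m. (falling j r * s ^ (j - r)) *\<^sub>R moment UNIV (Suc q) (directional_derivative \<eta> (\<phi> j)) (\<xi> + s *\<^sub>R \<eta>) x +
           (falling j (Suc r) * s ^ (j - Suc r)) *\<^sub>R M q j s x) = 0"
      by (rule has_vector_derivative_eq_0[OF _ deriv]) (rule Suc.IH, use Suc.prems in simp)
    ultimately show ?case by (simp add: sum.distrib)
  qed
  have M0: "M 0 j s x = 0" if "j \<le> m" for j s x
    using that
  proof (induction "m - j" arbitrary: j rule: less_induct)
    case less
    have "(falling i j * s ^ (i - j)) *\<^sub>R M 0 i s x = (if i = j then falling j j *\<^sub>R M 0 j s x else 0)" if "i \<le> m" for i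
      using less.hyps[of i] that less.prems by (cases i j rule: linorder_cases) (auto simp: falling_eq_0)
    then have "(\<Sum>i\<le>m. (falling i j * s ^ (i - j)) *\<^sub>R M 0 i s x) = (\<Sum>i\<le>m. if i = j then falling j j *\<^sub>R M 0 j s x else 0)"
      by (intro sum.cong) auto
    then show ?case using step[of 0 j s x] less.prems falling_nonzero[of j j] by simp
  qed
  have "\<phi> j x = 0" if "j \<le> m" for j
    by (rule xray_transform_injective[OF \<phi> ind]) (use M0[OF that] in \<open>simp add: M_def\<close>)
  then show ?thesis using c[of "\<lambda>is. G is x" 0] by (simp add: \<phi>_def)
qed

section \<open>Contractions of the Saint Venant operator\<close>

lemma symmetric_tensor_field_imp_symmetric_on:
  fixes f :: "('n::finite, 'a::zero) tensor_field"
  assumes "symmetric_tensor_field m f"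
  shows "symmetric_on m f"
  unfolding symmetric_on_def
proof (intro allI impI)
  fix "is" js :: "'n list" assume len: "length is = m" and "mset is = mset js"
  then obtain \<pi> where \<pi>: "\<pi> permutes {..<length is}" "permute_list \<pi> is = js"
    by (metis mset_eq_permutation)
  then show "f is = f js" using assms len unfolding symmetric_tensor_field_def by metis
qed

definition mixed_contraction ::
    "('n::finite list \<Rightarrow> real ^ 'n \<Rightarrow> 'a::real_vector) \<Rightarrow> nat \<Rightarrow> nat \<Rightarrow> real ^ 'n \<Rightarrow> real ^ 'n \<Rightarrow> real ^ 'n \<Rightarrow> 'a" where
  "mixed_contraction f b c \<eta> \<xi> x = contraction b (\<lambda>p. contraction c (\<lambda>q. f (p @ q) x) \<xi>) \<eta>"

text \<open>
  The component indices \<open>q\<^sub>1\<dots>q\<^bsub>m-k\<^esub> i\<^sub>1\<dots>i\<^sub>k\<close> of \<open>W\<^sup>k f\<close>, in which it is symmetric, are joined into the single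
  list \<open>r\<close>.
\<close>

definition saint_venant_form ::
    "nat \<Rightarrow> nat \<Rightarrow> ('n::finite, 'a::real_normed_vector) tensor_field \<Rightarrow> real ^ 'n \<Rightarrow> real ^ 'n \<Rightarrow> real ^ 'n \<Rightarrow> 'a" where
  "saint_venant_form m k f \<eta> \<xi> x =
     contraction m (\<lambda>r. contraction (m - k) (\<lambda>ps. saint_venant m k f ps (take (m - k) r) (drop (m - k) r) x) \<eta>) \<xi>"

lemma smooth_mixed_contraction:
  assumes "\<And>is. smooth (f is)"
  shows "smooth (mixed_contraction f b c \<eta> \<xi>)"
  unfolding mixed_contraction_def[abs_def] by (intro smooth_contraction assms)

lemma schwartz_mixed_contraction:
  assumes "\<And>is. schwartz (f is)"
  shows "schwartz (mixed_contraction f b c \<eta> \<xi>)"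
  unfolding mixed_contraction_def[abs_def] by (intro schwartz_contraction assms)

lemma partial_derivatives_mixed_contraction:
  assumes "\<And>is. smooth (f is)"
  shows "partial_derivatives js (mixed_contraction f b c \<eta> \<xi>) = mixed_contraction (\<lambda>is. partial_derivatives js (f is)) b c \<eta> \<xi>"
  unfolding mixed_contraction_def[abs_def]
  by (subst partial_derivatives_contraction, intro smooth_contraction assms)
    (subst partial_derivatives_contraction, intro assms, simp)

text \<open>
  The symmetrizations disappear in the contraction.  What remains is to sort the index lists by the
  place where they occur: as indices of \<open>f\<close> or as directions of differentiation.
\<close>

lemma saint_venant_form_eq:
  fixes f :: "('n::finite, 'a::real_normed_vector) tensor_field"
  assumes k: "k \<le> m" and smooth: "\<And>is. smooth (f is)" and sym: "symmetric_on m f"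
  shows "saint_venant_form m k f \<eta> \<xi> x =
    (\<Sum>l=0..m - k. ((- 1) ^ l * real ((m - k) choose l)) *\<^sub>R
       (directional_derivative \<eta> ^^ l) ((directional_derivative \<xi> ^^ (m - k - l))
         (mixed_contraction f (m - k - l) (k + l) \<eta> \<xi>)) x)"
proof -
  define N where "N = m - k"
  have m: "m = N + k" using k by (simp add: N_def)
  define S where "S p r = saint_venant_summand m k f p (take N r) (drop N r) x" for p r
  have "saint_venant_form m k f \<eta> \<xi> x =
      contraction m (\<lambda>r. contraction N (symmetrization (\<lambda>p. symmetrization (S p) r)) \<eta>) \<xi>"
    unfolding saint_venant_form_def N_def[symmetric]
    by (intro contraction_cong refl) (simp add: saint_venant_def S_def[abs_def] N_def)
  also have "\<dots> = contraction N (\<lambda>p. contraction m (S p) \<xi>) \<eta>"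
    by (simp only: contraction_symmetrization contraction_swap[of m] )
  also have "\<dots> = contraction N (\<lambda>p. contraction N (\<lambda>q. contraction k (\<lambda>i. saint_venant_summand m k f p q i x) \<xi>) \<xi>) \<eta>"
    unfolding m contraction_add by (intro contraction_cong refl) (simp add: S_def m)
  also have "\<dots> = (\<Sum>l=0..N. ((- 1) ^ l * real (N choose l)) *\<^sub>R
      contraction N (\<lambda>p. contraction N (\<lambda>q. contraction k (\<lambda>i.
        partial_derivatives (drop (N - l) p @ drop l q) (f (i @ take (N - l) p @ take l q)) x) \<xi>) \<xi>) \<eta>)"
    unfolding saint_venant_summand_def N_def[symmetric] fix_indices_def
    by (simp only: contraction_sum contraction_scaleR_fun)
  also have "\<dots> = (\<Sum>l=0..N. ((- 1) ^ l * real (N choose l)) *\<^sub>R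
       (directional_derivative \<eta> ^^ l) ((directional_derivative \<xi> ^^ (N - l))
         (mixed_contraction f (N - l) (k + l) \<eta> \<xi>)) x)"
  proof (intro sum.cong refl arg_cong2[of _ _ _ _ scaleR])
    fix l assume "l \<in> {0..N}"
    then have l: "l \<le> N" by simp
    define E where "E p1 p2 q1 q2 i = partial_derivatives (p2 @ q2) (f (i @ p1 @ q1)) x" for p1 p2 q1 q2 i
    have "contraction N (\<lambda>p. contraction N (\<lambda>q. contraction k (\<lambda>i.
        partial_derivatives (drop (N - l) p @ drop l q) (f (i @ take (N - l) p @ take l q)) x) \<xi>) \<xi>) \<eta> =
      contraction (N - l + l) (\<lambda>p. contraction (l + (N - l)) (\<lambda>q. contraction k (\<lambda>i.
        E (take (N - l) p) (drop (N - l) p) (take l q) (drop l q) i) \<xi>) \<xi>) \<eta>"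
      using l by (simp add: E_def)
    also have "\<dots> = contraction (N - l) (\<lambda>p1. contraction l (\<lambda>p2. contraction l (\<lambda>q1. contraction (N - l) (\<lambda>q2.
        contraction k (\<lambda>i. E p1 p2 q1 q2 i) \<xi>) \<xi>) \<xi>) \<eta>) \<eta>"
      unfolding contraction_add by (intro contraction_cong refl) simp
    also have "\<dots> = contraction (N - l) (\<lambda>p1. contraction l (\<lambda>p2. contraction (N - l) (\<lambda>q2. contraction k (\<lambda>i.
        contraction l (\<lambda>q1. E p1 p2 q1 q2 i) \<xi>) \<xi>) \<xi>) \<eta>) \<eta>"
      by (simp only: contraction_swap[of l _ "\<lambda>q1 q2. contraction k (\<lambda>i. E _ _ q1 q2 i) \<xi>"]
          contraction_swap[of l _ "\<lambda>q1 i. E _ _ q1 _ i"])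
    also have "\<dots> = contraction l (\<lambda>p2. contraction (N - l) (\<lambda>q2. contraction (N - l) (\<lambda>p1. contraction k (\<lambda>i.
        contraction l (\<lambda>q1. E p1 p2 q1 q2 i) \<xi>) \<xi>) \<eta>) \<xi>) \<eta>"
      by (rule trans[OF contraction_swap], rule contraction_cong[OF refl _ refl], rule contraction_swap)
    also have "\<dots> = contraction l (\<lambda>p2. contraction (N - l) (\<lambda>q2.
        mixed_contraction (\<lambda>is. partial_derivatives (p2 @ q2) (f is)) (N - l) (k + l) \<eta> \<xi> x) \<xi>) \<eta>"
      unfolding mixed_contraction_def contraction_add E_def
    proof (intro contraction_cong refl)
      fix p2 q2 p1 i q1 :: "'n list"
      assume "length p1 = N - l" "length i = k" "length q1 = l"
      then have "f (i @ p1 @ q1) = f (p1 @ i @ q1)"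
        using l by (intro symmetric_onD[OF sym]) (auto simp: m)
      then show "partial_derivatives (p2 @ q2) (f (i @ p1 @ q1)) x = partial_derivatives (p2 @ q2) (f (p1 @ i @ q1)) x"
        by simp
    qed
    also have "\<dots> = (directional_derivative \<eta> ^^ l) ((directional_derivative \<xi> ^^ (N - l))
         (mixed_contraction f (N - l) (k + l) \<eta> \<xi>)) x"
    proof -
      let ?h = "mixed_contraction f (N - l) (k + l) \<eta> \<xi>"
      have h: "smooth ?h" by (intro smooth_mixed_contraction smooth)
      have "(directional_derivative \<eta> ^^ l) ((directional_derivative \<xi> ^^ (N - l)) ?h) x =
          contraction l (\<lambda>p2. partial_derivatives p2 ((directional_derivative \<xi> ^^ (N - l)) ?h) x) \<eta>"
        by (subst directional_derivatives_eq_contraction) (intro smooth_directional_derivatives h, simp)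
      also have "\<dots> = contraction l (\<lambda>p2. contraction (N - l) (\<lambda>q2. partial_derivatives p2 (partial_derivatives q2 ?h) x) \<xi>) \<eta>"
        by (subst directional_derivatives_eq_contraction[OF h], subst partial_derivatives_contraction)
          (intro smooth_partial_derivatives h, simp)
      also have "\<dots> = contraction l (\<lambda>p2. contraction (N - l) (\<lambda>q2. partial_derivatives (p2 @ q2) ?h x) \<xi>) \<eta>"
        by simp
      also have "\<dots> = contraction l (\<lambda>p2. contraction (N - l) (\<lambda>q2.
          mixed_contraction (\<lambda>is. partial_derivatives (p2 @ q2) (f is)) (N - l) (k + l) \<eta> \<xi> x) \<xi>) \<eta>"
        by (simp only: partial_derivatives_mixed_contraction[OF smooth])
      finally show ?thesis by simp
    qed
    finally show "contraction N (\<lambda>p. contraction N (\<lambda>q. contraction k (\<lambda>i.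
        partial_derivatives (drop (N - l) p @ drop l q) (f (i @ take (N - l) p @ take l q)) x) \<xi>) \<xi>) \<eta> =
      (directional_derivative \<eta> ^^ l) ((directional_derivative \<xi> ^^ (N - l))
         (mixed_contraction f (N - l) (k + l) \<eta> \<xi>)) x" .
  qed
  finally show ?thesis by (simp only: N_def)
qed

text \<open>
  Polarization in the index list \<open>qs @ is\<close> and then in \<open>ps\<close>.
\<close>

lemma saint_venant_eq_zero:
  fixes f :: "('n::finite, 'a::real_normed_vector) tensor_field"
  assumes k: "k \<le> m" and zero: "\<And>\<eta> \<xi>. saint_venant_form m k f \<eta> \<xi> x = 0"
    and len: "length ps = m - k" "length qs = m - k" "length is = k"
  shows "saint_venant m k f ps qs is x = 0"
proof -
  define W where "W ps r = saint_venant m k f ps (take (m - k) r) (drop (m - k) r) x" for ps r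
  define S where "S p r = saint_venant_summand m k f p (take (m - k) r) (drop (m - k) r) x" for p r
  have W: "W ps r = symmetrization (\<lambda>p. symmetrization (S p) r) ps" for ps r
    by (simp add: W_def saint_venant_def S_def[abs_def])
  have sym_r: "W ps r = W ps r'" if "mset r = mset r'" for ps r r'
  proof -
    have "symmetrization (S p) r = symmetrization (S p) r'" for p
      by (rule symmetric_onD[OF symmetric_on_symmetrization refl that])
    then show ?thesis by (simp only: W)
  qed
  have "contraction (m - k) (\<lambda>ps. W ps r) \<eta> = 0" if "length r = m" for r \<eta>
  proof (rule contraction_eq_zero[where T = "\<lambda>r. contraction (m - k) (\<lambda>ps. W ps r) \<eta>" and r = m])
    show "symmetric_on m (\<lambda>r. contraction (m - k) (\<lambda>ps. W ps r) \<eta>)"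
      unfolding symmetric_on_def by (intro allI impI contraction_cong refl sym_r)
    show "contraction m (\<lambda>r. contraction (m - k) (\<lambda>ps. W ps r) \<eta>) \<xi> = 0" for \<xi>
      using zero[of \<eta> \<xi>] by (simp add: saint_venant_form_def W_def)
  qed fact
  then have "W ps r = 0" if "length r = m" for r
  proof (intro contraction_eq_zero[where T = "\<lambda>ps. W ps r" and r = "m - k"])
    show "symmetric_on (m - k) (\<lambda>ps. W ps r)"
      unfolding W by (rule symmetric_on_symmetrization)
  qed (use that len in auto)
  from this[of "qs @ is"] show ?thesis using len k by (simp add: W_def)
qed

lemma schwartz_symmetrization:
  assumes "\<And>js. schwartz (\<lambda>x. F js x)"
  shows "schwartz (\<lambda>x. symmetrization (\<lambda>js. F js x) is)"
  unfolding symmetrization_def scaleR_sum_right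
  by (intro schwartz_linear_combination assms finite_permutations) simp

lemma schwartz_saint_venant:
  assumes "\<And>is. schwartz (f is)"
  shows "schwartz (saint_venant m k f ps qs is)"
  unfolding saint_venant_def[abs_def] saint_venant_summand_def[abs_def] fix_indices_def
  by (intro schwartz_symmetrization schwartz_linear_combination schwartz_partial_derivatives assms) simp

lemma schwartz_saint_venant_form:
  assumes "\<And>is. schwartz (f is)"
  shows "schwartz (saint_venant_form m k f \<eta> \<xi>)"
  unfolding saint_venant_form_def[abs_def]
  by (intro schwartz_contraction schwartz_saint_venant[OF assms])

section \<open>Moments of the Saint Venant form\<close>

lemmas has_vector_derivative_scale_const =
  bounded_linear.has_vector_derivative[OF bounded_linear_scaleR_right]

text \<open>
  The Leibniz rule for \<open>M\<close> applications of a derivation that is a sum of two commuting shifts.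
\<close>

lemma binomial_has_vector_derivative:
  fixes \<Phi> :: "nat \<Rightarrow> nat \<Rightarrow> real \<Rightarrow> 'a::real_normed_vector"
  assumes "\<And>a b. (\<Phi> a b has_vector_derivative \<Phi> (Suc a) b s + \<Phi> a (Suc b) s) (at s)"
  shows "((\<lambda>s. \<Sum>j\<le>M. real (M choose j) *\<^sub>R \<Phi> (M - j) j s) has_vector_derivative
    (\<Sum>j\<le>Suc M. real (Suc M choose j) *\<^sub>R \<Phi> (Suc M - j) j s)) (at s)"
proof -
  define B where "B j = \<Phi> (Suc M - j) j s" for j
  have "((\<lambda>s. \<Sum>j\<le>M. real (M choose j) *\<^sub>R \<Phi> (M - j) j s) has_vector_derivative
      (\<Sum>j\<le>M. real (M choose j) *\<^sub>R (\<Phi> (Suc (M - j)) j s + \<Phi> (M - j) (Suc j) s))) (at s)"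
    by (intro has_vector_derivative_sum has_vector_derivative_scale_const assms)
  moreover have "(\<Sum>j\<le>M. real (M choose j) *\<^sub>R (\<Phi> (Suc (M - j)) j s + \<Phi> (M - j) (Suc j) s)) =
      (\<Sum>j\<le>M. real (M choose j) *\<^sub>R B j) + (\<Sum>j\<le>M. real (M choose j) *\<^sub>R B (Suc j))"
    unfolding sum.distrib[symmetric] B_def
    by (intro sum.cong) (auto simp: scaleR_add_right Suc_diff_le)
  moreover have "(\<Sum>j\<le>Suc M. real (Suc M choose j) *\<^sub>R B j) =
      (\<Sum>j\<le>M. real (M choose j) *\<^sub>R B j) + (\<Sum>j\<le>M. real (M choose j) *\<^sub>R B (Suc j))"
  proof -
    have "(\<Sum>j\<le>Suc M. real (Suc M choose j) *\<^sub>R B j) =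
        (\<Sum>j\<le>M. real (M choose j) *\<^sub>R B (Suc j)) + (B 0 + (\<Sum>j\<le>M. real (M choose Suc j) *\<^sub>R B (Suc j)))"
      by (subst sum.atMost_Suc_shift) (simp add: scaleR_add_left sum.distrib)
    also have "B 0 + (\<Sum>j\<le>M. real (M choose Suc j) *\<^sub>R B (Suc j)) = (\<Sum>j\<le>Suc M. real (M choose j) *\<^sub>R B j)"
      by (subst sum.atMost_Suc_shift) simp
    also have "\<dots> = (\<Sum>j\<le>M. real (M choose j) *\<^sub>R B j)" by simp
    finally show ?thesis by (simp add: add.commute)
  qed
  ultimately show ?thesis by (simp add: B_def)
qed

lemma directional_derivatives_mixed_contraction:
  assumes "\<And>is. smooth (f is)"
  shows "(directional_derivative \<eta> ^^ a) (mixed_contraction f b c \<eta> \<zeta>) =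
    (\<lambda>x. contraction c (\<lambda>q. contraction b (\<lambda>p. (directional_derivative \<eta> ^^ a) (f (p @ q)) x) \<eta>) \<zeta>)"
proof -
  have "mixed_contraction f b c \<eta> \<zeta> = (\<lambda>x. contraction c (\<lambda>q. contraction b (\<lambda>p. f (p @ q) x) \<eta>) \<zeta>)"
    unfolding mixed_contraction_def[abs_def] by (intro ext contraction_swap)
  then show ?thesis
    by (simp add: directional_derivatives_contraction assms smooth_contraction)
qed

text \<open>
  The direction \<open>\<xi> + s \<eta>\<close> occurs as the direction of the ray, where its derivative gives \<open>t D\<^sub>\<eta>\<close>, and as
  argument of \<open>f\<close> in \<open>m - b\<close> places, in each of which its derivative replaces it by \<open>\<eta>\<close>.
\<close>

lemma moment_mixed_contraction_has_vector_derivative: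
  fixes f :: "('n::finite, 'a::euclidean_space) tensor_field" and x :: "real ^ 'n"
  assumes f: "\<And>is. schwartz (f is)" and sym: "symmetric_on m f" and b: "b \<le> m"
    and nz: "\<xi> + s *\<^sub>R \<eta> \<noteq> 0" and T: "T \<in> sets borel"
  defines "\<Phi> \<equiv> \<lambda>q a b s. moment T q ((directional_derivative \<eta> ^^ a) (mixed_contraction f b (m - b) \<eta> (\<xi> + s *\<^sub>R \<eta>))) (\<xi> + s *\<^sub>R \<eta>) x"
  shows "(\<Phi> q a b has_vector_derivative \<Phi> (Suc q) (Suc a) b s + real (m - b) *\<^sub>R \<Phi> q a (Suc b) s) (at s)"
proof -
  let ?z = "\<xi> + s *\<^sub>R \<eta>"
  define \<psi> where "\<psi> a b q x = contraction b (\<lambda>p. (directional_derivative \<eta> ^^ a) (f (p @ q)) x) \<eta>" for a b q x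
  have \<psi>: "schwartz (\<psi> a b q)" for a b q
    unfolding \<psi>_def[abs_def] by (intro schwartz_contraction schwartz_directional_derivatives f)
  have mixed: "(directional_derivative \<eta> ^^ a) (mixed_contraction f b c \<eta> \<zeta>) = (\<lambda>x. contraction c (\<lambda>q. \<psi> a b q x) \<zeta>)" for a b c \<zeta>
    unfolding \<psi>_def by (rule directional_derivatives_mixed_contraction[OF schwartz_smooth[OF f]])
  have step: "\<psi> (Suc a) b q = directional_derivative \<eta> (\<psi> a b q)" for a b q
    unfolding \<psi>_def[abs_def]
    using directional_derivatives_contraction[where l = 1 and \<eta> = \<eta> and r = b and \<xi> = \<eta>
        and T = "\<lambda>p. (directional_derivative \<eta> ^^ a) (f (p @ q))"]
    by (simp add: smooth_directional_derivatives schwartz_smooth f)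
  have M: "moment T q (\<lambda>x. contraction c (\<lambda>q. \<psi> a b q x) \<zeta>) \<zeta> x = contraction c (\<lambda>r. moment T q (\<psi> a b r) \<zeta> x) \<zeta>"
    if "\<zeta> \<noteq> 0" for q a b c \<zeta>
    by (intro moment_contraction \<psi> that T)
  have sym_\<psi>: "\<psi> a b q = \<psi> a b q'" if "length q = m - b" "mset q = mset q'" for a q q'
  proof -
    have "f (p @ q) = f (p @ q')" if "length p = b" for p
      by (rule symmetric_onD[OF sym]) (use that \<open>length q = m - b\<close> \<open>mset q = mset q'\<close> b in auto)
    then show ?thesis unfolding \<psi>_def[abs_def] by (intro ext contraction_cong refl) simp
  qed
  have deriv: "((\<lambda>s. contraction (m - b) (\<lambda>r. moment T q (\<psi> a b r) (\<xi> + s *\<^sub>R \<eta>) x) (\<xi> + s *\<^sub>R \<eta>)) has_vector_derivative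
    contraction (m - b) (\<lambda>r. moment T (Suc q) (\<psi> (Suc a) b r) ?z x) ?z +
    real (m - b) *\<^sub>R contraction (m - b - 1) (\<lambda>r. \<Sum>i\<in>UNIV. \<eta> $ i *\<^sub>R moment T q (\<psi> a b (i # r)) ?z x) ?z) (at s)"
  proof (rule contraction_has_vector_derivative)
    show "((\<lambda>s. moment T q (\<psi> a b r) (\<xi> + s *\<^sub>R \<eta>) x) has_vector_derivative moment T (Suc q) (\<psi> (Suc a) b r) ?z x) (at s)" for r
      unfolding step by (intro moment_has_vector_derivative_direction \<psi> nz T)
    show "symmetric_on (m - b) (\<lambda>r. moment T q (\<psi> a b r) ?z x)"
      unfolding symmetric_on_def using sym_\<psi> by (intro allI impI) metis
  qed
  have "(\<Sum>i\<in>UNIV. \<eta> $ i *\<^sub>R moment T q (\<psi> a b (i # r)) ?z x) = moment T q (\<psi> a (Suc b) r) ?z x" for r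
  proof -
    have "\<psi> a (Suc b) r = (\<lambda>x. \<Sum>i\<in>UNIV. \<eta> $ i *\<^sub>R \<psi> a b (i # r) x)"
      unfolding \<psi>_def by (simp add: contraction_Suc_last contraction_sum contraction_scaleR_fun)
    then show ?thesis by (simp add: moment_linear_combination \<psi> nz T)
  qed
  moreover have "((\<lambda>s. contraction (m - b) (\<lambda>r. moment T q (\<psi> a b r) (\<xi> + s *\<^sub>R \<eta>) x) (\<xi> + s *\<^sub>R \<eta>)) has_vector_derivative v) (at s)
      \<longleftrightarrow> (\<Phi> q a b has_vector_derivative v) (at s)" for v
  proof (rule has_vector_derivative_cong_ev)
    have "open {s. \<xi> + s *\<^sub>R \<eta> \<noteq> 0}" by (intro open_Collect_neq continuous_intros)
    then have "\<forall>\<^sub>F s in nhds s. \<xi> + s *\<^sub>R \<eta> \<noteq> 0"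
      unfolding eventually_nhds using nz by (intro exI[of _ "{s. \<xi> + s *\<^sub>R \<eta> \<noteq> 0}"]) simp
    then show "\<forall>\<^sub>F s' in nhds s. s' \<in> UNIV \<longrightarrow>
        contraction (m - b) (\<lambda>r. moment T q (\<psi> a b r) (\<xi> + s' *\<^sub>R \<eta>) x) (\<xi> + s' *\<^sub>R \<eta>) = \<Phi> q a b s'"
      by eventually_elim (simp add: \<Phi>_def mixed M)
    then show "contraction (m - b) (\<lambda>r. moment T q (\<psi> a b r) (\<xi> + s *\<^sub>R \<eta>) x) (\<xi> + s *\<^sub>R \<eta>) = \<Phi> q a b s"
      using nz by (simp add: \<Phi>_def mixed M)
  qed
  ultimately show ?thesis using deriv nz by (simp add: \<Phi>_def mixed M)
qed

text \<open>
  An explicit formula for the derivative of order \<open>M\<close>, at \<open>s = 0\<close>, of the moment of order \<open>k\<close> of \<open>f\<close> in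
  the direction \<open>\<zeta> + s \<eta>\<close>.
\<close>

definition moment_derivative ::
    "real set \<Rightarrow> nat \<Rightarrow> nat \<Rightarrow> ('n::finite, 'a::euclidean_space) tensor_field \<Rightarrow> nat \<Rightarrow>
     real ^ 'n \<Rightarrow> real ^ 'n \<Rightarrow> real ^ 'n \<Rightarrow> 'a" where
  "moment_derivative T m k f M \<eta> \<zeta> x = (\<Sum>j\<le>M. (real (M choose j) * falling m j) *\<^sub>R
     moment T (k + (M - j)) ((directional_derivative \<eta> ^^ (M - j)) (mixed_contraction f j (m - j) \<eta> \<zeta>)) \<zeta> x)"

lemma moment_derivative_0: "moment_derivative T m k f 0 \<eta> \<zeta> x = moment T k (\<lambda>y. contraction m (\<lambda>is. f is y) \<zeta>) \<zeta> x"
  by (simp add: moment_derivative_def mixed_contraction_def[abs_def])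

lemma moment_derivative_has_vector_derivative:
  fixes f :: "('n::finite, 'a::euclidean_space) tensor_field"
  assumes f: "\<And>is. schwartz (f is)" and sym: "symmetric_on m f"
    and nz: "\<xi> + s *\<^sub>R \<eta> \<noteq> 0" and T: "T \<in> sets borel"
  shows "((\<lambda>s. moment_derivative T m k f M \<eta> (\<xi> + s *\<^sub>R \<eta>) x) has_vector_derivative
    moment_derivative T m k f (Suc M) \<eta> (\<xi> + s *\<^sub>R \<eta>) x) (at s)"
proof -
  define \<Phi> where "\<Phi> a b s = falling m b *\<^sub>R
    moment T (k + a) ((directional_derivative \<eta> ^^ a) (mixed_contraction f b (m - b) \<eta> (\<xi> + s *\<^sub>R \<eta>))) (\<xi> + s *\<^sub>R \<eta>) x" for a b s
  have "(\<Phi> a b has_vector_derivative \<Phi> (Suc a) b s + \<Phi> a (Suc b) s) (at s)" for a b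
  proof (cases "b \<le> m")
    case True
    from has_vector_derivative_scale_const[OF moment_mixed_contraction_has_vector_derivative[OF f sym True nz T, of "k + a" a x], of "falling m b"]
    show ?thesis using True by (simp add: \<Phi>_def[abs_def] scaleR_add_right of_nat_diff mult_ac)
  next
    case False
    then show ?thesis by (simp add: \<Phi>_def[abs_def] falling_eq_0 del: falling_simps)
  qed
  from binomial_has_vector_derivative[of \<Phi>, OF this, of M]
  show ?thesis by (simp add: moment_derivative_def \<Phi>_def del: sum.atMost_Suc falling_simps)
qed

lemma moment_directional_derivative:
  fixes \<phi> :: "real ^ 'n::finite \<Rightarrow> 'a::euclidean_space"
  assumes "schwartz \<phi>" "\<xi> \<noteq> 0" "T \<in> {UNIV, {0..}}" "0 < q"
  shows "moment T q (directional_derivative \<xi> \<phi>) \<xi> x = - (real q *\<^sub>R moment T (q - 1) \<phi> \<xi> x)"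
  using assms moment_UNIV_directional_derivative[of \<phi> \<xi> q x] moment_half_line_directional_derivative[of \<phi> \<xi> q x]
  by auto

lemma moment_directional_derivatives:
  fixes \<phi> :: "real ^ 'n::finite \<Rightarrow> 'a::euclidean_space"
  assumes "schwartz \<phi>" "\<xi> \<noteq> 0" "T \<in> {UNIV, {0..}}" "j \<le> q"
  shows "moment T q ((directional_derivative \<xi> ^^ j) \<phi>) \<xi> x = ((- 1) ^ j * falling q j) *\<^sub>R moment T (q - j) \<phi> \<xi> x"
  using assms(1,4)
proof (induction j arbitrary: \<phi>)
  case (Suc j)
  have "moment T q ((directional_derivative \<xi> ^^ Suc j) \<phi>) \<xi> x = moment T q ((directional_derivative \<xi> ^^ j) (directional_derivative \<xi> \<phi>)) \<xi> x"
    by (simp add: funpow_swap1)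
  also have "\<dots> = ((- 1) ^ j * falling q j) *\<^sub>R moment T (q - j) (directional_derivative \<xi> \<phi>) \<xi> x"
    using Suc by (intro Suc.IH schwartz_directional_derivative) auto
  also have "\<dots> = ((- 1) ^ j * falling q j) *\<^sub>R - (real (q - j) *\<^sub>R moment T (q - j - 1) \<phi> \<xi> x)"
    using Suc.prems by (subst moment_directional_derivative) (use assms in auto)
  also have "\<dots> = ((- 1) ^ Suc j * falling q (Suc j)) *\<^sub>R moment T (q - Suc j) \<phi> \<xi> x"
    using Suc.prems by (simp add: of_nat_diff mult_ac)
  finally show ?case .
qed simp

text \<open>
  In the moment of order \<open>m\<close> of the Saint Venant form at \<open>\<zeta>\<close>, integration by parts along the ray removes
  the derivatives \<open>D\<^sub>\<zeta>\<close>.  No boundary terms occur on the half-line, because a positive power of \<open>t\<close> is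
  left whenever a derivative is moved.
\<close>

lemma moment_saint_venant_form:
  fixes f :: "('n::finite, 'a::euclidean_space) tensor_field"
  assumes f: "\<And>is. schwartz (f is)" and sym: "symmetric_on m f" and k: "k \<le> m"
    and \<zeta>: "\<zeta> \<noteq> 0" and T: "T \<in> {UNIV, {0..}}"
  shows "moment T m (saint_venant_form m k f \<eta> \<zeta>) \<zeta> x = (- 1) ^ (m - k) *\<^sub>R moment_derivative T m k f (m - k) \<eta> \<zeta> x"
proof -
  define N where "N = m - k"
  have T': "T \<in> sets borel" using T by auto
  let ?\<phi> = "\<lambda>l. mixed_contraction f (N - l) (k + l) \<eta> \<zeta>"
  have \<phi>: "schwartz (?\<phi> l)" for l by (intro schwartz_mixed_contraction f)
  let ?D = "directional_derivative"
  have sv: "saint_venant_form m k f \<eta> \<zeta> = (\<lambda>x. \<Sum>l=0..N. ((- 1) ^ l * real (N choose l)) *\<^sub>R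
       (?D \<eta> ^^ l) ((?D \<zeta> ^^ (N - l)) (?\<phi> l)) x)"
    unfolding N_def by (intro ext saint_venant_form_eq k schwartz_smooth f sym)
  have "moment T m (saint_venant_form m k f \<eta> \<zeta>) \<zeta> x =
      (\<Sum>l=0..N. ((- 1) ^ l * real (N choose l)) *\<^sub>R moment T m ((?D \<eta> ^^ l) ((?D \<zeta> ^^ (N - l)) (?\<phi> l))) \<zeta> x)"
    unfolding sv by (intro moment_linear_combination schwartz_directional_derivatives \<phi> \<zeta> T') simp
  also have "\<dots> = (\<Sum>l=0..N. ((- 1) ^ l * real (N choose l)) *\<^sub>R
      (((- 1) ^ (N - l) * falling m (N - l)) *\<^sub>R moment T (m - (N - l)) ((?D \<eta> ^^ l) (?\<phi> l)) \<zeta> x))"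
  proof (intro sum.cong refl arg_cong2[of _ _ _ _ scaleR])
    fix l assume "l \<in> {0..N}"
    have eq: "moment T m ((?D \<zeta> ^^ (N - l)) (?\<phi> l)) \<zeta> =
        (\<lambda>x. \<Sum>i\<in>{0::nat}. ((- 1) ^ (N - l) * falling m (N - l)) *\<^sub>R moment T (m - (N - l)) (?\<phi> l) \<zeta> x)"
    proof
      fix y
      have "moment T m ((?D \<zeta> ^^ (N - l)) (?\<phi> l)) \<zeta> y = ((- 1) ^ (N - l) * falling m (N - l)) *\<^sub>R moment T (m - (N - l)) (?\<phi> l) \<zeta> y"
        by (rule moment_directional_derivatives[OF \<phi> \<zeta> T]) (simp add: N_def)
      then show "moment T m ((?D \<zeta> ^^ (N - l)) (?\<phi> l)) \<zeta> y =
          (\<Sum>i\<in>{0::nat}. ((- 1) ^ (N - l) * falling m (N - l)) *\<^sub>R moment T (m - (N - l)) (?\<phi> l) \<zeta> y)"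
        by simp
    qed
    have "moment T m ((?D \<eta> ^^ l) ((?D \<zeta> ^^ (N - l)) (?\<phi> l))) \<zeta> x = (?D \<eta> ^^ l) (moment T m ((?D \<zeta> ^^ (N - l)) (?\<phi> l)) \<zeta>) x"
      by (simp add: directional_derivatives_moment schwartz_directional_derivatives \<phi> \<zeta> T')
    also have "\<dots> = ((- 1) ^ (N - l) * falling m (N - l)) *\<^sub>R (?D \<eta> ^^ l) (moment T (m - (N - l)) (?\<phi> l) \<zeta>) x"
      unfolding eq by (subst directional_derivatives_linear_combination) (simp_all add: smooth_moment \<phi> \<zeta> T')
    finally show "moment T m ((?D \<eta> ^^ l) ((?D \<zeta> ^^ (N - l)) (?\<phi> l))) \<zeta> x =
        ((- 1) ^ (N - l) * falling m (N - l)) *\<^sub>R moment T (m - (N - l)) ((?D \<eta> ^^ l) (?\<phi> l)) \<zeta> x"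
      by (simp add: directional_derivatives_moment \<phi> \<zeta> T')
  qed
  also have "\<dots> = (\<Sum>j\<le>N. (- 1) ^ N *\<^sub>R ((real (N choose j) * falling m j) *\<^sub>R
     moment T (k + (N - j)) ((?D \<eta> ^^ (N - j)) (mixed_contraction f j (m - j) \<eta> \<zeta>)) \<zeta> x))"
  proof (rule sum.reindex_bij_witness[of _ "\<lambda>j. N - j" "\<lambda>j. N - j"])
    fix l assume "l \<in> {0..N}"
    then have l: "l \<le> N" by simp
    have "m - (N - l) = k + l" using l k by (simp add: N_def)
    moreover have "(- 1 :: real) ^ N = (- 1) ^ l * (- 1) ^ (N - l)" using l by (simp flip: power_add)
    moreover have "N choose (N - l) = N choose l" using l by (rule binomial_symmetric[symmetric])
    ultimately show "(- 1) ^ N *\<^sub>R ((real (N choose (N - l)) * falling m (N - l)) *\<^sub>R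
        moment T (k + (N - (N - l))) ((?D \<eta> ^^ (N - (N - l))) (mixed_contraction f (N - l) (m - (N - l)) \<eta> \<zeta>)) \<zeta> x) =
      ((- 1) ^ l * real (N choose l)) *\<^sub>R
      (((- 1) ^ (N - l) * falling m (N - l)) *\<^sub>R moment T (m - (N - l)) ((?D \<eta> ^^ l) (?\<phi> l)) \<zeta> x)"
      using l by (simp add: mult_ac)
  qed auto
  also have "\<dots> = (- 1) ^ N *\<^sub>R moment_derivative T m k f N \<eta> \<zeta> x"
    by (simp add: moment_derivative_def scaleR_sum_right)
  finally show ?thesis by (simp only: N_def)
qed

text \<open>
  Differentiation of the point along \<open>\<xi>\<close> lowers the order of the moment by one.
\<close>

lemma moment_UNIV_eq_zero_mono:
  fixes \<phi> :: "real ^ 'n::finite \<Rightarrow> 'a::euclidean_space"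
  assumes \<phi>: "schwartz \<phi>" and \<xi>: "\<xi> \<noteq> 0" and zero: "\<And>x. moment UNIV p \<phi> \<xi> x = 0" and q: "q \<le> p"
  shows "moment UNIV q \<phi> \<xi> x = 0"
  using q
proof (induction q arbitrary: x rule: inc_induct)
  case base
  show ?case by (rule zero)
next
  case (step q)
  have "moment UNIV (Suc q) \<phi> \<xi> = (\<lambda>x. 0)" using step.IH by auto
  then have "directional_derivative \<xi> (moment UNIV (Suc q) \<phi> \<xi>) x = 0" by simp
  then have "moment UNIV (Suc q) (directional_derivative \<xi> \<phi>) \<xi> x = 0"
    by (simp add: directional_derivative_moment \<phi> \<xi>)
  then show ?case
    using moment_UNIV_directional_derivative[OF \<phi> \<xi>, of "Suc q" x] by (simp del: of_nat_Suc)
qed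

lemma exists_independent_pair:
  fixes \<xi> :: "real ^ 'n::finite"
  assumes "2 \<le> CARD('n)" "\<xi> \<noteq> 0"
  obtains \<zeta> where "independent_pair \<xi> \<zeta>"
proof -
  have "dim {\<xi>} = 1" using assms(2) by simp
  moreover have "dim (UNIV :: (real ^ 'n) set) = CARD('n)" by simp
  ultimately have "span {\<xi>} \<noteq> UNIV" using assms(1) by (metis dim_span Suc_1 Suc_n_not_le_n)
  then obtain \<zeta> where \<zeta>: "\<zeta> \<notin> span {\<xi>}" by auto
  have "independent_pair \<xi> \<zeta>"
    unfolding independent_pair_def
  proof (intro allI impI)
    fix a b :: real assume eq: "a *\<^sub>R \<xi> + b *\<^sub>R \<zeta> = 0"
    have "b = 0"
    proof (rule ccontr)
      assume b: "b \<noteq> 0"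
      have "b *\<^sub>R \<zeta> = - a *\<^sub>R \<xi>" using eq by (simp add: eq_neg_iff_add_eq_0 add.commute)
      then have "(1 / b) *\<^sub>R (b *\<^sub>R \<zeta>) = (- a / b) *\<^sub>R \<xi>" by simp
      then have "\<zeta> = (- a / b) *\<^sub>R \<xi>" using b by simp
      then show False using \<zeta> by (metis span_base span_scale singletonI)
    qed
    then show "a = 0 \<and> b = 0" using eq assms(2) by simp
  qed
  then show ?thesis by (rule that)
qed

lemma independent_pair_commute: "independent_pair \<xi> \<eta> \<longleftrightarrow> independent_pair \<eta> \<xi>"
  unfolding independent_pair_def by (metis add.commute)

text \<open>
  If \<open>\<xi>\<close> and \<open>\<eta>\<close> are independent, the direction \<open>\<xi> + s \<eta>\<close> never vanishes, and the moments of all orders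
  up to \<open>m\<close> of \<open>w(\<cdot>; \<eta>, \<xi> + s \<eta>)\<close> vanish by the identity for the derivative of order \<open>m - k\<close>.  Because
  the vector \<open>\<eta>\<close> in the form is the one along which the direction moves, the pairs \<open>(\<eta>, \<xi> + s \<eta>)\<close> stay
  independent.  Dependent pairs are limits of independent ones.
\<close>

theorem saint_venant_form_eq_zero:
  fixes f :: "('n::finite, 'a::euclidean_space) tensor_field"
  assumes f: "\<And>is. schwartz (f is)" and sym: "symmetric_on m f" and k: "k \<le> m" and m: "0 < m"
    and card: "2 \<le> CARD('n)"
    and zero: "\<And>\<xi> x. \<xi> \<noteq> 0 \<Longrightarrow> moment UNIV k (\<lambda>y. contraction m (\<lambda>is. f is y) \<xi>) \<xi> x = 0"
  shows "saint_venant_form m k f \<eta> \<xi> x = 0"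
proof -
  have indep: "saint_venant_form m k f \<eta> \<xi> x = 0" if ind: "independent_pair \<xi> \<eta>" for \<eta> \<xi> x
  proof -
    have nz: "\<xi> + s *\<^sub>R \<eta> \<noteq> 0" for s by (rule independent_pair_nonzero[OF ind])
    have deriv_zero: "moment_derivative UNIV m k f M \<eta> (\<xi> + s *\<^sub>R \<eta>) x = 0" for M s x
    proof (induction M arbitrary: s)
      case 0
      show ?case by (simp add: moment_derivative_0 zero nz)
    next
      case (Suc M)
      show ?case
        by (rule has_vector_derivative_eq_0[OF Suc moment_derivative_has_vector_derivative[OF f sym nz]]) simp
    qed
    have "moment UNIV q (saint_venant_form m k f \<eta> (\<xi> + s *\<^sub>R \<eta>)) (\<xi> + s *\<^sub>R \<eta>) x = 0" if "q \<le> m" for q s x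
    proof (rule moment_UNIV_eq_zero_mono[OF schwartz_saint_venant_form[OF f] nz _ that])
      show "moment UNIV m (saint_venant_form m k f \<eta> (\<xi> + s *\<^sub>R \<eta>)) (\<xi> + s *\<^sub>R \<eta>) x = 0" for x
        by (simp add: moment_saint_venant_form[OF f sym k nz] deriv_zero)
    qed
    then show ?thesis
      unfolding saint_venant_form_def[abs_def]
      by (intro vanishing_moments_imp_zero[OF _ ind] schwartz_contraction schwartz_saint_venant f)
  qed
  show ?thesis
  proof (cases "\<xi> = 0")
    case True
    then show ?thesis using m by (simp add: saint_venant_form_def contraction_zero_vector)
  next
    case False
    obtain \<zeta> where \<zeta>: "independent_pair \<xi> \<zeta>" using exists_independent_pair[OF card False] .
    define g where "g s = saint_venant_form m k f (\<eta> + s *\<^sub>R \<zeta>) \<xi> x" for s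
    \<comment> \<open>at most one of the vectors \<open>\<eta> + s \<zeta>\<close> is a multiple of \<open>\<xi>\<close>\<close>
    have ex: "\<exists>s\<^sub>0. \<forall>s. s \<noteq> s\<^sub>0 \<longrightarrow> independent_pair \<xi> (\<eta> + s *\<^sub>R \<zeta>)"
    proof (rule ccontr)
      assume "\<not> ?thesis"
      then obtain s s' where s: "s \<noteq> s'" "\<not> independent_pair \<xi> (\<eta> + s *\<^sub>R \<zeta>)" "\<not> independent_pair \<xi> (\<eta> + s' *\<^sub>R \<zeta>)"
        by metis
      have mult: "\<exists>c. \<eta> + s *\<^sub>R \<zeta> = c *\<^sub>R \<xi>" if dep: "\<not> independent_pair \<xi> (\<eta> + s *\<^sub>R \<zeta>)" for s
      proof -
        obtain a b where ab: "a *\<^sub>R \<xi> + b *\<^sub>R (\<eta> + s *\<^sub>R \<zeta>) = 0" "a \<noteq> 0 \<or> b \<noteq> 0"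
          using dep unfolding independent_pair_def by blast
        have b: "b \<noteq> 0" using ab False by auto
        have "b *\<^sub>R (\<eta> + s *\<^sub>R \<zeta>) = - a *\<^sub>R \<xi>" using ab(1) by (simp add: eq_neg_iff_add_eq_0 add.commute)
        then have "(1 / b) *\<^sub>R (b *\<^sub>R (\<eta> + s *\<^sub>R \<zeta>)) = (- a / b) *\<^sub>R \<xi>" by simp
        then show ?thesis using b by (intro exI[of _ "- a / b"]) simp
      qed
      obtain c c' where c: "\<eta> + s *\<^sub>R \<zeta> = c *\<^sub>R \<xi>" "\<eta> + s' *\<^sub>R \<zeta> = c' *\<^sub>R \<xi>"
        using mult[OF s(2)] mult[OF s(3)] by blast
      have "(c' - c) *\<^sub>R \<xi> + (s - s') *\<^sub>R \<zeta> =
          (\<eta> + s *\<^sub>R \<zeta> - c *\<^sub>R \<xi>) - (\<eta> + s' *\<^sub>R \<zeta> - c' *\<^sub>R \<xi>)"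
        by (simp add: algebra_simps)
      also have "\<dots> = 0" by (simp only: c diff_self)
      finally have "(c' - c) *\<^sub>R \<xi> + (s - s') *\<^sub>R \<zeta> = 0" .
      then have "s - s' = 0" using \<zeta> unfolding independent_pair_def by blast
      with s(1) show False by simp
    qed
    then obtain s\<^sub>0 where s\<^sub>0: "\<And>s. s \<noteq> s\<^sub>0 \<Longrightarrow> g s = 0"
      using indep unfolding g_def by blast
    have "continuous_on UNIV g"
      unfolding g_def saint_venant_form_def by (intro continuous_intros)
    then have "g \<midarrow>0\<rightarrow> g 0" by (simp add: continuous_on_eq_continuous_at isCont_def)
    moreover have "\<forall>\<^sub>F s in at 0. g s = 0"
    proof (cases "s\<^sub>0 = 0")
      case True
      then show ?thesis using s\<^sub>0 by (auto simp: eventually_at_filter)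
    next
      case False
      then have "\<forall>\<^sub>F s in at 0. s \<noteq> s\<^sub>0" by (intro tendsto_imp_eventually_ne[OF tendsto_ident_at]) auto
      then show ?thesis by eventually_elim (rule s\<^sub>0)
    qed
    then have "g \<midarrow>0\<rightarrow> 0" by (rule tendsto_eventually)
    ultimately have "g 0 = 0" by (rule LIM_unique)
    then show ?thesis by (simp add: g_def)
  qed
qed

section \<open>Functions that are polynomial along lines\<close>

definition polynomial_map :: "(real ^ 'n::finite \<Rightarrow> 'a::real_vector) \<Rightarrow> bool" where
  "polynomial_map V \<longleftrightarrow> (\<exists>E c. \<forall>\<xi>. V \<xi> = (\<Sum>e\<le>E. contraction e (c e) \<xi>))"

lemma polynomial_map_degree:
  assumes "polynomial_map V"
  obtains E c where "d \<le> E" "\<And>\<xi>. V \<xi> = (\<Sum>e\<le>E. contraction e (c e) \<xi>)"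
proof -
  obtain E c where V: "\<And>\<xi>. V \<xi> = (\<Sum>e\<le>E. contraction e (c e) \<xi>)"
    using assms by (auto simp: polynomial_map_def)
  have "V \<xi> = (\<Sum>e\<le>max d E. contraction e (if e \<le> E then c e else (\<lambda>is. 0)) \<xi>)" for \<xi>
    unfolding V by (rule sum.mono_neutral_cong_left) auto
  then show ?thesis using that[of "max d E"] by auto
qed

lemma polynomial_map_const: "polynomial_map (\<lambda>\<xi>. v)"
  unfolding polynomial_map_def by (intro exI[of _ 0] exI[of _ "\<lambda>e is. v"]) simp

lemma polynomial_map_add:
  assumes "polynomial_map V" "polynomial_map W"
  shows "polynomial_map (\<lambda>\<xi>. V \<xi> + W \<xi>)"
proof -
  obtain D a where V: "\<And>\<xi>. V \<xi> = (\<Sum>e\<le>D. contraction e (a e) \<xi>)"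
    using assms(1) by (auto simp: polynomial_map_def)
  obtain E b where W: "D \<le> E" "\<And>\<xi>. W \<xi> = (\<Sum>e\<le>E. contraction e (b e) \<xi>)"
    using polynomial_map_degree[OF assms(2)] by blast
  obtain E' a' where V': "E \<le> E'" "\<And>\<xi>. V \<xi> = (\<Sum>e\<le>E'. contraction e (a' e) \<xi>)"
    using polynomial_map_degree[OF assms(1)] by blast
  have W': "W \<xi> = (\<Sum>e\<le>E'. contraction e (if e \<le> E then b e else (\<lambda>is. 0)) \<xi>)" for \<xi>
    unfolding W by (rule sum.mono_neutral_cong_left) (use V'(1) in auto)
  have eq: "V \<xi> + W \<xi> = (\<Sum>e\<le>E'. contraction e (\<lambda>is. a' e is + (if e \<le> E then b e else (\<lambda>is. 0)) is) \<xi>)" for \<xi>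
    unfolding contraction_add_fun sum.distrib V'(2) W' ..
  show ?thesis unfolding polynomial_map_def by (intro exI allI, rule eq)
qed

lemma polynomial_map_scaleR:
  assumes "polynomial_map V"
  shows "polynomial_map (\<lambda>\<xi>. r *\<^sub>R V \<xi>)"
proof -
  obtain D a where V: "\<And>\<xi>. V \<xi> = (\<Sum>e\<le>D. contraction e (a e) \<xi>)"
    using assms(1) by (auto simp: polynomial_map_def)
  have eq: "r *\<^sub>R V \<xi> = (\<Sum>e\<le>D. contraction e (\<lambda>is. r *\<^sub>R a e is) \<xi>)" for \<xi>
    unfolding contraction_scaleR_fun V scaleR_sum_right ..
  show ?thesis unfolding polynomial_map_def by (intro exI allI, rule eq)
qed

lemma polynomial_map_sum:
  "finite J \<Longrightarrow> (\<And>j. j \<in> J \<Longrightarrow> polynomial_map (V j)) \<Longrightarrow> polynomial_map (\<lambda>\<xi>. \<Sum>j\<in>J. V j \<xi>)"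
  by (induction J rule: finite_induct) (auto intro: polynomial_map_const polynomial_map_add)

lemma polynomial_map_coordinate:
  fixes V :: "real ^ 'n::finite \<Rightarrow> 'a::real_vector"
  assumes "polynomial_map V"
  shows "polynomial_map (\<lambda>\<xi>. \<xi> $ i *\<^sub>R V \<xi>)"
proof -
  obtain D a where V: "\<And>\<xi>. V \<xi> = (\<Sum>e\<le>D. contraction e (a e) \<xi>)"
    using assms(1) by (auto simp: polynomial_map_def)
  define b where "b e' = (case e' of 0 \<Rightarrow> (\<lambda>is. 0) | Suc e \<Rightarrow> (\<lambda>is. if hd is = i then a e (tl is) else 0))" for e'
  have "contraction (Suc e) (b (Suc e)) \<xi> = \<xi> $ i *\<^sub>R contraction e (a e) \<xi>" for e \<xi>
  proof -
    have "contraction (Suc e) (b (Suc e)) \<xi> = (\<Sum>j\<in>UNIV. if j = i then \<xi> $ i *\<^sub>R contraction e (a e) \<xi> else 0)"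
      unfolding contraction_Suc by (intro sum.cong) (auto simp: b_def)
    then show ?thesis by simp
  qed
  then have "\<xi> $ i *\<^sub>R V \<xi> = (\<Sum>e\<le>Suc D. contraction e (b e) \<xi>)" for \<xi>
    by (subst sum.atMost_Suc_shift) (simp add: V scaleR_sum_right b_def[of 0])
  then show ?thesis unfolding polynomial_map_def by blast
qed

lemma polynomial_map_coordinate_power:
  "polynomial_map V \<Longrightarrow> polynomial_map (\<lambda>\<xi>. (\<xi> $ i) ^ j *\<^sub>R V \<xi>)"
proof (induction j)
  case (Suc j)
  then have "polynomial_map (\<lambda>\<xi>. \<xi> $ i *\<^sub>R ((\<xi> $ i) ^ j *\<^sub>R V \<xi>))"
    by (intro polynomial_map_coordinate) auto
  then show ?case by simp
qed simp

text \<open>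
  Interpolation in one coordinate after the other: along a coordinate line, \<open>V\<close> is a combination of its
  values at \<open>d + 1\<close> points, and these values are functions of fewer coordinates of the same kind.
\<close>

theorem polynomial_on_lines_imp_polynomial_map:
  fixes V :: "real ^ 'n::finite \<Rightarrow> 'a::real_vector"
  assumes "\<And>\<xi> \<eta>. \<exists>a. \<forall>s. V (\<xi> + s *\<^sub>R \<eta>) = (\<Sum>j\<le>d. s ^ j *\<^sub>R a j)"
  shows "polynomial_map V"
proof -
  define restr where "restr S \<xi> = (\<chi> i. if i \<in> S then \<xi> $ i else 0)" for S and \<xi> :: "real ^ 'n"
  obtain v where v: "\<And>(a :: nat \<Rightarrow> 'a) j. j \<le> d \<Longrightarrow>
     a j = (\<Sum>l\<le>d. v l j *\<^sub>R (\<Sum>i\<le>d. real l ^ i *\<^sub>R a i))"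
    using vector_polynomial_coeffs[of d, where 'a = 'a] by blast
  have "polynomial_map (\<lambda>\<xi>. V (restr S \<xi>))" if "finite S" for S
    using that assms
  proof (induction S arbitrary: V rule: finite_induct)
    case empty
    have "restr {} = (\<lambda>\<xi>. 0)" by (simp add: restr_def fun_eq_iff vec_eq_iff)
    then show ?case by (simp add: polynomial_map_const)
  next
    case (insert i S)
    let ?e = "axis i 1 :: real ^ 'n"
    have restr: "restr (insert i S) \<xi> = restr S \<xi> + \<xi> $ i *\<^sub>R ?e" for \<xi>
      using insert.hyps by (auto simp: restr_def vec_eq_iff axis_def)
    have eq: "V (restr (insert i S) \<xi>) = (\<Sum>j\<le>d. (\<xi> $ i) ^ j *\<^sub>R (\<Sum>l\<le>d. v l j *\<^sub>R V (restr S \<xi> + real l *\<^sub>R ?e)))" for \<xi>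
    proof -
      obtain a where a: "\<And>s. V (restr S \<xi> + s *\<^sub>R ?e) = (\<Sum>j\<le>d. s ^ j *\<^sub>R a j)"
        using insert.prems by blast
      show ?thesis
        unfolding restr a by (intro sum.cong refl arg_cong2[of _ _ _ _ scaleR] v) simp
    qed
    have "polynomial_map (\<lambda>\<xi>. V (restr S \<xi> + real l *\<^sub>R ?e))" for l
    proof (rule insert.IH)
      fix \<xi> \<eta>
      obtain a where "\<And>s. V ((\<xi> + real l *\<^sub>R ?e) + s *\<^sub>R \<eta>) = (\<Sum>j\<le>d. s ^ j *\<^sub>R a j)"
        using insert.prems by blast
      then show "\<exists>a. \<forall>s. V (\<xi> + s *\<^sub>R \<eta> + real l *\<^sub>R ?e) = (\<Sum>j\<le>d. s ^ j *\<^sub>R a j)"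
        by (intro exI[of _ a]) (simp add: add_ac)
    qed
    then show ?case
      unfolding eq by (intro polynomial_map_sum polynomial_map_coordinate_power polynomial_map_scaleR) auto
  qed
  from this[of UNIV] show ?thesis by (simp add: restr_def)
qed

text \<open>
  A homogeneous polynomial coincides with its part of the same degree.
\<close>

lemma homogeneous_polynomial_map:
  fixes V :: "real ^ 'n::finite \<Rightarrow> 'a::real_vector"
  assumes "polynomial_map V" and hom: "\<And>l \<xi>. V (real l *\<^sub>R \<xi>) = real l ^ d *\<^sub>R V \<xi>"
  obtains T where "\<And>\<xi>. V \<xi> = contraction d T \<xi>"
proof -
  obtain E c where E: "d \<le> E" and V: "\<And>\<xi>. V \<xi> = (\<Sum>e\<le>E. contraction e (c e) \<xi>)"
    using polynomial_map_degree[OF assms(1)] by blast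
  have "V \<xi> = contraction d (c d) \<xi>" for \<xi>
  proof -
    have "contraction d (c d) \<xi> = (if d = d then V \<xi> else 0)"
    proof (rule vector_polynomial_eqD[where d = E and a = "\<lambda>e. contraction e (c e) \<xi>" and b = "\<lambda>e. if e = d then V \<xi> else 0"])
      fix l
      have "(\<Sum>e\<le>E. real l ^ e *\<^sub>R contraction e (c e) \<xi>) = V (real l *\<^sub>R \<xi>)"
        unfolding V by (simp add: contraction_scaleR)
      also have "\<dots> = (\<Sum>e\<le>E. if e = d then real l ^ d *\<^sub>R V \<xi> else 0)"
        using E by (simp add: hom)
      also have "\<dots> = (\<Sum>e\<le>E. real l ^ e *\<^sub>R (if e = d then V \<xi> else 0))"
        by (intro sum.cong) auto
      finally show "(\<Sum>e\<le>E. real l ^ e *\<^sub>R contraction e (c e) \<xi>) = (\<Sum>e\<le>E. real l ^ e *\<^sub>R (if e = d then V \<xi> else 0))" .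
    qed (rule E)
    then show ?thesis by simp
  qed
  then show ?thesis by (rule that)
qed

lemma polynomial_antiderivative:
  fixes g :: "real \<Rightarrow> 'a::real_normed_vector"
  assumes g: "\<And>s. (g has_vector_derivative (\<Sum>j<n. s ^ j *\<^sub>R a j)) (at s)"
  shows "\<exists>b. \<forall>s. g s = (\<Sum>j<Suc n. s ^ j *\<^sub>R b j)"
proof -
  define b where "b j = (case j of 0 \<Rightarrow> g 0 | Suc i \<Rightarrow> (1 / real (Suc i)) *\<^sub>R a i)" for j
  have sum: "(\<Sum>j<Suc n. s ^ j *\<^sub>R b j) = g 0 + (\<Sum>j<n. (s ^ Suc j / real (Suc j)) *\<^sub>R a j)" for s
    by (subst sum.lessThan_Suc_shift) (simp add: b_def)
  have "((\<lambda>s. g s - (\<Sum>j<n. (s ^ Suc j / real (Suc j)) *\<^sub>R a j)) has_vector_derivative 0) (at s)" for s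
  proof -
    have "((\<lambda>s. s ^ Suc j / real (Suc j)) has_real_derivative s ^ j) (at s)" for j
      using DERIV_cdivide[OF DERIV_pow[of "Suc j" s], of "real (Suc j)"] by (simp del: of_nat_Suc)
    then have "((\<lambda>s. \<Sum>j<n. (s ^ Suc j / real (Suc j)) *\<^sub>R a j) has_vector_derivative (\<Sum>j<n. s ^ j *\<^sub>R a j)) (at s)"
      by (intro has_vector_derivative_sum)
        (use has_vector_derivative_scaleR[OF _ has_vector_derivative_const] in fastforce)
    from has_vector_derivative_diff[OF g this] show ?thesis by simp
  qed
  then obtain c where c: "\<And>s. g s - (\<Sum>j<n. (s ^ Suc j / real (Suc j)) *\<^sub>R a j) = c"
    using has_vector_derivative_zero_constant[of UNIV] by auto
  have "g s = (\<Sum>j<Suc n. s ^ j *\<^sub>R b j)" for s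
    using c[of s] c[of 0] unfolding sum by (simp add: algebra_simps)
  then show ?thesis by blast
qed

section \<open>The half-line moment of a field with vanishing Saint Venant form\<close>

text \<open>
  The derivative of order \<open>m - k\<close> in \<open>s\<close> is a moment of the Saint Venant form, hence zero.
\<close>

lemma half_line_moment_polynomial:
  fixes f :: "('n::finite, 'a::euclidean_space) tensor_field"
  assumes f: "\<And>is. schwartz (f is)" and sym: "symmetric_on m f" and k: "k \<le> m"
    and zero: "\<And>\<eta> \<xi> x. saint_venant_form m k f \<eta> \<xi> x = 0" and ind: "independent_pair \<xi> \<eta>"
  shows "\<exists>a. \<forall>s. moment {0..} k (\<lambda>y. contraction m (\<lambda>is. f is y) (\<xi> + s *\<^sub>R \<eta>)) (\<xi> + s *\<^sub>R \<eta>) x =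
    (\<Sum>j<m - k. s ^ j *\<^sub>R a j)"
proof -
  have nz: "\<xi> + s *\<^sub>R \<eta> \<noteq> 0" for s by (rule independent_pair_nonzero[OF ind])
  have "\<exists>a. \<forall>s. moment_derivative {0..} m k f M \<eta> (\<xi> + s *\<^sub>R \<eta>) x = (\<Sum>j<m - k - M. s ^ j *\<^sub>R a j)"
    if "M \<le> m - k" for M
    using that
  proof (induction M rule: inc_induct)
    case base
    have "saint_venant_form m k f \<eta> (\<xi> + s *\<^sub>R \<eta>) = (\<lambda>x. 0)" for s using zero by auto
    then have "moment_derivative {0..} m k f (m - k) \<eta> (\<xi> + s *\<^sub>R \<eta>) x = 0" for s
      using moment_saint_venant_form[OF f sym k nz, where T = "{0..}" and \<eta> = \<eta> and x = x] by simp
    then show ?case by simp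
  next
    case (step M)
    obtain a where a: "\<And>s. moment_derivative {0..} m k f (Suc M) \<eta> (\<xi> + s *\<^sub>R \<eta>) x = (\<Sum>j<m - k - Suc M. s ^ j *\<^sub>R a j)"
      using step.IH by blast
    have "((\<lambda>s. moment_derivative {0..} m k f M \<eta> (\<xi> + s *\<^sub>R \<eta>) x) has_vector_derivative (\<Sum>j<m - k - Suc M. s ^ j *\<^sub>R a j)) (at s)" for s
      unfolding a[symmetric] by (rule moment_derivative_has_vector_derivative[OF f sym nz]) simp
    from polynomial_antiderivative[OF this] show ?case
      using step.hyps by (simp add: Suc_diff_Suc)
  qed
  from this[of 0] show ?thesis by (simp add: moment_derivative_0)
qed

lemma moment_scaleR:
  "moment T q (\<lambda>x. c *\<^sub>R \<phi> x) \<xi> x = c *\<^sub>R moment T q \<phi> \<xi> x"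
proof -
  have "(\<lambda>t. indicator T t *\<^sub>R t ^ q *\<^sub>R c *\<^sub>R \<phi> (x + t *\<^sub>R \<xi>)) = (\<lambda>t. c *\<^sub>R (indicator T t *\<^sub>R t ^ q *\<^sub>R \<phi> (x + t *\<^sub>R \<xi>)))"
    by (auto simp: mult_ac)
  then show ?thesis
    unfolding moment_def set_lebesgue_integral_def by (simp only: integral_scaleR_right)
qed

lemma independent_pair_scaleR:
  assumes "independent_pair \<xi> \<eta>" "c \<noteq> 0"
  shows "independent_pair (c *\<^sub>R \<xi>) \<eta>"
  unfolding independent_pair_def
proof (intro allI impI)
  fix a b assume "a *\<^sub>R c *\<^sub>R \<xi> + b *\<^sub>R \<eta> = 0"
  then have "(a * c) *\<^sub>R \<xi> + b *\<^sub>R \<eta> = 0" by simp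
  then have "a * c = 0 \<and> b = 0" using assms(1) unfolding independent_pair_def by blast
  then show "a = 0 \<and> b = 0" using assms(2) by simp
qed

lemma dependent_pair:
  fixes \<xi> \<eta> e :: "'v::real_vector"
  assumes "\<not> independent_pair \<xi> \<eta>" "e \<noteq> 0"
  obtains u \<alpha> \<beta> where "u \<noteq> 0" "\<xi> = \<alpha> *\<^sub>R u" "\<eta> = \<beta> *\<^sub>R u"
proof -
  obtain a b where ab: "a *\<^sub>R \<xi> + b *\<^sub>R \<eta> = 0" "a \<noteq> 0 \<or> b \<noteq> 0"
    using assms unfolding independent_pair_def by blast
  consider "\<xi> = 0" "\<eta> = 0" | "\<xi> \<noteq> 0" | "\<eta> \<noteq> 0" "\<xi> = 0" by blast
  then show ?thesis
  proof cases
    case 1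
    then show ?thesis using that[of e 0 0] assms(2) by simp
  next
    case 2
    then have b: "b \<noteq> 0" using ab by auto
    have "b *\<^sub>R \<eta> = - a *\<^sub>R \<xi>" using ab(1) by (simp add: eq_neg_iff_add_eq_0 add.commute)
    then have "(1 / b) *\<^sub>R (b *\<^sub>R \<eta>) = (- a / b) *\<^sub>R \<xi>" by simp
    then show ?thesis using that[of \<xi> 1 "- a / b"] 2 b by simp
  next
    case 3
    then show ?thesis using that[of \<eta> 0 1] by simp
  qed
qed

text \<open>
  The function \<open>V\<close> is a polynomial along lines that avoid the origin and homogeneous of degree
  \<open>d = m - k - 1\<close> for positive factors.  Comparing \<open>V(\<xi> + s \<rho>)\<close> with \<open>s\<^sup>d V(\<rho> + \<xi> / s)\<close> for \<open>s > 0\<close>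
  identifies the coefficients of the two polynomials in reverse order, and at \<open>s = -1\<close> this gives
  \<open>V(- \<eta>) = (-1)\<^sup>d V(\<eta>)\<close>.  The parity makes the two half-line moments cancel, and extends the
  homogeneity to all factors, which covers the lines through the origin.
\<close>

theorem half_line_moment_homogeneous_polynomial:
  fixes f :: "('n::finite, 'a::euclidean_space) tensor_field" and x :: "real ^ 'n"
  assumes f: "\<And>is. schwartz (f is)" and sym: "symmetric_on m f" and k: "k < m"
    and card: "2 \<le> CARD('n)"
    and zero: "\<And>\<eta> \<xi> x. saint_venant_form m k f \<eta> \<xi> x = 0"
  defines "V \<equiv> \<lambda>\<xi>. moment {0..} k (\<lambda>y. contraction m (\<lambda>is. f is y) \<xi>) \<xi> x"
  shows "\<xi> \<noteq> 0 \<Longrightarrow> moment UNIV k (\<lambda>y. contraction m (\<lambda>is. f is y) \<xi>) \<xi> x = 0"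
    and "\<exists>T. \<forall>\<xi>. \<xi> \<noteq> 0 \<longrightarrow> V \<xi> = contraction (m - k - 1) T \<xi>"
proof -
  define d where "d = m - k - 1"
  have mkd: "m - k = Suc d" "m = k + Suc d" using k by (auto simp: d_def)
  have line: "\<exists>a. \<forall>s. V (\<xi> + s *\<^sub>R \<eta>) = (\<Sum>j\<le>d. s ^ j *\<^sub>R a j)" if "independent_pair \<xi> \<eta>" for \<xi> \<eta>
    using half_line_moment_polynomial[OF f sym less_imp_le[OF k] zero that, of x]
    by (simp only: V_def mkd(1) lessThan_Suc_atMost)
  have scale: "V (c *\<^sub>R \<xi>) = c ^ d *\<^sub>R V \<xi>" if c: "0 < c" for c \<xi>
  proof -
    have "V (c *\<^sub>R \<xi>) = c ^ m *\<^sub>R moment {0..} k (\<lambda>y. contraction m (\<lambda>is. f is y) \<xi>) (c *\<^sub>R \<xi>) x"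
      by (simp add: V_def contraction_scaleR moment_scaleR)
    also have "\<dots> = c ^ d *\<^sub>R (c ^ Suc k *\<^sub>R moment {0..} k (\<lambda>y. contraction m (\<lambda>is. f is y) \<xi>) (c *\<^sub>R \<xi>) x)"
      by (simp add: mkd(2) power_add mult_ac)
    also have "c ^ Suc k *\<^sub>R moment {0..} k (\<lambda>y. contraction m (\<lambda>is. f is y) \<xi>) (c *\<^sub>R \<xi>) x = V \<xi>"
      unfolding V_def by (rule moment_scale[symmetric]) (use c in \<open>auto simp: zero_le_mult_iff\<close>)
    finally show ?thesis .
  qed
  have parity: "V (- \<eta>) = (- 1) ^ d *\<^sub>R V \<eta>" if \<eta>: "\<eta> \<noteq> 0" for \<eta>
  proof -
    obtain \<xi> where ind: "independent_pair \<eta> \<xi>" using exists_independent_pair[OF card \<eta>] .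
    \<comment> \<open>with this choice \<open>\<xi> + s \<rho>\<close> is \<open>- \<eta>\<close> at \<open>s = - 1\<close>\<close>
    define \<rho> where "\<rho> = \<eta> + \<xi>"
    have ind1: "independent_pair \<rho> \<xi>"
      using independent_pair_shear[OF ind, of 1] by (simp add: \<rho>_def)
    then have ind2: "independent_pair \<xi> \<rho>" by (simp add: independent_pair_commute)
    obtain a where a: "\<And>s. V (\<xi> + s *\<^sub>R \<rho>) = (\<Sum>j\<le>d. s ^ j *\<^sub>R a j)" using line[OF ind2] by blast
    obtain b where b: "\<And>s. V (\<rho> + s *\<^sub>R \<xi>) = (\<Sum>j\<le>d. s ^ j *\<^sub>R b j)" using line[OF ind1] by blast
    have rev: "(\<Sum>j\<le>d. s ^ j *\<^sub>R a j) = (\<Sum>j\<le>d. s ^ j *\<^sub>R b (d - j))" if s: "0 < s" for s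
    proof -
      have "\<xi> + s *\<^sub>R \<rho> = s *\<^sub>R (\<rho> + (1 / s) *\<^sub>R \<xi>)" using s by (simp add: scaleR_add_right add.commute)
      then have "(\<Sum>j\<le>d. s ^ j *\<^sub>R a j) = s ^ d *\<^sub>R (\<Sum>j\<le>d. (1 / s) ^ j *\<^sub>R b j)"
        unfolding a[symmetric] b[symmetric] by (simp only: scale[OF s])
      also have "\<dots> = (\<Sum>j\<le>d. s ^ (d - j) *\<^sub>R b j)"
        unfolding scaleR_sum_right
        by (intro sum.cong) (use s in \<open>auto simp: power_diff power_one_over divide_inverse power_inverse\<close>)
      also have "\<dots> = (\<Sum>j\<le>d. s ^ j *\<^sub>R b (d - j))"
        by (rule sum.reindex_bij_witness[of _ "\<lambda>j. d - j" "\<lambda>j. d - j"]) auto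
      finally show ?thesis .
    qed
    have ab: "a j = b (d - j)" if j: "j \<le> d" for j
    proof -
      \<comment> \<open>multiplied by \<open>s\<close>, both sides of \<open>rev\<close> also agree at the node \<open>s = 0\<close>\<close>
      let ?shift = "\<lambda>c i. case i of 0 \<Rightarrow> 0 | Suc j \<Rightarrow> c j"
      have "?shift a (Suc j) = ?shift (\<lambda>j. b (d - j)) (Suc j)"
      proof (rule vector_polynomial_eqD[where d = "Suc d"])
        fix l
        have shift: "(\<Sum>i\<le>Suc d. real l ^ i *\<^sub>R ?shift c i) = real l *\<^sub>R (\<Sum>i\<le>d. real l ^ i *\<^sub>R c i)" for c :: "nat \<Rightarrow> 'a"
          by (subst sum.atMost_Suc_shift) (simp add: scaleR_sum_right)
        show "(\<Sum>i\<le>Suc d. real l ^ i *\<^sub>R ?shift a i) = (\<Sum>i\<le>Suc d. real l ^ i *\<^sub>R ?shift (\<lambda>j. b (d - j)) i)"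
          unfolding shift using rev[of "real l"] by (cases "l = 0") auto
      qed (use j in simp)
      then show ?thesis by simp
    qed
    have "V (- \<eta>) = V (\<xi> + (- 1) *\<^sub>R \<rho>)" by (simp add: \<rho>_def)
    also have "\<dots> = (\<Sum>j\<le>d. (- 1) ^ j *\<^sub>R b (d - j))" unfolding a by (intro sum.cong) (simp_all add: ab)
    also have "\<dots> = (\<Sum>j\<le>d. (- 1) ^ (d - j) *\<^sub>R b j)"
      by (rule sum.reindex_bij_witness[of _ "\<lambda>j. d - j" "\<lambda>j. d - j"]) auto
    also have "\<dots> = (- 1) ^ d *\<^sub>R (\<Sum>j\<le>d. (- 1) ^ j *\<^sub>R b j)"
    proof -
      have "(- 1 :: real) ^ (d - j) = (- 1) ^ d * (- 1) ^ j" if "j \<le> d" for j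
        using that by (simp add: power_diff power_minus' divide_simps minus_one_power_iff)
      then show ?thesis unfolding scaleR_sum_right by (intro sum.cong) simp_all
    qed
    also have "\<dots> = (- 1) ^ d *\<^sub>R V \<eta>" unfolding b[symmetric] by (simp add: \<rho>_def)
    finally show ?thesis .
  qed
  have sch: "schwartz (\<lambda>y. contraction m (\<lambda>is. f is y) \<xi>)" for \<xi> by (intro schwartz_contraction f)
  show "moment UNIV k (\<lambda>y. contraction m (\<lambda>is. f is y) \<xi>) \<xi> x = 0" if \<xi>: "\<xi> \<noteq> 0"
  proof -
    have "V (- \<xi>) = (- 1) ^ m *\<^sub>R moment {0..} k (\<lambda>y. contraction m (\<lambda>is. f is y) \<xi>) (- \<xi>) x"
    proof -
      have "contraction m T (- \<xi>) = (- 1) ^ m *\<^sub>R contraction m T \<xi>" for T :: "'n list \<Rightarrow> 'a"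
        using contraction_scaleR[of m T "- 1" \<xi>] by simp
      then show ?thesis by (simp add: V_def moment_scaleR)
    qed
    then have "moment {0..} k (\<lambda>y. contraction m (\<lambda>is. f is y) \<xi>) (- \<xi>) x = (- 1) ^ m *\<^sub>R V (- \<xi>)"
      by (simp flip: power_add)
    then have "moment UNIV k (\<lambda>y. contraction m (\<lambda>is. f is y) \<xi>) \<xi> x = V \<xi> + ((- 1) ^ k * (- 1) ^ m * (- 1) ^ d) *\<^sub>R V \<xi>"
      using moment_half_line_reflect[OF sch \<xi>, of k \<xi> x] parity[OF \<xi>] by (simp add: V_def mult_ac)
    moreover have "(- 1 :: real) ^ k * (- 1) ^ m * (- 1) ^ d = - 1"
      by (simp add: mkd(2) minus_one_power_iff)
    ultimately show ?thesis by simp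
  qed
  obtain i :: 'n where True by simp
  define e where "e = (axis i 1 :: real ^ 'n)"
  have e: "e \<noteq> 0" by (simp add: e_def axis_eq_0_iff)
  \<comment> \<open>the continuous extension of \<open>V\<close> to the origin; for \<open>d = 0\<close> the function \<open>V\<close> is constant elsewhere\<close>
  define U where "U \<xi> = (if \<xi> \<noteq> 0 then V \<xi> else if d = 0 then V e else 0)" for \<xi>
  have const: "V \<xi> = V \<eta>" if d: "d = 0" and \<xi>: "\<xi> \<noteq> 0" and \<eta>: "\<eta> \<noteq> 0" for \<xi> \<eta>
  proof -
    have indep: "V \<xi> = V \<eta>" if ind: "independent_pair \<xi> \<eta>" for \<xi> \<eta>
    proof -
      obtain a where a: "\<And>s. V (\<xi> + s *\<^sub>R \<eta>) = (\<Sum>j\<le>d. s ^ j *\<^sub>R a j)" using line[OF ind] by blast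
      obtain b where b: "\<And>s. V (\<eta> + s *\<^sub>R \<xi>) = (\<Sum>j\<le>d. s ^ j *\<^sub>R b j)"
        using line[of \<eta> \<xi>] ind by (metis independent_pair_commute)
      show ?thesis using a[of 0] a[of 1] b[of 0] b[of 1] d by (simp add: add.commute)
    qed
    show ?thesis
    proof (cases "independent_pair \<xi> \<eta>")
      case False
      then obtain u \<alpha> \<beta> where u: "u \<noteq> 0" "\<xi> = \<alpha> *\<^sub>R u" "\<eta> = \<beta> *\<^sub>R u" using dependent_pair[OF _ e] by blast
      \<comment> \<open>parallel vectors are compared through a third one\<close>
      obtain \<zeta> where \<zeta>: "independent_pair u \<zeta>" using exists_independent_pair[OF card u(1)] .
      have "\<alpha> \<noteq> 0" "\<beta> \<noteq> 0" using u \<xi> \<eta> by auto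
      then have "independent_pair \<xi> \<zeta>" "independent_pair \<eta> \<zeta>"
        unfolding u by (intro independent_pair_scaleR \<zeta>; simp)+
      then show ?thesis using indep by metis
    qed (rule indep)
  qed
  have hom: "U (c *\<^sub>R \<xi>) = c ^ d *\<^sub>R U \<xi>" for c \<xi>
  proof -
    consider "\<xi> = 0" | "\<xi> \<noteq> 0" "c = 0" | "\<xi> \<noteq> 0" "0 < c" | "\<xi> \<noteq> 0" "c < 0" by linarith
    then show ?thesis
    proof cases
      case 1
      then show ?thesis by (simp add: U_def)
    next
      case 2
      then show ?thesis using const[of e \<xi>] e by (auto simp: U_def power_0_left)
    next
      case 3
      then show ?thesis using scale[of c \<xi>] by (simp add: U_def)
    next
      case 4
      have "V (c *\<^sub>R \<xi>) = V (- ((- c) *\<^sub>R \<xi>))" by simp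
      also have "\<dots> = (- 1) ^ d *\<^sub>R V ((- c) *\<^sub>R \<xi>)" using 4 by (intro parity) auto
      also have "\<dots> = (- 1) ^ d *\<^sub>R (- c) ^ d *\<^sub>R V \<xi>" using 4 scale[of "- c" \<xi>] by simp
      also have "\<dots> = c ^ d *\<^sub>R V \<xi>" by (simp flip: power_mult_distrib)
      finally show ?thesis using 4 by (simp add: U_def)
    qed
  qed
  have "polynomial_map U"
  proof (rule polynomial_on_lines_imp_polynomial_map[where d = d])
    fix \<xi> \<eta> :: "real ^ 'n"
    show "\<exists>a. \<forall>s. U (\<xi> + s *\<^sub>R \<eta>) = (\<Sum>j\<le>d. s ^ j *\<^sub>R a j)"
    proof (cases "independent_pair \<xi> \<eta>")
      case True
      have "U (\<xi> + s *\<^sub>R \<eta>) = V (\<xi> + s *\<^sub>R \<eta>)" for s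
        using independent_pair_nonzero[OF True] by (simp add: U_def)
      then show ?thesis using line[OF True] by simp
    next
      case False
      then obtain u \<alpha> \<beta> where u: "u \<noteq> 0" "\<xi> = \<alpha> *\<^sub>R u" "\<eta> = \<beta> *\<^sub>R u" using dependent_pair[OF _ e] by blast
      have eq: "U (\<xi> + s *\<^sub>R \<eta>) = (\<Sum>j\<le>d. s ^ j *\<^sub>R ((real (d choose j) * \<beta> ^ j * \<alpha> ^ (d - j)) *\<^sub>R U u))" for s
      proof -
        have "\<xi> + s *\<^sub>R \<eta> = (s * \<beta> + \<alpha>) *\<^sub>R u" by (simp add: u scaleR_add_left add.commute)
        then have "U (\<xi> + s *\<^sub>R \<eta>) = (s * \<beta> + \<alpha>) ^ d *\<^sub>R U u" by (simp only: hom)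
        then show ?thesis
          unfolding binomial_ring scaleR_sum_left by (simp add: power_mult_distrib mult_ac)
      qed
      show ?thesis by (intro exI allI, rule eq)
    qed
  qed
  then obtain T where "\<And>\<xi>. U \<xi> = contraction d T \<xi>"
    using homogeneous_polynomial_map[OF _ hom] by blast
  then show "\<exists>T. \<forall>\<xi>. \<xi> \<noteq> 0 \<longrightarrow> V \<xi> = contraction (m - k - 1) T \<xi>"
    unfolding d_def[symmetric] U_def by metis
qed

section \<open>Inner derivatives and potentials\<close>

lemma symmetric_on_imp_symmetric_tensor_field:
  fixes u :: "('n::finite, 'a::zero) tensor_field"
  assumes "symmetric_on r u" "\<And>is. length is \<noteq> r \<Longrightarrow> u is = (\<lambda>x. 0)"
  shows "symmetric_tensor_field r u"
  unfolding symmetric_tensor_field_def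
proof (intro conjI allI impI)
  fix "is" :: "'n list" and \<pi> assume "length is = r \<and> \<pi> permutes {..<r}"
  then show "u (permute_list \<pi> is) = u is"
    by (intro symmetric_onD[OF assms(1), symmetric]) auto
qed (rule assms(2))

lemma smooth_symmetrization:
  assumes "\<And>js. smooth (\<lambda>x. F js x)"
  shows "smooth (\<lambda>x. symmetrization (\<lambda>js. F js x) is)"
  unfolding symmetrization_def scaleR_sum_right
  by (intro smooth_linear_combination assms finite_permutations) simp

lemma partial_derivative_zero [simp]: "partial_derivative i (\<lambda>x. 0) = (\<lambda>x. 0)"
  by (rule ext) (rule has_derivative_partial_derivative[OF has_derivative_const])

lemma smooth_zero: "smooth (\<lambda>x. 0)"
  using smooth_linear_combination[of "{}"] by simp

lemma symmetrization_cong: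
  assumes "\<And>js. length js = length is \<Longrightarrow> F js = G js"
  shows "symmetrization F is = symmetrization G is"
  unfolding symmetrization_def using assms by (intro arg_cong2[of _ _ _ _ scaleR] sum.cong) auto

lemma inner_derivative_smooth_symmetric:
  fixes u :: "('n::finite, 'a::real_normed_vector) tensor_field"
  assumes u: "smooth_symmetric_tensor_field r u"
  shows "smooth_symmetric_tensor_field (Suc r) (inner_derivative u)"
  unfolding smooth_symmetric_tensor_field_def
proof (intro conjI allI)
  have u0: "u is = (\<lambda>x. 0)" if "length is \<noteq> r" for "is"
    using u that by (auto simp: smooth_symmetric_tensor_field_def symmetric_tensor_field_def)
  have smooth: "smooth (u is)" for "is" using u by (simp add: smooth_symmetric_tensor_field_def)
  define S where "S js x = partial_derivative (last js) (u (butlast js)) x" for js x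
  have eq: "inner_derivative u is = (\<lambda>x. symmetrization (\<lambda>js. S js x) is)" if "is \<noteq> []" for "is"
    using that by (simp add: inner_derivative_def S_def fun_eq_iff)
  show "symmetric_tensor_field (Suc r) (inner_derivative u)"
  proof (rule symmetric_on_imp_symmetric_tensor_field)
    show "symmetric_on (Suc r) (inner_derivative u)"
      unfolding symmetric_on_def
    proof (intro allI impI)
      fix "is" js :: "'n list" assume len: "length is = Suc r" and mset: "mset is = mset js"
      then have ne: "is \<noteq> []" "js \<noteq> []" by auto
      show "inner_derivative u is = inner_derivative u js"
        unfolding eq[OF ne(1)] eq[OF ne(2)] by (intro ext symmetric_onD[OF symmetric_on_symmetrization refl mset])
    qed
    fix "is" :: "'n list" assume len: "length is \<noteq> Suc r"
    show "inner_derivative u is = (\<lambda>x. 0)"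
    proof (cases "is = []")
      case False
      have "S js x = 0" if "length js = length is" for js x
        using u0[of "butlast js"] that len False by (cases "length is") (auto simp: S_def)
      then have "symmetrization (\<lambda>js. S js x) is = symmetrization (\<lambda>js. 0) is" for x
        by (intro symmetrization_cong) auto
      then show ?thesis unfolding eq[OF False] by (simp add: symmetrization_def)
    qed (simp add: inner_derivative_def fun_eq_iff)
  qed
  show "smooth (inner_derivative u is)" for "is"
  proof (cases "is = []")
    case True
    then have "inner_derivative u is = (\<lambda>x. 0)" by (simp add: inner_derivative_def fun_eq_iff)
    then show ?thesis by (simp add: smooth_zero)
  next
    case False
    show ?thesis
      unfolding eq[OF False] S_def by (intro smooth_symmetrization smooth_partial_derivative smooth)
  qed
qed

text \<open>
  The symmetrization disappears in the contraction, and the new index becomes a derivative along \<open>\<xi>\<close>.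
\<close>

lemma contraction_inner_derivative:
  fixes u :: "('n::finite, 'a::real_normed_vector) tensor_field"
  assumes u: "\<And>is. smooth (u is)"
  shows "contraction (Suc r) (\<lambda>is. inner_derivative u is x) \<xi> =
    directional_derivative \<xi> (\<lambda>x. contraction r (\<lambda>is. u is x) \<xi>) x"
proof -
  have "contraction (Suc r) (\<lambda>is. inner_derivative u is x) \<xi> =
      contraction (Suc r) (symmetrization (\<lambda>js. partial_derivative (last js) (u (butlast js)) x)) \<xi>"
    by (intro contraction_cong) (auto simp: inner_derivative_def)
  also have "\<dots> = contraction r (\<lambda>is. \<Sum>i\<in>UNIV. \<xi> $ i *\<^sub>R partial_derivative i (u is) x) \<xi>"
    by (simp add: contraction_symmetrization contraction_Suc_last)
  also have "\<dots> = directional_derivative \<xi> (\<lambda>x. contraction r (\<lambda>is. u is x) \<xi>) x"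
    using directional_derivatives_contraction[of r u 1 \<xi> \<xi>] u
    by (simp add: directional_derivative_def)
  finally show ?thesis .
qed

lemma inner_derivatives_smooth_symmetric:
  assumes "smooth_symmetric_tensor_field r u"
  shows "smooth_symmetric_tensor_field (r + l) ((inner_derivative ^^ l) u)"
  using assms by (induction l) (auto intro: inner_derivative_smooth_symmetric)

lemma contraction_inner_derivatives:
  fixes u :: "('n::finite, 'a::real_normed_vector) tensor_field"
  assumes u: "smooth_symmetric_tensor_field r u"
  shows "(\<lambda>x. contraction (r + l) (\<lambda>is. (inner_derivative ^^ l) u is x) \<xi>) =
    (directional_derivative \<xi> ^^ l) (\<lambda>x. contraction r (\<lambda>is. u is x) \<xi>)"
proof (induction l)
  case (Suc l)
  have "smooth ((inner_derivative ^^ l) u is)" for "is"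
    using inner_derivatives_smooth_symmetric[OF u, of l] by (simp add: smooth_symmetric_tensor_field_def)
  from contraction_inner_derivative[where u = "(inner_derivative ^^ l) u" and r = "r + l" and \<xi> = \<xi>, OF this] show ?case
    by (simp add: Suc[symmetric])
qed simp

lemma smooth_contraction_field:
  "smooth_symmetric_tensor_field r u \<Longrightarrow> smooth (\<lambda>x. contraction r (\<lambda>is. u is x) \<xi>)"
  by (intro smooth_contraction) (simp add: smooth_symmetric_tensor_field_def)

text \<open>
  The derivative is dominated by that of \<open>- C / (1 + t)\<^bsup>M+1\<^esup>\<close>, and the value at infinity is \<open>0\<close>.
\<close>

lemma rapid_decay_half_line:
  fixes G g :: "real \<Rightarrow> 'a::real_normed_vector"
  assumes G: "\<And>t. (G has_vector_derivative g t) (at t)" and lim: "(G \<longlongrightarrow> 0) at_top"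
    and g: "\<And>t. 0 \<le> t \<Longrightarrow> norm (g t) \<le> C / (1 + \<bar>t\<bar>) ^ (M + 2)" and C: "0 \<le> C" and t: "0 \<le> t"
  shows "norm (G t) \<le> C / (1 + \<bar>t\<bar>) ^ M"
proof -
  define p where "p s = - (C * inverse ((1 + s) ^ Suc M))" for s :: real
  have p: "(p has_vector_derivative C * (real (Suc M) * (1 + s) ^ M / ((1 + s) ^ Suc M)\<^sup>2)) (at s)" if s: "0 \<le> s" for s
  proof -
    have "((\<lambda>s. (1 + s) ^ Suc M) has_real_derivative real (Suc M) * (1 + s) ^ M) (at s)"
      by (auto intro!: derivative_eq_intros simp del: power_Suc)
    from DERIV_inverse_fun[OF this] s
    have "((\<lambda>s. inverse ((1 + s) ^ Suc M)) has_real_derivative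
        - (real (Suc M) * (1 + s) ^ M * inverse (((1 + s) ^ Suc M) ^ Suc (Suc 0)))) (at s)"
      by (simp add: add_nonneg_eq_0_iff del: power_Suc)
    from DERIV_minus[OF DERIV_cmult[OF this, of C]] show ?thesis
      unfolding p_def[abs_def] has_real_derivative_iff_has_vector_derivative[symmetric]
      by (simp add: divide_inverse numeral_2_eq_2 mult_ac del: power_Suc)
  qed
  have pointwise: "norm (g s) \<le> C * (real (Suc M) * (1 + s) ^ M / ((1 + s) ^ Suc M)\<^sup>2)" if s: "0 \<le> s" for s
  proof -
    define u where "u = 1 + s"
    have u: "0 < u" using s by (simp add: u_def)
    have "norm (g s) \<le> C / u ^ (M + 2)" using g[OF s] s by (simp add: u_def)
    also have "\<dots> \<le> real (Suc M) * (C / u ^ (M + 2))"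
      using C u mult_right_mono[of 1 "real (Suc M)" "C / u ^ (M + 2)"] by simp
    also have "\<dots> = C * (real (Suc M) * u ^ M / (u ^ Suc M)\<^sup>2)"
      using u by (simp add: power_add power2_eq_square field_simps)
    finally show ?thesis by (simp add: u_def)
  qed
  have bound: "norm (G b - G t) \<le> C / (1 + t) ^ M" if b: "t < b" for b
  proof -
    have "norm (G b - G t) \<le> p b - p t"
    proof (rule differentiable_bound_general[OF b])
      show "continuous_on {t..b} G"
        using G by (intro continuous_at_imp_continuous_on ballI has_vector_derivative_continuous)
      show "continuous_on {t..b} p"
      proof (intro continuous_at_imp_continuous_on ballI)
        fix s assume "s \<in> {t..b}"
        then show "isCont p s" using t by (intro has_vector_derivative_continuous[OF p]) simp
      qed
      show "(G has_vector_derivative g s) (at s)" for s by (rule G)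
      fix s assume s: "t < s" "s < b"
      then show "(p has_vector_derivative C * (real (Suc M) * (1 + s) ^ M / ((1 + s) ^ Suc M)\<^sup>2)) (at s)"
        "norm (g s) \<le> C * (real (Suc M) * (1 + s) ^ M / ((1 + s) ^ Suc M)\<^sup>2)"
        using p[of s] pointwise[of s] t by auto
    qed
    also have "\<dots> \<le> C * inverse ((1 + t) ^ Suc M)"
      using b t C by (simp add: p_def)
    also have "\<dots> \<le> C * inverse ((1 + t) ^ M)"
      using t C by (intro mult_left_mono le_imp_inverse_le) (auto intro: mult_right_mono[of 1, simplified])
    finally show ?thesis by (simp add: divide_inverse)
  qed
  have "((\<lambda>b. norm (G b - G t)) \<longlongrightarrow> norm (0 - G t)) at_top"
    by (intro tendsto_intros lim)
  then have "norm (0 - G t) \<le> C / (1 + t) ^ M"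
    by (rule tendsto_upperbound) (auto intro!: eventually_mono[OF eventually_gt_at_top[of t]] bound)
  then show ?thesis using t by simp
qed

definition rapidly_decreasing :: "(real \<Rightarrow> 'a::real_normed_vector) \<Rightarrow> bool" where
  "rapidly_decreasing g \<longleftrightarrow> (\<forall>M. \<exists>C. \<forall>t. norm (g t) \<le> C / (1 + \<bar>t\<bar>) ^ M)"

lemma rapidly_decreasing_antiderivative:
  fixes G g :: "real \<Rightarrow> 'a::real_normed_vector"
  assumes G: "\<And>t. (G has_vector_derivative g t) (at t)" and lim: "(G \<longlongrightarrow> 0) at_top" "(G \<longlongrightarrow> 0) at_bot"
    and g: "rapidly_decreasing g"
  shows "rapidly_decreasing G"
  unfolding rapidly_decreasing_def
proof
  fix M
  obtain C where C: "\<And>t. norm (g t) \<le> C / (1 + \<bar>t\<bar>) ^ (M + 2)"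
    using g unfolding rapidly_decreasing_def by blast
  have C0: "0 \<le> C" using order_trans[OF norm_ge_zero C[of 0]] by simp
  have "norm (G t) \<le> C / (1 + \<bar>t\<bar>) ^ M" for t
  proof (cases "0 \<le> t")
    case True
    show ?thesis by (rule rapid_decay_half_line[OF G lim(1) C C0 True])
  next
    case False
    have "((\<lambda>t. G (- t)) has_vector_derivative - g (- t)) (at t)" for t
    proof -
      have "(uminus has_vector_derivative - 1) (at t)" by (auto intro!: derivative_eq_intros)
      from vector_diff_chain_at[OF this, of G "g (- t)"] G[of "- t"] show ?thesis by (simp add: o_def)
    qed
    moreover have "((\<lambda>t. G (- t)) \<longlongrightarrow> 0) at_top"
      using lim(2) by (simp add: filterlim_at_bot_mirror)
    moreover have "norm (- g (- s)) \<le> C / (1 + \<bar>s\<bar>) ^ (M + 2)" for s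
      using C[of "- s"] unfolding norm_minus_cancel abs_minus_cancel .
    ultimately have "norm (G (- (- t))) \<le> C / (1 + \<bar>- t\<bar>) ^ M"
      by (rule rapid_decay_half_line) (use C0 False in auto)
    then show ?thesis by simp
  qed
  then show "\<exists>C. \<forall>t. norm (G t) \<le> C / (1 + \<bar>t\<bar>) ^ M" by blast
qed

text \<open>
  Starting from the antiderivative \<open>F\<^sub>l\<close> of \<open>F\<^sub>l\<^sub>+\<^sub>1\<close>, integration by parts gives an antiderivative of
  \<open>t\<^sup>q F\<^sub>l\<^sub>+\<^sub>1\<close> that vanishes at both ends, as long as \<open>q \<le> l\<close>.
\<close>

lemma iterated_antiderivative_moment:
  fixes F :: "nat \<Rightarrow> real \<Rightarrow> 'a::euclidean_space"
  assumes F: "\<And>l t. l \<le> k \<Longrightarrow> (F l has_vector_derivative F (Suc l) t) (at t)"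
    and lim: "\<And>l. l \<le> k \<Longrightarrow> (F l \<longlongrightarrow> 0) at_top" "\<And>l. l \<le> k \<Longrightarrow> (F l \<longlongrightarrow> 0) at_bot"
    and rapid: "rapidly_decreasing (F (Suc k))" and cont: "continuous_on UNIV (F (Suc k))"
    and q: "q \<le> k"
  shows "(LINT t|lborel. t ^ q *\<^sub>R F (Suc k) t) = 0"
proof -
  have rapid': "rapidly_decreasing (F l)" if "l \<le> Suc k" for l
    using that
  proof (induction l rule: inc_induct)
    case (step l)
    then show ?case using rapidly_decreasing_antiderivative[OF F lim] by simp
  qed (rule rapid)
  have H: "\<exists>H. (\<forall>t. (H has_vector_derivative t ^ q *\<^sub>R F (Suc l) t) (at t)) \<and> (H \<longlongrightarrow> 0) at_top \<and> (H \<longlongrightarrow> 0) at_bot"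
    if "q \<le> l" "l \<le> k" for q l
    using that
  proof (induction q arbitrary: l)
    case 0
    then show ?case using F lim by (intro exI[of _ "F l"]) auto
  next
    case (Suc q)
    then obtain l' where l: "l = Suc l'" "q \<le> l'" "l' \<le> k" by (cases l) auto
    obtain H where H: "\<And>t. (H has_vector_derivative t ^ q *\<^sub>R F (Suc l') t) (at t)" "(H \<longlongrightarrow> 0) at_top" "(H \<longlongrightarrow> 0) at_bot"
      using Suc.IH[OF l(2,3)] by blast
    obtain C where C: "\<And>t. norm (F l t) \<le> C / (1 + \<bar>t\<bar>) ^ (Suc q + 1)"
      using rapid'[of l] Suc.prems unfolding rapidly_decreasing_def by (meson le_SucI)
    have C0: "0 \<le> C" using order_trans[OF norm_ge_zero C[of 0]] by simp
    have "norm (t ^ Suc q *\<^sub>R F l t) \<le> C / (1 + \<bar>t\<bar>)" for t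
    proof -
      have "norm (t ^ Suc q *\<^sub>R F l t) \<le> \<bar>t\<bar> ^ Suc q * (C / (1 + \<bar>t\<bar>) ^ (Suc q + 1))"
        unfolding norm_scaleR power_abs by (intro mult_left_mono C) auto
      also have "\<dots> \<le> C / (1 + \<bar>t\<bar>) ^ 1" by (rule power_div_power_bound[OF C0])
      finally show ?thesis by simp
    qed
    note tail = tendsto_zero_of_bound[OF this]
    define H' where "H' t = t ^ Suc q *\<^sub>R F l t - real (Suc q) *\<^sub>R H t" for t
    have "(H' has_vector_derivative t ^ Suc q *\<^sub>R F (Suc l) t) (at t)" for t
    proof -
      have "((\<lambda>t. t ^ Suc q) has_real_derivative real (Suc q) * t ^ q) (at t)"
        using DERIV_pow[of "Suc q" t] by (simp del: power_Suc)
      from has_vector_derivative_diff[OF has_vector_derivative_scaleR[OF this F[OF Suc.prems(2)]] has_vector_derivative_scale_const[OF H(1)], of "real (Suc q)"]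
      show ?thesis unfolding H'_def[abs_def] l(1) by (simp del: power_Suc of_nat_Suc)
    qed
    moreover have "(H' \<longlongrightarrow> 0) at_top" "(H' \<longlongrightarrow> 0) at_bot"
      unfolding H'_def[abs_def]
      using tendsto_diff[OF tail(1) tendsto_scaleR[OF tendsto_const H(2), of "real (Suc q)"]]
        tendsto_diff[OF tail(2) tendsto_scaleR[OF tendsto_const H(3), of "real (Suc q)"]] by simp_all
    ultimately show ?case by blast
  qed
  obtain H where H: "\<And>t. (H has_vector_derivative t ^ q *\<^sub>R F (Suc k) t) (at t)" "(H \<longlongrightarrow> 0) at_top" "(H \<longlongrightarrow> 0) at_bot"
    using H[OF q order_refl] by blast
  obtain C where C: "\<And>t. norm (F (Suc k) t) \<le> C / (1 + \<bar>t\<bar>) ^ (q + 2)"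
    using rapid unfolding rapidly_decreasing_def by meson
  have C0: "0 \<le> C" using order_trans[OF norm_ge_zero C[of 0]] by simp
  have "(LINT t|lborel. t ^ q *\<^sub>R F (Suc k) t) = 0 - 0"
  proof (rule FTC_whole_line[OF H(1) _ _ H(2,3)])
    show "continuous_on UNIV (\<lambda>t. t ^ q *\<^sub>R F (Suc k) t)" by (intro continuous_intros cont)
    then show "integrable lborel (\<lambda>t. t ^ q *\<^sub>R F (Suc k) t)"
    proof (rule integrable_continuous_bounded)
      fix t :: real
      have "norm (t ^ q *\<^sub>R F (Suc k) t) \<le> \<bar>t\<bar> ^ q * (C / (1 + \<bar>t\<bar>) ^ (q + 2))"
        unfolding norm_scaleR power_abs by (intro mult_left_mono C) auto
      also have "\<dots> \<le> C / (1 + \<bar>t\<bar>)\<^sup>2" by (rule power_div_power_bound[OF C0])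
      finally show "norm (t ^ q *\<^sub>R F (Suc k) t) \<le> C / (1 + \<bar>t\<bar>)\<^sup>2" .
    qed
  qed
  then show ?thesis by simp
qed

theorem potential_imp_moments_zero:
  fixes f v :: "('n::finite, 'a::euclidean_space) tensor_field"
  assumes f: "\<And>is. schwartz (f is)" and v: "smooth_symmetric_tensor_field d v"
    and fv: "f = (inner_derivative ^^ Suc k) v"
    and lim: "\<And>l is. l \<le> k \<Longrightarrow> ((inner_derivative ^^ l) v is \<longlongrightarrow> 0) at_infinity"
    and q: "q \<le> k" and \<xi>: "\<xi> \<noteq> 0"
  shows "moment UNIV q (\<lambda>y. contraction (d + Suc k) (\<lambda>is. f is y) \<xi>) \<xi> x = 0"
proof -
  define P where "P l = (\<lambda>y. contraction (d + l) (\<lambda>is. (inner_derivative ^^ l) v is y) \<xi>)" for l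
  have P_step: "P (Suc l) = directional_derivative \<xi> (P l)" for l
    unfolding P_def contraction_inner_derivatives[OF v] by simp
  have P_smooth: "smooth (P l)" for l
    unfolding P_def by (intro smooth_contraction_field inner_derivatives_smooth_symmetric v)
  have P_top: "P (Suc k) = (\<lambda>y. contraction (d + Suc k) (\<lambda>is. f is y) \<xi>)" by (simp only: P_def fv)
  have sch: "schwartz (P (Suc k))" unfolding P_top by (intro schwartz_contraction f)
  have P_lim: "(P l \<longlongrightarrow> 0) at_infinity" if "l \<le> k" for l
  proof -
    have "(P l \<longlongrightarrow> (\<Sum>is | length is = d + l. monomial \<xi> is *\<^sub>R 0)) at_infinity"
      unfolding P_def contraction_def by (intro tendsto_sum tendsto_scaleR tendsto_const lim that)
    then show ?thesis by simp
  qed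
  have line: "filterlim (\<lambda>t. x + t *\<^sub>R \<xi>) at_infinity F" if "filterlim (\<lambda>t::real. t) at_infinity F" for F
  proof -
    have "filterlim (\<lambda>t. t *\<^sub>R \<xi>) at_infinity F"
      unfolding filterlim_at_infinity_conv_norm_at_top norm_scaleR
      using that \<xi> by (intro filterlim_at_top_mult_tendsto_pos[OF tendsto_const])
        (auto simp: filterlim_at_infinity_conv_norm_at_top)
    then show ?thesis by (rule tendsto_add_filterlim_at_infinity[OF tendsto_const])
  qed
  have inf: "filterlim (\<lambda>t::real. t) at_infinity at_top" "filterlim (\<lambda>t::real. t) at_infinity at_bot"
    using at_top_le_at_infinity at_bot_le_at_infinity by (auto simp: filterlim_def)
  have "(LINT t|lborel. t ^ q *\<^sub>R P (Suc k) (x + t *\<^sub>R \<xi>)) = 0"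
  proof (rule iterated_antiderivative_moment[where F = "\<lambda>l t. P l (x + t *\<^sub>R \<xi>)" and k = k])
    show "((\<lambda>t. P l (x + t *\<^sub>R \<xi>)) has_vector_derivative P (Suc l) (x + t *\<^sub>R \<xi>)) (at t)" for l t
      unfolding P_step by (rule smooth_has_vector_derivative_line[OF P_smooth])
    show "((\<lambda>t. P l (x + t *\<^sub>R \<xi>)) \<longlongrightarrow> 0) at_top" "((\<lambda>t. P l (x + t *\<^sub>R \<xi>)) \<longlongrightarrow> 0) at_bot" if "l \<le> k" for l
      by (rule filterlim_compose[OF P_lim[OF that] line[OF inf(1)]] filterlim_compose[OF P_lim[OF that] line[OF inf(2)]])+
    show "rapidly_decreasing (\<lambda>t. P (Suc k) (x + t *\<^sub>R \<xi>))"
      unfolding rapidly_decreasing_def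
    proof
      fix M
      obtain C where "\<And>t. norm (t ^ 0 *\<^sub>R P (Suc k) (x + t *\<^sub>R \<xi>)) \<le> C / (1 + \<bar>t\<bar>) ^ M"
        using schwartz_line_bound[OF sch \<xi>, of 0 x M] by blast
      then show "\<exists>C. \<forall>t. norm (P (Suc k) (x + t *\<^sub>R \<xi>)) \<le> C / (1 + \<bar>t\<bar>) ^ M" by auto
    qed
    show "continuous_on UNIV (\<lambda>t. P (Suc k) (x + t *\<^sub>R \<xi>))" by (rule continuous_on_line[OF P_smooth])
  qed (rule q)
  then show ?thesis by (simp add: moment_UNIV P_top)
qed

text \<open>
  The potential is the symmetric field whose contraction with \<open>\<xi> \<noteq> 0\<close> is \<open>c V(x, \<xi>)\<close>, where \<open>V\<close> is the
  half-line moment of order \<open>k\<close> and \<open>c = (-1)\<^bsup>k+1\<^esup> / k!\<close>.  Smoothness and decay hold for the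
  contractions and pass to the components by polarization.  The contraction with \<open>\<xi> = 0\<close> is treated
  apart: it is zero, unless the potential has rank \<open>0\<close> and its contraction does not depend on \<open>\<xi>\<close>.
\<close>

theorem saint_venant_zero_imp_potential:
  fixes f :: "('n::finite, 'a::euclidean_space) tensor_field"
  assumes f: "schwartz_symmetric_tensor_field m f" and k: "k < m" and card: "2 \<le> CARD('n)"
    and zero: "\<And>\<eta> \<xi> x. saint_venant_form m k f \<eta> \<xi> x = 0"
  shows "\<exists>v. smooth_symmetric_tensor_field (m - k - 1) v \<and> f = (inner_derivative ^^ (k + 1)) v \<and>
    (\<forall>l\<le>k. \<forall>is. ((inner_derivative ^^ l) v is \<longlongrightarrow> 0) at_infinity)"
proof -
  define d where "d = m - k - 1"
  have m: "m = d + Suc k" using k by (simp add: d_def)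
  have sch: "schwartz (f is)" for "is" using f by (simp add: schwartz_symmetric_tensor_field_def)
  have sym: "symmetric_on m f"
    using f by (simp add: schwartz_symmetric_tensor_field_def symmetric_tensor_field_imp_symmetric_on)
  define P where "P \<xi> = (\<lambda>y. contraction m (\<lambda>is. f is y) \<xi>)" for \<xi>
  have P: "schwartz (P \<xi>)" for \<xi> unfolding P_def by (intro schwartz_contraction sch)
  note half = half_line_moment_homogeneous_polynomial[OF sch sym k card zero, folded P_def d_def]
  obtain T where T: "\<And>x \<xi>. \<xi> \<noteq> 0 \<Longrightarrow> moment {0..} k (P \<xi>) \<xi> x = contraction d (T x) \<xi>"
    using half(2) by metis
  define c where "c = (- 1) ^ Suc k / falling k k"
  define v where "v is x = (if length is = d then c *\<^sub>R symmetrization (T x) is else 0)" for "is" x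
  have v_contraction: "(\<lambda>x. contraction d (\<lambda>is. v is x) \<xi>) = (\<lambda>x. c *\<^sub>R moment {0..} k (P \<xi>) \<xi> x)" if "\<xi> \<noteq> 0" for \<xi>
  proof
    fix x
    have "contraction d (\<lambda>is. v is x) \<xi> = contraction d (\<lambda>is. c *\<^sub>R symmetrization (T x) is) \<xi>"
      by (intro contraction_cong) (auto simp: v_def)
    then show "contraction d (\<lambda>is. v is x) \<xi> = c *\<^sub>R moment {0..} k (P \<xi>) \<xi> x"
      by (simp add: contraction_scaleR_fun contraction_symmetrization T[OF that])
  qed
  have v_sym: "symmetric_on d v"
    unfolding symmetric_on_def
  proof (intro allI impI ext)
    fix "is" js :: "'n list" and x assume len: "length is = d" and mset: "mset is = mset js"
    show "v is x = v js x"
      using len mset_eq_length[OF mset] symmetric_onD[OF symmetric_on_symmetrization refl mset, of "T x"] by (simp add: v_def)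
  qed
  have v_tensor: "symmetric_tensor_field d v"
    by (rule symmetric_on_imp_symmetric_tensor_field[OF v_sym]) (simp add: v_def fun_eq_iff)
  obtain i :: 'n where True by simp
  define e where "e = (axis i 1 :: real ^ 'n)"
  have e: "e \<noteq> 0" by (simp add: e_def axis_eq_0_iff)
  have zero_vector: "(\<lambda>x. contraction r (\<lambda>is. u is x) 0) = (if r = 0 then (\<lambda>x. contraction r (\<lambda>is. u is x) e) else (\<lambda>x. 0))"
    for r and u :: "('n, 'a) tensor_field"
    by (simp add: contraction_zero_vector)
  have smooth_half: "smooth (\<lambda>x. c *\<^sub>R moment {0..} k (P \<xi>) \<xi> x)" if "\<xi> \<noteq> 0" for \<xi>
    using smooth_linear_combination[of "{0::nat}" "\<lambda>_. moment {0..} k (P \<xi>) \<xi>" "\<lambda>_. c"]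
      smooth_moment[OF P that] by simp
  have v_smooth: "smooth (v is)" for "is"
  proof (cases "length is = d")
    case True
    show ?thesis
    proof (rule polarization[where S = smooth, OF _ _ smooth_zero v_sym _ True])
      show "smooth (\<lambda>x. g x + h x)" if "smooth g" "smooth h" for g h :: "real ^ 'n \<Rightarrow> 'a"
        using smooth_linear_combination[of "{0, 1::nat}" "\<lambda>j. if j = 0 then g else h" "\<lambda>_. 1"] that by simp
      show "smooth (\<lambda>x. r *\<^sub>R g x)" if "smooth g" for r and g :: "real ^ 'n \<Rightarrow> 'a"
        using smooth_linear_combination[of "{0::nat}" "\<lambda>j. g" "\<lambda>_. r"] that by simp
      show "smooth (\<lambda>x. contraction d (\<lambda>is. v is x) \<xi>)" for \<xi>
      proof (cases "\<xi> = 0")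
        case False
        show ?thesis unfolding v_contraction[OF False] by (rule smooth_half[OF False])
      next
        case True
        show ?thesis
          unfolding True zero_vector[of d v] v_contraction[OF e] using smooth_half[OF e] smooth_zero by auto
      qed
    qed
  next
    case False
    then have "v is = (\<lambda>x. 0)" by (simp add: v_def fun_eq_iff)
    then show ?thesis by (simp add: smooth_zero)
  qed
  have v: "smooth_symmetric_tensor_field d v"
    using v_tensor v_smooth by (simp add: smooth_symmetric_tensor_field_def)
  have deriv: "(\<lambda>x. contraction (d + l) (\<lambda>is. (inner_derivative ^^ l) v is x) \<xi>) =
      (\<lambda>x. (c * ((- 1) ^ l * falling k l)) *\<^sub>R moment {0..} (k - l) (P \<xi>) \<xi> x)" if \<xi>: "\<xi> \<noteq> 0" and l: "l \<le> k" for \<xi> l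
  proof -
    have "(\<lambda>x. contraction (d + l) (\<lambda>is. (inner_derivative ^^ l) v is x) \<xi>) =
        (directional_derivative \<xi> ^^ l) (\<lambda>x. \<Sum>j\<in>{0::nat}. c *\<^sub>R moment {0..} k (P \<xi>) \<xi> x)"
      unfolding contraction_inner_derivatives[OF v] v_contraction[OF \<xi>] by simp
    also have "\<dots> = (\<lambda>x. c *\<^sub>R moment {0..} k ((directional_derivative \<xi> ^^ l) (P \<xi>)) \<xi> x)"
      by (subst directional_derivatives_linear_combination)
        (auto intro: smooth_moment P \<xi> simp: directional_derivatives_moment P \<xi>)
    also have "\<dots> = (\<lambda>x. (c * ((- 1) ^ l * falling k l)) *\<^sub>R moment {0..} (k - l) (P \<xi>) \<xi> x)"
      using l by (subst moment_directional_derivatives[OF P \<xi>]) auto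
    finally show ?thesis .
  qed
  have top: "contraction m (\<lambda>is. (inner_derivative ^^ Suc k) v is x) \<xi> = contraction m (\<lambda>is. f is x) \<xi>" for x \<xi>
  proof (cases "\<xi> = 0")
    case True
    then show ?thesis using k by (simp add: contraction_zero_vector)
  next
    case False
    have ck: "c * ((- 1) ^ k * falling k k) = - 1"
      using falling_nonzero[of k k] by (simp add: c_def flip: power_add)
    have "contraction m (\<lambda>is. (inner_derivative ^^ Suc k) v is x) \<xi> =
        directional_derivative \<xi> (\<lambda>x. contraction (d + k) (\<lambda>is. (inner_derivative ^^ k) v is x) \<xi>) x"
      using inner_derivatives_smooth_symmetric[OF v, of k] contraction_inner_derivative[of "(inner_derivative ^^ k) v" "d + k" x \<xi>]
      by (simp add: m smooth_symmetric_tensor_field_def)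
    also have "(\<lambda>x. contraction (d + k) (\<lambda>is. (inner_derivative ^^ k) v is x) \<xi>) =
        (\<lambda>x. \<Sum>j\<in>{0::nat}. (- 1) *\<^sub>R moment {0..} 0 (P \<xi>) \<xi> x)"
      unfolding deriv[OF False order_refl] ck by simp
    also have "directional_derivative \<xi> \<dots> x = - moment {0..} 0 (directional_derivative \<xi> (P \<xi>)) \<xi> x"
      by (subst directional_derivative_linear_combination)
        (auto intro: smooth_moment P False simp: directional_derivative_moment P False)
    also have "\<dots> = P \<xi> x"
      using moment_half_line_directional_derivative[OF P False, where q = 0 and x = x] by simp
    finally show ?thesis by (simp add: P_def)
  qed
  have f_eq: "f = (inner_derivative ^^ Suc k) v"
  proof (intro ext)
    fix "is" :: "'n list" and x
    have dv: "symmetric_tensor_field m ((inner_derivative ^^ Suc k) v)"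
      using inner_derivatives_smooth_symmetric[OF v, of "Suc k"] by (simp add: m smooth_symmetric_tensor_field_def)
    show "f is x = (inner_derivative ^^ Suc k) v is x"
    proof (cases "length is = m")
      case True
      have "f is x - (inner_derivative ^^ Suc k) v is x = 0"
      proof (rule contraction_eq_zero[where T = "\<lambda>is. f is x - (inner_derivative ^^ Suc k) v is x", OF _ _ True])
        show "symmetric_on m (\<lambda>is. f is x - (inner_derivative ^^ Suc k) v is x)"
          using sym symmetric_tensor_field_imp_symmetric_on[OF dv] unfolding symmetric_on_def by metis
        show "contraction m (\<lambda>is. f is x - (inner_derivative ^^ Suc k) v is x) \<xi> = 0" for \<xi>
          using contraction_add_fun[of m "\<lambda>is. f is x" "\<lambda>is. (- 1) *\<^sub>R (inner_derivative ^^ Suc k) v is x" \<xi>]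
          by (simp only: contraction_scaleR_fun top) simp
      qed
      then show ?thesis by simp
    next
      case False
      then show ?thesis
        using f dv by (simp add: schwartz_symmetric_tensor_field_def symmetric_tensor_field_def del: funpow.simps)
    qed
  qed
  have lim: "((inner_derivative ^^ l) v is \<longlongrightarrow> 0) at_infinity" if l: "l \<le> k" for l "is"
  proof -
    have dv: "symmetric_tensor_field (d + l) ((inner_derivative ^^ l) v)"
      using inner_derivatives_smooth_symmetric[OF v, of l] by (simp add: smooth_symmetric_tensor_field_def)
    have nonzero: "((\<lambda>x. contraction (d + l) (\<lambda>is. (inner_derivative ^^ l) v is x) \<xi>) \<longlongrightarrow> 0) at_infinity" if \<xi>: "\<xi> \<noteq> 0" for \<xi>
    proof -
      have "moment UNIV (k - l) (P \<xi>) \<xi> x = 0" for x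
        by (rule moment_UNIV_eq_zero_mono[OF P \<xi> half(1)[OF \<xi>]]) simp
      from tendsto_scaleR[OF tendsto_const moment_half_line_tendsto_zero[OF P \<xi> this]] show ?thesis
        unfolding deriv[OF \<xi> l] by simp
    qed
    show ?thesis
    proof (cases "length is = d + l")
      case True
      show ?thesis
      proof (rule polarization[where S = "\<lambda>g. (g \<longlongrightarrow> 0) at_infinity", OF _ _ tendsto_const symmetric_tensor_field_imp_symmetric_on[OF dv] _ True])
        show "((\<lambda>x. g x + h x) \<longlongrightarrow> 0) at_infinity" if "(g \<longlongrightarrow> 0) at_infinity" "(h \<longlongrightarrow> 0) at_infinity" for g h :: "real ^ 'n \<Rightarrow> 'a"
          using tendsto_add[OF that] by simp
        show "((\<lambda>x. r *\<^sub>R g x) \<longlongrightarrow> 0) at_infinity" if "(g \<longlongrightarrow> 0) at_infinity" for r and g :: "real ^ 'n \<Rightarrow> 'a"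
          using tendsto_scaleR[OF tendsto_const that, of r] by simp
        show "((\<lambda>x. contraction (d + l) (\<lambda>is. (inner_derivative ^^ l) v is x) \<xi>) \<longlongrightarrow> 0) at_infinity" for \<xi>
        proof (cases "\<xi> = 0")
          case True
          show ?thesis unfolding True zero_vector[of "d + l"] using nonzero[OF e] by auto
        qed (rule nonzero)
      qed
    next
      case False
      then have "(inner_derivative ^^ l) v is = (\<lambda>x. 0)" using dv by (simp add: symmetric_tensor_field_def)
      then show ?thesis by simp
    qed
  qed
  show ?thesis
    unfolding d_def[symmetric] using v f_eq lim by (intro exI[of _ v]) (simp del: funpow.simps)
qed

section \<open>Vanishing moments on the sphere bundle\<close>

lemma moment_transform_eq_moment: "moment_transform m q f x \<xi> = moment UNIV q (\<lambda>y. contraction m (\<lambda>is. f is y) \<xi>) \<xi> x"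
  by (simp add: moment_transform_def moment_UNIV contraction_def monomial_def)

text \<open>
  A line is parametrized by any of its points and any of its direction vectors: a shift of the parameter
  mixes a moment with those of lower order, and a change of the length of \<open>\<xi>\<close> multiplies it by a
  constant.
\<close>

lemma moment_transforms_zero_iff:
  fixes f :: "('n::finite, 'a::euclidean_space) tensor_field"
  assumes f: "\<And>is. schwartz (f is)"
  shows "(\<forall>q\<le>k. \<forall>(x, \<xi>)\<in>sphere_tangent_bundle. moment_transform m q f x \<xi> = 0) \<longleftrightarrow>
    (\<forall>q\<le>k. \<forall>\<xi> x. \<xi> \<noteq> 0 \<longrightarrow> moment UNIV q (\<lambda>y. contraction m (\<lambda>is. f is y) \<xi>) \<xi> x = 0)" (is "?L \<longleftrightarrow> ?R")
proof
  have sch: "schwartz (\<lambda>y. contraction m (\<lambda>is. f is y) \<xi>)" for \<xi> by (intro schwartz_contraction f)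
  assume L: ?L
  show ?R
  proof (intro allI impI)
    fix q and \<xi> x :: "real ^ 'n" assume q: "q \<le> k" and \<xi>: "\<xi> \<noteq> 0"
    define c where "c = norm \<xi>"
    define \<omega> where "\<omega> = (1 / c) *\<^sub>R \<xi>"
    have c: "0 < c" using \<xi> by (simp add: c_def)
    have \<omega>: "norm \<omega> = 1" "\<xi> = c *\<^sub>R \<omega>" "\<omega> \<noteq> 0" using c \<xi> by (auto simp: \<omega>_def c_def)
    define a where "a = x \<bullet> \<omega>"
    define y where "y = x - a *\<^sub>R \<omega>"
    have "\<omega> \<bullet> \<omega> = 1" using \<omega>(1) by (simp add: norm_eq_1)
    then have "y \<bullet> \<omega> = 0" by (simp add: y_def a_def inner_diff_left)
    then have "(y, \<omega>) \<in> sphere_tangent_bundle" using \<omega>(1) by (simp add: sphere_tangent_bundle_def)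
    then have "moment UNIV i (\<lambda>y. contraction m (\<lambda>is. f is y) \<omega>) \<omega> y = 0" if "i \<le> k" for i
      using L that unfolding moment_transform_eq_moment by blast
    then have "moment UNIV q (\<lambda>y. contraction m (\<lambda>is. f is y) \<omega>) \<omega> (y + a *\<^sub>R \<omega>) = 0"
      using q by (subst moment_UNIV_translate[OF sch \<omega>(3)]) auto
    then have "moment UNIV q (\<lambda>y. contraction m (\<lambda>is. f is y) \<omega>) \<omega> x = 0" by (simp add: y_def)
    then have "moment UNIV q (\<lambda>y. contraction m (\<lambda>is. f is y) \<omega>) \<xi> x = 0"
      using moment_scale[OF c, of UNIV q "\<lambda>y. contraction m (\<lambda>is. f is y) \<omega>" \<omega> x] c by (simp add: \<omega>(2))
    then show "moment UNIV q (\<lambda>y. contraction m (\<lambda>is. f is y) \<xi>) \<xi> x = 0"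
      by (subst \<omega>(2)) (simp add: contraction_scaleR moment_scaleR)
  qed
next
  assume R: ?R
  show ?L
  proof (intro allI impI ballI, clarify)
    fix q and x \<xi> :: "real ^ 'n" assume "q \<le> k" "(x, \<xi>) \<in> sphere_tangent_bundle"
    moreover from this have "\<xi> \<noteq> 0" by (auto simp: sphere_tangent_bundle_def)
    ultimately show "moment_transform m q f x \<xi> = 0" using R by (simp add: moment_transform_eq_moment)
  qed
qed

theorem theorem3p2:
  fixes f :: "('n::finite, 'a::{real_normed_field, euclidean_space}) tensor_field"
    and m k :: nat
  assumes "0 < m" and "1 \<le> k" and "k \<le> min m (CARD('n) - 1)"
    and "schwartz_symmetric_tensor_field m f"
  defines "cond1 \<equiv> (\<forall>q\<le>k. \<forall>(x, \<xi>)\<in>sphere_tangent_bundle. moment_transform m q f x \<xi> = 0)"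
    and "cond2 \<equiv>
      (if k = m then f = (\<lambda>is x. 0)
       else \<exists>v. smooth_symmetric_tensor_field (m - k - 1) v \<and>
              f = (inner_derivative ^^ (k + 1)) v \<and>
              (\<forall>l\<le>k. \<forall>is. ((inner_derivative ^^ l) v is \<longlongrightarrow> 0) at_infinity))"
    and "cond3 \<equiv>
      (\<forall>ps qs is x. length ps = m - k \<and> length qs = m - k \<and> length is = k \<longrightarrow>
         saint_venant m k f ps qs is x = 0)"
  shows "(cond1 \<longleftrightarrow> cond2) \<and> (cond2 \<longleftrightarrow> cond3)"
proof -
  have km: "k \<le> m" and card: "2 \<le> CARD('n)" using assms(1-3) by auto
  have f: "schwartz (f is)" for "is" using assms(4) by (simp add: schwartz_symmetric_tensor_field_def)
  have tensor: "symmetric_tensor_field m f" using assms(4) by (simp add: schwartz_symmetric_tensor_field_def)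
  note sym = symmetric_tensor_field_imp_symmetric_on[OF tensor]
  note cond1 = moment_transforms_zero_iff[where f = f and k = k and m = m, OF f, folded cond1_def]
  have "cond3" if cond1
    unfolding cond3_def
  proof (intro allI impI)
    fix ps qs "is" :: "'n list" and x
    assume "length ps = m - k \<and> length qs = m - k \<and> length is = k"
    then show "saint_venant m k f ps qs is x = 0"
      using that cond1
      by (intro saint_venant_eq_zero[OF km] saint_venant_form_eq_zero[OF f sym km assms(1) card]) auto
  qed
  moreover have "cond2" if cond3
  proof -
    have form: "saint_venant_form m k f \<eta> \<xi> x = 0" for \<eta> \<xi> x
    proof -
      have "saint_venant_form m k f \<eta> \<xi> x = contraction m (\<lambda>r. contraction (m - k) (\<lambda>ps. 0) \<eta>) \<xi>"
        unfolding saint_venant_form_def using that km by (intro contraction_cong refl) (simp add: cond3_def)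
      then show ?thesis by simp
    qed
    show ?thesis
    proof (cases "k = m")
      case True
      have "contraction m (\<lambda>is. f is x) \<xi> = 0" for x \<xi>
        using form[of 0 \<xi> x] saint_venant_form_eq[OF km schwartz_smooth[OF f] sym, of 0 \<xi> x] True
        by (simp add: mixed_contraction_def)
      moreover have "symmetric_on m (\<lambda>is. f is x)" for x
        using sym unfolding symmetric_on_def by metis
      ultimately have "f is x = 0" if "length is = m" for "is" x
        using contraction_eq_zero[of m "\<lambda>is. f is x"] that by blast
      then have "f = (\<lambda>is x. 0)"
        using tensor unfolding symmetric_tensor_field_def by (metis ext)
      with True show ?thesis by (simp add: cond2_def)
    next
      case False
      then show ?thesis
        using saint_venant_zero_imp_potential[OF assms(4) _ card form] km by (simp add: cond2_def)
    qed
  qed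
  moreover have "cond1" if cond2
  proof (cases "k = m")
    case True
    then have "f = (\<lambda>is x. 0)" using that by (simp add: cond2_def)
    then show ?thesis unfolding cond1 by simp
  next
    case False
    then obtain v where v: "smooth_symmetric_tensor_field (m - k - 1) v" "f = (inner_derivative ^^ Suc k) v"
      "\<And>l is. l \<le> k \<Longrightarrow> ((inner_derivative ^^ l) v is \<longlongrightarrow> 0) at_infinity"
      using \<open>cond2\<close> by (auto simp: cond2_def)
    have "m - k - 1 + Suc k = m" using False km by simp
    then show ?thesis
      unfolding cond1 using potential_imp_moments_zero[where f = f and v = v, OF f v] by simp
  qed
  ultimately show ?thesis by blast
qed

end
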